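(* Let $h\in\mathcal H$ be twice continuously differentiable with bounded first and second derivatives, and suppose that $h^{(3)}$ exists and satisfies $|h^{(3)}|\le C(1+h^{-q})$ on $(0,r)$ for some constant $C$ and some $q\in[0,1)$. Suppose that $\sigma$ is bounded, let $X_0\in(0,r)$, and consider the BEM scheme $\widehat X$ associated with $h$. Then for any $T>0$ and $p\in[0,1)$ the following hold. (1) For each $m\in\mathbb N$, $$\sup_{t\le T,\,N}E^{h,X_0}\left(\frac1h(\widehat X_t)+\sum_{n=0}^{N-1}\int_{t_n}^{t_{n+1}}\frac{\sigma^2(\widehat X_{t_n})\,h^{-2-p}(\widehat X_s)}{H_x^2(t_n,\widehat X_{t_n};s,\widehat X_s)}ds+|\widehat X_t|^m\right)<\infty.$$ (2) For each $n$ and each integer $m\ge0$, $$\operatorname*{ess\,sup}_{\tau\in\mathcal T_n}E^{h,X_0}\Big(\frac1h(\widehat X_\tau)+\widehat X_\tau^m\,\Big|\,\mathcal F_{t_n}\Big)<\infty,$$ where $\mathcal T_n$ is the set of stopping times $\tau$ with $\tau\in[t_n,t_{n+1}]$, $Q^{h,X_0}$-a.s. (3) Suppose further that $p\le\frac12$ and that $\frac{h''}{h^{1-p}}$ is bounded. Then for each $m\ge0$ there is a constant $K$ independent of $N$ such that, for every $N$, $$E^{h,X_0}\left(\sum_{n=0}^{N-1}\int_{t_n}^{t_{n+1}}\left(1-\exp\Big((s-t_n)\sigma^2(\widehat X_{t_n})\frac{h''}{2h}(\widehat X_{t_n})\Big)\right)\frac{\sigma^2(\widehat X_{t_n})\big(h^{-p}(\widehat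 X_s)+\widehat X_s^m\big)}{H_x^2(t_n,\widehat X_{t_n};s,\widehat X_s)}ds\right)<\frac{KT}{N}.$$
   Context: Standing setting. Let $r\in(0,\infty]$. Under $P^x$, $X$ is a regular one-dimensional diffusion on $(0,r)$ with $X_0=x$ and $X_t=X_0+\int_0^t\sigma(X_s)dB_s$ for $t<\zeta$, $B$ a Brownian motion, killed at $\zeta=\inf\{t>0:X_t\notin(0,r)\}$. Standing assumptions: $\sigma:(0,r)\to(0,\infty)$ is continuously differentiable with bounded derivative; $\sigma(0+)$ exists and is finite, and so does $\sigma(r-)$ if $r<\infty$; $P^x(\zeta<\infty)>0$ for all $x\in(0,r)$; the boundary $0$ is accessible (reached in finite time with positive probability). Speed measure: $m(dx)=2\sigma^{-2}(x)dx$. Potential density: $u(x,y)=(x\wedge y)(1-\frac{x\vee y}{r})$ if $r<\infty$, $u(x,y)=x\wedge y$ if $r=\infty$. $\mathcal H_0$ is the set of functions $h(x)=\int_{(0,r)}u(x,y)f(y)m(dy)$, where $f:(0,r)\to(0,\infty)$ is continuous with $\int_{(0,r)}f\,dm<\infty$ and $\int_{(0,r)}yf(y)m(dy)<\infty$; such $h$ is concave, $C^2$, and $\frac12\sigma^2h''=-f$. If $r<\infty$, $\mathcal H:=\mathcal H_0$; if $r=\infty$, $\mathcal H:=\mathcal H_0\cup\{x\mapsto x\}$. For $h\in\mathcal H$ and $x\in(0,r)$, $Q^{h,x}$ (with expectation $E^{h,x}$) is the probability measure under which $X_0=x$, $X$ stays in $(0,r)$ for all times, and $dX_t=\sigma(X_t)dW_t+\sigma^2(X_t)\frac{h'(X_t)}{h(X_t)}dt$,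 with $W$ a $Q^{h,x}$-Brownian motion with respect to the filtration $(\mathcal F_t)$. BEM (backward Euler–Maruyama) scheme: for $T>0$ and an integer $N>1$, $t_n:=nT/N$, $\widehat X_0=X_0$, and for $n=0,\dots,N-1$ and $t\in(t_n,t_{n+1}]$, $\widehat X_t\in(0,r)$ is the unique solution of $$\widehat X_t=\widehat X_{t_n}+\sigma(\widehat X_{t_n})(W_t-W_{t_n})+(t-t_n)\sigma^2(\widehat X_{t_n})\frac{h'(\widehat X_t)}{h(\widehat X_t)}$$ (unique solvability holds because for every $z>0$ the map $x\mapsto x-z\,h'(x)/h(x)$ is a strictly increasing bijection from $(0,r)$ onto $\mathbb R$). $H(t_n,z;t,x):=x-\sigma^2(z)(t-t_n)\frac{h'}{h}(x)$ for $z,x\in(0,r)$, $t\in[t_n,t_{n+1}]$, and $H_x=\partial H/\partial x$ (so $H_x\ge1$). *)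

theory Defs
  imports "HOL-Probability.Probability"
begin

text \<open>Time is the half-line \<open>t \<ge> 0\<close> inside \<open>real\<close>. The values of a filtration at negative times
  carry no information: any filtration on the half-line extends by \<open>F t = F 0\<close>.\<close>

definition filtered_prob_space :: "'a measure \<Rightarrow> (real \<Rightarrow> 'a measure) \<Rightarrow> bool" where
  "filtered_prob_space M F \<longleftrightarrow>
     prob_space M \<and> filtration (space M) F \<and> (\<forall>t. subalgebra M (F t))"

definition adapted :: "(real \<Rightarrow> 'a measure) \<Rightarrow> (real \<Rightarrow> 'a \<Rightarrow> real) \<Rightarrow> bool" where
  "adapted F Y \<longleftrightarrow> (\<forall>t\<ge>0. Y t \<in> borel_measurable (F t))"

definition progressive :: "(real \<Rightarrow> 'a measure) \<Rightarrow> (real \<Rightarrow> 'a \<Rightarrow> real) \<Rightarrow> bool" where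
  "progressive F Y \<longleftrightarrow>
     (\<forall>t\<ge>0. (\<lambda>(s, \<omega>). Y s \<omega>) \<in> borel_measurable (restrict_space borel {0..t} \<Otimes>\<^sub>M F t))"

definition brownian_motion ::
  "'a measure \<Rightarrow> (real \<Rightarrow> 'a measure) \<Rightarrow> (real \<Rightarrow> 'a \<Rightarrow> real) \<Rightarrow> bool" where
  "brownian_motion M F W \<longleftrightarrow>
     adapted F W \<and>
     (\<forall>\<omega>\<in>space M. W 0 \<omega> = 0 \<and> continuous_on {0..} (\<lambda>t. W t \<omega>)) \<and>
     (\<forall>s t. 0 \<le> s \<and> s < t \<longrightarrow>
        distributed M lborel (\<lambda>\<omega>. W t \<omega> - W s \<omega>) (normal_density 0 (sqrt (t - s))) \<and>
        prob_space.indep_set M (sets (F s))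
          {(\<lambda>\<omega>. W t \<omega> - W s \<omega>) -` A \<inter> space M | A. A \<in> sets borel})"

text \<open>A simple integrand is \<open>\<Sum>i<k. \<xi> i * indicator {s i<..s (i+1)}\<close> with \<open>\<xi> i\<close> bounded and
  measurable for \<open>F (s i)\<close>.\<close>

definition simple_integrand ::
  "(real \<Rightarrow> 'a measure) \<Rightarrow> nat \<Rightarrow> (nat \<Rightarrow> real) \<Rightarrow> (nat \<Rightarrow> 'a \<Rightarrow> real) \<Rightarrow> bool" where
  "simple_integrand F k s \<xi> \<longleftrightarrow>
     (\<forall>i<k. 0 \<le> s i \<and> s i \<le> s (Suc i) \<and> \<xi> i \<in> borel_measurable (F (s i)) \<and>
        bounded (\<xi> i ` space (F (s i))))"

definition simple_value ::
  "nat \<Rightarrow> (nat \<Rightarrow> real) \<Rightarrow> (nat \<Rightarrow> 'a \<Rightarrow> real) \<Rightarrow> real \<Rightarrow> 'a \<Rightarrow> real" where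
  "simple_value k s \<xi> t \<omega> = (\<Sum>i<k. \<xi> i \<omega> * indicator {s i<..s (Suc i)} t)"

definition simple_integral ::
  "(real \<Rightarrow> 'a \<Rightarrow> real) \<Rightarrow> nat \<Rightarrow> (nat \<Rightarrow> real) \<Rightarrow> (nat \<Rightarrow> 'a \<Rightarrow> real) \<Rightarrow> real \<Rightarrow> 'a \<Rightarrow> real" where
  "simple_integral W k s \<xi> t \<omega> =
     (\<Sum>i<k. \<xi> i \<omega> * (W (min t (s (Suc i))) \<omega> - W (min t (s i)) \<omega>))"

text \<open>\<open>I\<close> is (a continuous version of) the process \<open>\<integral>\<^sub>0\<^sup>t Y dW\<close>: for some simple integrands \<open>S j\<close>
  with \<open>\<integral>\<^sub>0\<^sup>t (S j - Y)\<^sup>2 ds\<close> tending to 0 in probability, the elementary integrals of \<open>S j\<close>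
  tend to \<open>I t\<close> in probability. This determines \<open>I\<close> up to indistinguishability, and such \<open>S j\<close>
  exist exactly if \<open>\<integral>\<^sub>0\<^sup>t Y\<^sup>2 ds\<close> is almost surely finite for all \<open>t\<close>.\<close>

definition has_ito_integral ::
  "'a measure \<Rightarrow> (real \<Rightarrow> 'a measure) \<Rightarrow> (real \<Rightarrow> 'a \<Rightarrow> real) \<Rightarrow>
   (real \<Rightarrow> 'a \<Rightarrow> real) \<Rightarrow> (real \<Rightarrow> 'a \<Rightarrow> real) \<Rightarrow> bool" where
  "has_ito_integral M F W Y I \<longleftrightarrow>
     progressive F Y \<and>
     (\<forall>t\<ge>0. I t \<in> borel_measurable M) \<and>
     (AE \<omega> in M. continuous_on {0..} (\<lambda>t. I t \<omega>)) \<and>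
     (\<exists>k s \<xi>. (\<forall>j::nat. simple_integrand F (k j) (s j) (\<xi> j)) \<and>
        (\<forall>t\<ge>0. \<forall>\<epsilon>>0.
           (\<lambda>j. measure M {\<omega> \<in> space M.
              ennreal \<epsilon> < (\<integral>\<^sup>+ u\<in>{0..t}. ennreal ((simple_value (k j) (s j) (\<xi> j) u \<omega> - Y u \<omega>)\<^sup>2) \<partial>lborel)})
             \<longlonglongrightarrow> 0 \<and>
           (\<lambda>j. measure M {\<omega> \<in> space M.
              \<epsilon> < \<bar>simple_integral W (k j) (s j) (\<xi> j) t \<omega> - I t \<omega>\<bar>}) \<longlonglongrightarrow> 0))"

text \<open>The essential supremum of a family of random variables, itself a random variable that is
  unique up to null sets. (The library's \<open>esssup\<close> is the essential supremum of one function.)\<close>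

definition is_ess_sup :: "'a measure \<Rightarrow> ('a \<Rightarrow> ennreal) set \<Rightarrow> ('a \<Rightarrow> ennreal) \<Rightarrow> bool" where
  "is_ess_sup M \<Phi> Z \<longleftrightarrow>
     Z \<in> borel_measurable M \<and> (\<forall>f\<in>\<Phi>. AE \<omega> in M. f \<omega> \<le> Z \<omega>) \<and>
     (\<forall>Z'\<in>borel_measurable M. (\<forall>f\<in>\<Phi>. AE \<omega> in M. f \<omega> \<le> Z' \<omega>) \<longrightarrow> (AE \<omega> in M. Z \<omega> \<le> Z' \<omega>))"

definition state_space :: "ereal \<Rightarrow> real set" where
  "state_space r = {x. 0 < x \<and> ereal x < r}"

text \<open>A killed path is a real-valued path which takes values outside \<open>(0, r)\<close> from the lifetime on;
  these values play the role of the cemetery state.\<close>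

definition lifetime :: "ereal \<Rightarrow> (real \<Rightarrow> 'a \<Rightarrow> real) \<Rightarrow> 'a \<Rightarrow> ereal" where
  "lifetime r X \<omega> = Inf {ereal t | t. 0 < t \<and> X t \<omega> \<notin> state_space r}"

definition killed_solution ::
  "ereal \<Rightarrow> (real \<Rightarrow> real) \<Rightarrow> real \<Rightarrow> 'a measure \<Rightarrow> (real \<Rightarrow> 'a measure) \<Rightarrow>
   (real \<Rightarrow> 'a \<Rightarrow> real) \<Rightarrow> bool" where
  "killed_solution r \<sigma> x M F X \<longleftrightarrow>
     filtered_prob_space M F \<and> adapted F X \<and>
     (AE \<omega> in M. X 0 \<omega> = x \<and> 0 < lifetime r X \<omega> \<and>
        continuous_on {t. 0 \<le> t \<and> ereal t < lifetime r X \<omega>} (\<lambda>t. X t \<omega>) \<and>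
        (\<forall>t\<ge>0. lifetime r X \<omega> \<le> ereal t \<longrightarrow> X t \<omega> \<notin> state_space r)) \<and>
     (\<exists>B I. brownian_motion M F B \<and>
        has_ito_integral M F B (\<lambda>s \<omega>. if ereal s < lifetime r X \<omega> then \<sigma> (X s \<omega>) else 0) I \<and>
        (AE \<omega> in M. \<forall>t\<ge>0. ereal t < lifetime r X \<omega> \<longrightarrow> X t \<omega> = x + I t \<omega>))"

text \<open>The semigroup of the killed process: \<open>E\<^sup>x [f (X\<^sub>s); s < \<zeta>]\<close>.\<close>

definition killed_semigroup ::
  "ereal \<Rightarrow> (real \<Rightarrow> 'a measure) \<Rightarrow> (real \<Rightarrow> 'a \<Rightarrow> real) \<Rightarrow> real \<Rightarrow> (real \<Rightarrow> ennreal) \<Rightarrow> real \<Rightarrow> ennreal"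
  where
  "killed_semigroup r P X s f x =
     (\<integral>\<^sup>+ \<omega>. f (X s \<omega>) * indicator {\<omega>. ereal s < lifetime r X \<omega>} \<omega> \<partial>P x)"

definition strong_markov ::
  "ereal \<Rightarrow> (real \<Rightarrow> 'a measure) \<Rightarrow> (real \<Rightarrow> 'a measure) \<Rightarrow> (real \<Rightarrow> 'a \<Rightarrow> real) \<Rightarrow> bool" where
  "strong_markov r P F X \<longleftrightarrow>
     (\<forall>f\<in>borel_measurable borel. \<forall>s\<ge>0.
        killed_semigroup r P X s f \<in> borel_measurable (restrict_space borel (state_space r)) \<and>
        (\<forall>x\<in>state_space r. \<forall>\<tau>. stopping_time F \<tau> \<and> (\<forall>\<omega>. 0 \<le> \<tau> \<omega>) \<longrightarrow>
          (\<forall>A\<in>sets (filtration.pre_sigma (space (P x)) F \<tau>).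
            (\<integral>\<^sup>+ \<omega>\<in>A. f (X (\<tau> \<omega> + s) \<omega>)
                * indicator {\<omega>. ereal (\<tau> \<omega> + s) < lifetime r X \<omega>} \<omega> \<partial>P x) =
            (\<integral>\<^sup>+ \<omega>\<in>A. killed_semigroup r P X s f (X (\<tau> \<omega>) \<omega>)
                * indicator {\<omega>. ereal (\<tau> \<omega>) < lifetime r X \<omega>} \<omega> \<partial>P x))))"

text \<open>Events of positive probability below are in particular measurable, since \<open>measure\<close> is 0
  outside the sigma-algebra.\<close>

definition regular_diffusion ::
  "ereal \<Rightarrow> (real \<Rightarrow> real) \<Rightarrow> (real \<Rightarrow> 'a measure) \<Rightarrow> (real \<Rightarrow> 'a measure) \<Rightarrow>
   (real \<Rightarrow> 'a \<Rightarrow> real) \<Rightarrow> bool" where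
  "regular_diffusion r \<sigma> P F X \<longleftrightarrow>
     (\<forall>x\<in>state_space r. \<forall>y\<in>state_space r. sets (P x) = sets (P y)) \<and>
     (\<forall>x\<in>state_space r. killed_solution r \<sigma> x (P x) F X) \<and>
     strong_markov r P F X \<and>
     (\<forall>x\<in>state_space r. \<forall>y\<in>state_space r.
        0 < measure (P x) {\<omega> \<in> space (P x). \<exists>t\<ge>0. ereal t < lifetime r X \<omega> \<and> X t \<omega> = y})"

definition zero_accessible ::
  "ereal \<Rightarrow> (real \<Rightarrow> 'a measure) \<Rightarrow> (real \<Rightarrow> 'a \<Rightarrow> real) \<Rightarrow> bool" where
  "zero_accessible r P X \<longleftrightarrow>
     (\<forall>x\<in>state_space r. 0 < measure (P x) {\<omega> \<in> space (P x). lifetime r X \<omega> < \<infinity> \<and>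
        ((\<lambda>t. X t \<omega>) \<longlongrightarrow> 0) (at_left (real_of_ereal (lifetime r X \<omega>)))})"

definition admissible_coefficient :: "ereal \<Rightarrow> (real \<Rightarrow> real) \<Rightarrow> bool" where
  "admissible_coefficient r \<sigma> \<longleftrightarrow>
     (\<forall>x\<in>state_space r. 0 < \<sigma> x \<and> \<sigma> differentiable (at x)) \<and>
     continuous_on (state_space r) (deriv \<sigma>) \<and> bounded (deriv \<sigma> ` state_space r) \<and>
     (\<exists>l. (\<sigma> \<longlongrightarrow> l) (at_right 0)) \<and>
     (r < \<infinity> \<longrightarrow> (\<exists>l. (\<sigma> \<longlongrightarrow> l) (at_left (real_of_ereal r))))"

definition standing_setting ::
  "ereal \<Rightarrow> (real \<Rightarrow> real) \<Rightarrow> (real \<Rightarrow> 'a measure) \<Rightarrow> (real \<Rightarrow> 'a measure) \<Rightarrow>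
   (real \<Rightarrow> 'a \<Rightarrow> real) \<Rightarrow> bool" where
  "standing_setting r \<sigma> P F X \<longleftrightarrow>
     0 < r \<and> admissible_coefficient r \<sigma> \<and> regular_diffusion r \<sigma> P F X \<and>
     (\<forall>x\<in>state_space r. 0 < measure (P x) {\<omega> \<in> space (P x). lifetime r X \<omega> < \<infinity>}) \<and>
     zero_accessible r P X"

definition speed_measure :: "ereal \<Rightarrow> (real \<Rightarrow> real) \<Rightarrow> real measure" where
  "speed_measure r \<sigma> = density lborel (\<lambda>x. ennreal (2 / (\<sigma> x)\<^sup>2) * indicator (state_space r) x)"

definition potential_density :: "ereal \<Rightarrow> real \<Rightarrow> real \<Rightarrow> real" where
  "potential_density r x y =
     (if r = \<infinity> then min x y else min x y * (1 - max x y / real_of_ereal r))"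

text \<open>Functions on \<open>(0, r)\<close> are total functions whose values elsewhere are irrelevant.\<close>

definition H0_class :: "ereal \<Rightarrow> (real \<Rightarrow> real) \<Rightarrow> (real \<Rightarrow> real) set" where
  "H0_class r \<sigma> = {h. \<exists>f.
     continuous_on (state_space r) f \<and> (\<forall>y\<in>state_space r. 0 < f y) \<and>
     set_integrable (speed_measure r \<sigma>) (state_space r) f \<and>
     set_integrable (speed_measure r \<sigma>) (state_space r) (\<lambda>y. y * f y) \<and>
     (\<forall>x\<in>state_space r.
        h x = (LINT y:state_space r|speed_measure r \<sigma>. potential_density r x y * f y))}"

definition H_class :: "ereal \<Rightarrow> (real \<Rightarrow> real) \<Rightarrow> (real \<Rightarrow> real) set" where
  "H_class r \<sigma> =
     (if r < \<infinity> then H0_class r \<sigma> else H0_class r \<sigma> \<union> {h. \<forall>x\<in>state_space r. h x = x})"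

text \<open>\<open>M\<close> is \<open>Q\<^sup>h\<^sup>,\<^sup>x\<close>, with \<open>X\<close> driven by the Brownian motion \<open>W\<close>. The case distinction only matters
  on the null set where \<open>X\<close> leaves \<open>(0, r)\<close>.\<close>

definition h_transform ::
  "ereal \<Rightarrow> (real \<Rightarrow> real) \<Rightarrow> (real \<Rightarrow> real) \<Rightarrow> real \<Rightarrow> 'a measure \<Rightarrow> (real \<Rightarrow> 'a measure) \<Rightarrow>
   (real \<Rightarrow> 'a \<Rightarrow> real) \<Rightarrow> (real \<Rightarrow> 'a \<Rightarrow> real) \<Rightarrow> bool" where
  "h_transform r \<sigma> h x M F W X \<longleftrightarrow>
     filtered_prob_space M F \<and> brownian_motion M F W \<and> adapted F X \<and>
     (AE \<omega> in M. X 0 \<omega> = x \<and> (\<forall>t\<ge>0. X t \<omega> \<in> state_space r) \<and>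
        continuous_on {0..} (\<lambda>t. X t \<omega>)) \<and>
     (\<exists>I. has_ito_integral M F W (\<lambda>s \<omega>. if X s \<omega> \<in> state_space r then \<sigma> (X s \<omega>) else 0) I \<and>
        (AE \<omega> in M. \<forall>t\<ge>0. X t \<omega> =
           x + I t \<omega> + (LBINT s:{0..t}. (\<sigma> (X s \<omega>))\<^sup>2 * (deriv h (X s \<omega>) / h (X s \<omega>)))))"

definition grid :: "real \<Rightarrow> nat \<Rightarrow> nat \<Rightarrow> real" where
  "grid T N n = real n * T / real N"

text \<open>One implicit step of length \<open>d\<close> from \<open>z\<close> with Brownian increment \<open>w\<close>.\<close>

definition bem_step ::
  "ereal \<Rightarrow> (real \<Rightarrow> real) \<Rightarrow> (real \<Rightarrow> real) \<Rightarrow> real \<Rightarrow> real \<Rightarrow> real \<Rightarrow> real" where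
  "bem_step r \<sigma> h z w d =
     (THE y. y \<in> state_space r \<and> y = z + \<sigma> z * w + d * (\<sigma> z)\<^sup>2 * (deriv h y / h y))"

primrec bem_grid ::
  "ereal \<Rightarrow> (real \<Rightarrow> real) \<Rightarrow> (real \<Rightarrow> real) \<Rightarrow> real \<Rightarrow> (real \<Rightarrow> 'a \<Rightarrow> real) \<Rightarrow> real \<Rightarrow> nat \<Rightarrow>
   nat \<Rightarrow> 'a \<Rightarrow> real" where
  "bem_grid r \<sigma> h x0 W T N 0 \<omega> = x0"
| "bem_grid r \<sigma> h x0 W T N (Suc n) \<omega> =
     bem_step r \<sigma> h (bem_grid r \<sigma> h x0 W T N n \<omega>)
       (W (grid T N (Suc n)) \<omega> - W (grid T N n) \<omega>) (grid T N (Suc n) - grid T N n)"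

text \<open>For \<open>t > 0\<close> the index \<open>n\<close> below is the one with \<open>grid T N n < t \<le> grid T N (Suc n)\<close>. The scheme
  only matters on \<open>[0, T]\<close>; continuing it in the same way beyond \<open>T\<close>, and by \<open>x0\<close> to negative times,
  gives it continuous paths on the whole line, so that it can be evaluated at stopping times
  which lie in \<open>[0, T]\<close> only almost surely.\<close>

definition bem ::
  "ereal \<Rightarrow> (real \<Rightarrow> real) \<Rightarrow> (real \<Rightarrow> real) \<Rightarrow> real \<Rightarrow> (real \<Rightarrow> 'a \<Rightarrow> real) \<Rightarrow> real \<Rightarrow> nat \<Rightarrow>
   real \<Rightarrow> 'a \<Rightarrow> real" where
  "bem r \<sigma> h x0 W T N t \<omega> =
     (if t \<le> 0 then x0
      else let n = nat (\<lceil>t * real N / T\<rceil> - 1); z = bem_grid r \<sigma> h x0 W T N n \<omega>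
           in bem_step r \<sigma> h z (W t \<omega> - W (grid T N n) \<omega>) (t - grid T N n))"

definition bem_H ::
  "(real \<Rightarrow> real) \<Rightarrow> (real \<Rightarrow> real) \<Rightarrow> real \<Rightarrow> real \<Rightarrow> real \<Rightarrow> real \<Rightarrow> real" where
  "bem_H \<sigma> h tn z t x = x - (\<sigma> z)\<^sup>2 * (t - tn) * (deriv h x / h x)"

definition bem_Hx ::
  "(real \<Rightarrow> real) \<Rightarrow> (real \<Rightarrow> real) \<Rightarrow> real \<Rightarrow> real \<Rightarrow> real \<Rightarrow> real \<Rightarrow> real" where
  "bem_Hx \<sigma> h tn z t x = deriv (bem_H \<sigma> h tn z t) x"

definition interval_stopping_times ::
  "'a measure \<Rightarrow> (real \<Rightarrow> 'a measure) \<Rightarrow> real \<Rightarrow> real \<Rightarrow> ('a \<Rightarrow> real) set" where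
  "interval_stopping_times M F a b = {\<tau>. stopping_time F \<tau> \<and> (AE \<omega> in M. \<tau> \<omega> \<in> {a..b})}"

end

theory Submission
  imports Defs "HOL-Real_Asymp.Real_Asymp"
begin

text \<open>Let \<open>g = h'/h\<close>. A step of length \<open>d\<close> from \<open>z\<close> ends below \<open>y\<close> iff the normalised Brownian
  increment is at most \<open>(y - z - c\<^sup>2 d g(y)) / (c \<surd>d)\<close>, where \<open>c = \<sigma>(z)\<close>. The law of a step is thus explicit, and
  Ito's formula for a function \<open>U\<close> of the step reduces to an integration by parts in \<open>y\<close>. For
  \<open>U = h\<^sup>-\<^sup>p\<close> with \<open>0 < p < 1\<close> the drift is at most \<open>c\<^sup>2 (K - a h\<^sup>-\<^sup>2\<^sup>-\<^sup>p) / H\<^sub>x\<^sup>2\<close> with \<open>a > 0\<close>: here \<open>h'\<close> stays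
  away from \<open>0\<close> near the boundary, \<open>H\<^sub>x \<ge> 1 + c\<^sup>2 d g\<^sup>2\<close>, and \<open>q < 1\<close> makes the term with the third
  derivative of lower order. Summing over the steps bounds the integral in (1). The drift of \<open>1/h\<close>
  is at most a multiple of \<open>c\<^sup>2 (1 + h\<^sup>-\<^sup>2\<^sup>-\<^sup>p) / H\<^sub>x\<^sup>2\<close>, hence bounded in expectation by that integral, and
  the polynomial moments follow from \<open>x g(x) \<le> 1\<close>, which gives
  \<open>X\<^sup>2 \<le> (z + c w)\<^sup>2 + 2 c\<^sup>2 d\<close> for a step \<open>X\<close> with increment \<open>w\<close>. Part (3) follows from (1) by
  \<open>1 - e\<^sup>-\<^sup>x \<le> x\<close>.
  For (2), concavity of \<open>h\<close> gives the pathwise estimate \<open>1/h(X) \<le> C(z) (1 + w\<^sup>6/d)\<close>, and dyadic chaining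
  provides an integrable random variable \<open>K\<close> with \<open>w\<^sup>2\<^sup>k \<le> K d\<close> for all times \<open>d\<close> in the step at once.\<close>

subsection \<open>The implicit step\<close>

text \<open>Probability enters through Gaussian increments independent of the past and through path
  continuity; the rest is calculus in \<open>y\<close> and \<open>t\<close>. The drift of h^-p has
  leading coefficient -p (1 - p)/2, which vanishes at p = 0 and p = 1. Hence the integral in (1) is
  first bounded for exponents strictly inside (0, 1); p = 0 follows from a larger exponent, and 1/h,
  without a negative drift of its own, borrows from the integral with an exponent in [q, 1). In (2)
  bounds at fixed times do not suffice, since a stopping time may choose its instant within the
  step. Near the boundary 1/h is at most a multiple of w^2/d, which is of no use as d tends to 0;
  but getting there also forces |w| above a multiple of h(z)/\<sigma>(z), and the fourth power of
  that ratio turns the bound into w^6/d.\<close>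

lemma open_state_space: "open (state_space r)"
proof -
  have "state_space r = {0<..} \<inter> {x. ereal x < r}" by (auto simp: state_space_def)
  moreover have "open {x. ereal x < r}"
    by (intro open_Collect_less continuous_intros)
  ultimately show ?thesis by (simp add: open_Int)
qed

text \<open>Concavity is recorded as the tangent inequality, and the decay of h at 0 and at a finite
  r as linear bounds. One constant \<open>L\<close> serves for these bounds and for both
  derivatives.\<close>

locale bem_profile =
  fixes r :: ereal and h h1 h2 h3 :: "real \<Rightarrow> real" and L C q :: real
  assumes r_pos: "0 < r"
    and h_pos: "x \<in> state_space r \<Longrightarrow> 0 < h x"
    and h_D1: "x \<in> state_space r \<Longrightarrow> (h has_real_derivative h1 x) (at x)"
    and h_D2: "x \<in> state_space r \<Longrightarrow> (h1 has_real_derivative h2 x) (at x)"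
    and h_D3: "x \<in> state_space r \<Longrightarrow> (h2 has_real_derivative h3 x) (at x)"
    and h1_bound: "x \<in> state_space r \<Longrightarrow> \<bar>h1 x\<bar> \<le> L"
    and h2_bound: "x \<in> state_space r \<Longrightarrow> \<bar>h2 x\<bar> \<le> L"
    and h3_bound: "x \<in> state_space r \<Longrightarrow> \<bar>h3 x\<bar> \<le> C * (1 + h x powr (- q))"
    and q_nonneg: "0 \<le> q" and q_less_1: "q < 1"
    and h_tangent: "x \<in> state_space r \<Longrightarrow> t \<in> state_space r \<Longrightarrow> h t \<le> h x + h1 x * (t - x)"
    and h_le_left: "x \<in> state_space r \<Longrightarrow> h x \<le> L * x"
    and h_le_right: "x \<in> state_space r \<Longrightarrow> r < \<infinity> \<Longrightarrow> h x \<le> L * (real_of_ereal r - x)"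
    and h_mono: "r = \<infinity> \<Longrightarrow> x \<in> state_space r \<Longrightarrow> x \<le> t \<Longrightarrow> h x \<le> h t"
begin

abbreviation "S \<equiv> state_space r"

text \<open>\<open>Hs (\<sigma>\<^sup>2(z) (t - t\<^sub>n))\<close> is the derivative \<open>H\<^sub>x(t\<^sub>n, z; t, \<cdot>)\<close>, see \<open>bem_Hx_eq\<close>.\<close>

definition "g x = h1 x / h x"
definition "g1 x = h2 x / h x - (g x)\<^sup>2"
definition "g2 x = h3 x / h x - 3 * g x * h2 x / h x + 2 * (g x)^3"
definition "Hs s x = 1 - s * g1 x"

lemma state_pos: "x \<in> S \<Longrightarrow> 0 < x"
  by (simp add: state_space_def)

lemma S_between: "a \<in> S \<Longrightarrow> b \<in> S \<Longrightarrow> a \<le> x \<Longrightarrow> x \<le> b \<Longrightarrow> x \<in> S"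
  by (auto simp: state_space_def) (meson ereal_less_eq(3) order_le_less_trans)

lemma S_below: "b \<in> S \<Longrightarrow> 0 < x \<Longrightarrow> x \<le> b \<Longrightarrow> x \<in> S"
  by (auto simp: state_space_def) (meson ereal_less_eq(3) order_le_less_trans)

lemma S_infinite: "r = \<infinity> \<Longrightarrow> x \<in> S \<longleftrightarrow> 0 < x"
  by (auto simp: state_space_def)

lemma S_finite: "r < \<infinity> \<Longrightarrow> x \<in> S \<longleftrightarrow> 0 < x \<and> x < real_of_ereal r"
  using r_pos by (cases r) (auto simp: state_space_def)

lemma S_nonempty: "\<exists>y. y \<in> S"
proof (cases "r = \<infinity>")
  case True then show ?thesis using S_infinite[of 1] by (intro exI[of _ 1]) simp
next
  case False
  then show ?thesis using S_finite[of "real_of_ereal r / 2"] r_pos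
    by (intro exI[of _ "real_of_ereal r / 2"]) (cases r; auto)
qed

lemma L_pos: "0 < L"
proof -
  obtain y where y: "y \<in> S" using S_nonempty by blast
  have "0 < L * y" using h_pos[OF y] h_le_left[OF y] by linarith
  then show ?thesis using state_pos[OF y] by (simp add: zero_less_mult_iff)
qed

section \<open>Concavity and the slope of h near the boundary\<close>

lemma h1_antimono: "x \<in> S \<Longrightarrow> t \<in> S \<Longrightarrow> x \<le> t \<Longrightarrow> h1 t \<le> h1 x"
proof (cases "x = t")
  case False
  assume a: "x \<in> S" "t \<in> S" "x \<le> t"
  have "0 \<le> (h1 x - h1 t) * (t - x)"
    using h_tangent[OF a(1,2)] h_tangent[OF a(2,1)] by (simp add: algebra_simps)
  then show ?thesis using a False by (simp add: zero_le_mult_iff)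
qed simp

lemma h2_nonpos: assumes "x \<in> S" shows "h2 x \<le> 0"
proof (rule ccontr)
  assume "\<not> h2 x \<le> 0"
  then obtain d where d: "d > 0" "\<And>e. 0 < e \<Longrightarrow> e < d \<Longrightarrow> h1 x < h1 (x + e)"
    using DERIV_pos_inc_right[OF h_D2[OF assms]] by auto
  obtain e where e: "e > 0" "ball x e \<subseteq> S" using open_state_space assms openE by blast
  define k where "k = min d e / 2"
  have "x + k \<in> S" using e d(1) by (auto simp: k_def subset_iff dist_real_def min_def)
  moreover have "0 < k" "k < d" using e d(1) by (auto simp: k_def)
  ultimately show False using d(2)[of k] h1_antimono[OF assms, of "x + k"] by simp
qed

text \<open>A positive concave function lies below its tangent at x, so a tangent with positive
  slope cannot have its zero x - h(x)/h'(x) inside (0, x).\<close>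

lemma x_g_le_1: assumes "x \<in> S" shows "x * g x \<le> 1"
proof -
  have "x * h1 x \<le> h x"
  proof (rule ccontr)
    assume "\<not> x * h1 x \<le> h x"
    then have pos: "0 < x * h1 x - h x" by simp
    then have "0 < x * h1 x" using h_pos[OF assms] by linarith
    then have h1p: "0 < h1 x" using state_pos[OF assms] by (simp add: zero_less_mult_iff)
    \<comment> \<open>Up to \<open>(x * h1 x - h x) / h1 x\<close> the tangent at x is nonpositive;
      the minimum with x keeps t in the state space.\<close>
    define t where "t = min x ((x * h1 x - h x) / h1 x)"
    have t: "0 < t" "t \<le> x" using pos h1p state_pos[OF assms] by (auto simp: t_def)
    have "t * h1 x \<le> x * h1 x - h x" using h1p by (simp add: t_def min_def field_simps)
    then have "h t \<le> 0" using h_tangent[OF assms S_below[OF assms t]] by (simp add: algebra_simps)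
    then show False using h_pos[OF S_below[OF assms t]] by simp
  qed
  then show ?thesis using h_pos[OF assms] by (simp add: g_def)
qed

lemma g1_le: "x \<in> S \<Longrightarrow> g1 x \<le> - (g x)\<^sup>2"
  using h2_nonpos[of x] h_pos[of x] by (simp add: g1_def divide_nonpos_pos)

text \<open>Since h'' <= 0, g' is at most -g^2. Thus H_x is large wherever the drift g is large,
  which later pays for the derivatives of g.\<close>

lemma Hs_ge: assumes "x \<in> S" "0 \<le> s" shows "1 + s * (g x)\<^sup>2 \<le> Hs s x"
  using mult_left_mono[OF g1_le[OF assms(1)] assms(2)] by (simp add: Hs_def)

lemma Hs_ge_1: assumes "x \<in> S" "0 \<le> s" shows "1 \<le> Hs s x"
  using Hs_ge[OF assms] assms(2) by (smt (verit) mult_nonneg_nonneg zero_le_power2)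

lemma g_deriv: assumes "x \<in> S" shows "(g has_real_derivative g1 x) (at x)"
  unfolding g_def [abs_def] g1_def
  by (rule derivative_eq_intros h_D1 h_D2 assms h_pos[OF assms, THEN less_imp_neq, symmetric] refl)+
     (use h_pos[OF assms] in \<open>simp add: field_simps power2_eq_square\<close>)

lemma g1_deriv: assumes "x \<in> S" shows "(g1 has_real_derivative g2 x) (at x)"
proof -
  have "((\<lambda>x. h2 x / h x - (g x)\<^sup>2) has_real_derivative g2 x) (at x)"
    by (rule derivative_eq_intros h_D1 h_D3 g_deriv assms h_pos[OF assms, THEN less_imp_neq, symmetric] refl)+
       (use h_pos[OF assms] in \<open>simp add: g2_def g1_def g_def field_simps power2_eq_square power3_eq_cube\<close>)
  then show ?thesis by (simp add: g1_def[abs_def])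
qed

lemma step_deriv: assumes "x \<in> S"
  shows "((\<lambda>y. y - s * g y) has_real_derivative Hs s x) (at x)"
  unfolding Hs_def by (rule derivative_eq_intros g_deriv assms refl)+ simp

lemma continuous_h: "continuous_on S h"
  and continuous_g: "continuous_on S g"
  and continuous_g1: "continuous_on S g1"
  by (meson DERIV_isCont continuous_at_imp_continuous_on h_D1 h_D2 h_D3 g_deriv g1_deriv)+

lemma step_strict_mono:
  assumes "x \<in> S" "y \<in> S" "x < y" "0 \<le> s"
  shows "x - s * g x < y - s * g y"
proof (rule DERIV_pos_imp_increasing[OF assms(3)])
  fix t assume "x \<le> t" "t \<le> y"
  then have "t \<in> S" using S_between assms by blast
  then show "\<exists>y. ((\<lambda>x. x - s * g x) has_real_derivative y) (at t) \<and> 0 < y"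
    using step_deriv[of t s] Hs_ge_1[of t s] assms(4) by (intro exI[of _ "Hs s t"]) auto
qed

text \<open>The tangent at y, evaluated at a fixed y0, is at least h(y0). If h(y) is at most half of
  that, slope times distance supplies the other half, and the distance is at most
  \<open>max y0 R\<close>; this is the origin of \<open>c1\<close>. To the right of y0 this needs a
  finite r, because for infinite r h does not decrease.\<close>

lemma boundary_slope:
  obtains y0 c1 where "y0 \<in> S" "0 < c1"
    "\<And>y. y \<in> S \<Longrightarrow> y \<le> y0 \<Longrightarrow> h y \<le> h y0 / 2 \<Longrightarrow> c1 \<le> h1 y"
    "\<And>y. y \<in> S \<Longrightarrow> y0 \<le> y \<Longrightarrow> h y \<le> h y0 / 2 \<Longrightarrow> r < \<infinity> \<and> h1 y \<le> - c1"
proof -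
  obtain y0 where y0: "y0 \<in> S" using S_nonempty by blast
  define R where "R = (if r = \<infinity> then 1 else real_of_ereal r)"
  have R: "0 < R" using r_pos by (cases r) (auto simp: R_def)
  define c1 where "c1 = h y0 / (2 * max y0 R)"
  have c1: "0 < c1" using h_pos[OF y0] R state_pos[OF y0] by (auto simp: c1_def)
  have key: "h y0 / 2 \<le> h1 y * (y0 - y)" if "y \<in> S" "h y \<le> h y0 / 2" for y
    using h_tangent[OF that(1) y0] that(2) by simp
  have 1: "c1 \<le> h1 y" if y: "y \<in> S" "y \<le> y0" "h y \<le> h y0 / 2" for y
  proof -
    have "0 < h1 y * (y0 - y)" using key[OF y(1,3)] h_pos[OF y0] by linarith
    then have p: "0 < h1 y" using y by (simp add: zero_less_mult_iff)
    have "h y0 / 2 \<le> h1 y * max y0 R"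
    proof -
      have "h1 y * (y0 - y) \<le> h1 y * max y0 R"
        by (intro mult_left_mono) (use p state_pos[OF y(1)] in auto)
      then show ?thesis using key[OF y(1,3)] by linarith
    qed
    then show ?thesis using R by (simp add: c1_def field_simps)
  qed
  have 2: "r < \<infinity> \<and> h1 y \<le> - c1" if y: "y \<in> S" "y0 \<le> y" "h y \<le> h y0 / 2" for y
  proof -
    have r: "r < \<infinity>"
    proof (rule ccontr)
      assume "\<not> r < \<infinity>" then have "h y0 \<le> h y" using h_mono[of y0 y] y0 y by auto
      then show False using y h_pos[OF y0] by simp
    qed
    have "0 < h1 y * (y0 - y)" using key[OF y(1,3)] h_pos[OF y0] by linarith
    then have p: "h1 y < 0" using y by (simp add: zero_less_mult_iff)
    have "y < R" using S_finite[OF r] y r by (auto simp: R_def)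
    then have "y - y0 \<le> max y0 R" using state_pos[OF y0] by auto
    then have "h y0 / 2 \<le> - h1 y * max y0 R"
    proof -
      have "(- h1 y) * (y - y0) \<le> (- h1 y) * max y0 R"
        by (intro mult_left_mono) (use p \<open>y - y0 \<le> max y0 R\<close> in auto)
      moreover have "(- h1 y) * (y - y0) = h1 y * (y0 - y)" by (simp add: algebra_simps)
      ultimately show ?thesis using key[OF y(1,3)] by linarith
    qed
    then show ?thesis using R r by (simp add: c1_def field_simps)
  qed
  show ?thesis by (rule that[OF y0 c1 1 2]) auto
qed

lemma near_left: assumes "0 < e" shows "\<exists>\<delta>>0. \<forall>y\<in>S. y \<le> \<delta> \<longrightarrow> h y \<le> e"
  using assms L_pos order_trans[OF h_le_left]
  by (intro exI[of _ "e / L"]) (auto simp: field_simps)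

text \<open>At a finite end h is at most L times the distance while |h'| >= c1, so s |g| grows like
  the inverse distance and passes every level; at infinity g <= 1/y keeps the drift bounded. The
  intermediate value theorem applies between two such points.\<close>

lemma step_bij:
  assumes s: "0 < s"
  shows "\<exists>y\<in>S. y - s * g y = a"
proof -
  obtain y0 c1 where y0: "y0 \<in> S" and c1: "0 < c1"
    and left: "\<And>y. y \<in> S \<Longrightarrow> y \<le> y0 \<Longrightarrow> h y \<le> h y0 / 2 \<Longrightarrow> c1 \<le> h1 y"
    and right: "\<And>y. y \<in> S \<Longrightarrow> y0 \<le> y \<Longrightarrow> h y \<le> h y0 / 2 \<Longrightarrow> r < \<infinity> \<and> h1 y \<le> - c1"
    using boundary_slope by blast
  obtain \<delta> where \<delta>: "0 < \<delta>" "\<And>y. y \<in> S \<Longrightarrow> y \<le> \<delta> \<Longrightarrow> h y \<le> h y0 / 2"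
    using near_left[of "h y0 / 2"] h_pos[OF y0] by auto
  have lo: "\<exists>y\<in>S. y \<le> y0 \<and> y - s * g y \<le> a"
  proof -
    \<comment> \<open>The last bound forces \<open>s * g y \<ge> \<bar>a\<bar> + 1\<close>, and y <=
      1 then gives y - s g(y) <= a.\<close>
    define y where "y = min (min y0 \<delta>) (min 1 (s * c1 / (L * (\<bar>a\<bar> + 1))))"
    have yp: "0 < y" using state_pos[OF y0] \<delta>(1) s c1 L_pos by (auto simp: y_def)
    have yS: "y \<in> S" using S_below[OF y0 yp] by (auto simp: y_def)
    have "c1 \<le> h1 y" using left[OF yS] \<delta>(2)[OF yS] by (auto simp: y_def)
    then have "c1 / (L * y) \<le> h1 y / h y"
      using h_le_left[OF yS] h_pos[OF yS] c1 by (intro frac_le) auto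
    then have 1: "s * (c1 / (L * y)) \<le> s * g y" unfolding g_def using s by (intro mult_left_mono) auto
    have "0 < L * (\<bar>a\<bar> + 1)" using L_pos by (simp add: add_nonneg_pos)
    moreover have "y \<le> s * c1 / (L * (\<bar>a\<bar> + 1))" by (simp add: y_def)
    ultimately have "y * (L * (\<bar>a\<bar> + 1)) \<le> s * c1" by (simp only: pos_le_divide_eq)
    then have "\<bar>a\<bar> + 1 \<le> s * (c1 / (L * y))"
      using L_pos yp by (simp add: pos_le_divide_eq algebra_simps)
    then have "y - s * g y \<le> a" using 1 by (smt (verit) min.cobounded1 min.cobounded2 y_def)
    moreover have "y \<le> y0" by (simp add: y_def)
    ultimately show ?thesis using yS by blast
  qed
  have hi: "\<exists>y\<in>S. y0 \<le> y \<and> a \<le> y - s * g y"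
  proof (cases "r = \<infinity>")
    case True
    define y where "y = max y0 (\<bar>a\<bar> + s + 1)"
    have y: "y \<in> S" "1 \<le> y" using S_infinite[OF True] state_pos[OF y0] s by (auto simp: y_def)
    have "g y \<le> 1 / y" using x_g_le_1[OF y(1)] y by (simp add: field_simps)
    also have "\<dots> \<le> 1" using y by simp
    finally have "s * g y \<le> s" using mult_left_mono[of "g y" 1 s] s by simp
    moreover have "y0 \<le> y" "\<bar>a\<bar> + s + 1 \<le> y" by (auto simp: y_def)
    ultimately have "y0 \<le> y \<and> a \<le> y - s * g y" by linarith
    then show ?thesis using y(1) by blast
  next
    case False
    then have r: "r < \<infinity>" by simp
    define R where "R = real_of_ereal r"
    have y0R: "y0 < R" using S_finite[OF r] y0 by (simp add: R_def)
    \<comment> \<open>Mirror image at r: the second bound puts R - d where h is at most h(y0)/2, the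
      third makes -s g at least |a| + 1.\<close>
    define d where "d = min (R - y0) (min (h y0 / (2 * L)) (s * c1 / (L * (\<bar>a\<bar> + 1))))"
    define y where "y = R - d"
    have d: "0 < d" using y0R h_pos[OF y0] L_pos s c1 by (auto simp: d_def)
    have y0y: "y0 \<le> y" by (auto simp: y_def d_def)
    have yS: "y \<in> S" using S_finite[OF r] state_pos[OF y0] y0y d by (simp add: y_def R_def)
    have hy: "h y \<le> L * d" using h_le_right[OF yS r] by (simp add: R_def[symmetric] y_def)
    have "d \<le> h y0 / (2 * L)" by (simp add: d_def)
    then have "L * d \<le> h y0 / 2" using L_pos by (simp add: field_simps)
    then have h1y: "h1 y \<le> - c1" using right[OF yS y0y] hy by simp
    have "c1 / (L * d) \<le> (- h1 y) / h y"
      using hy h1y h_pos[OF yS] c1 by (intro frac_le) auto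
    then have 1: "s * (c1 / (L * d)) \<le> s * (- g y)"
      using s by (intro mult_left_mono) (auto simp: g_def)
    have "0 < L * (\<bar>a\<bar> + 1)" using L_pos by (simp add: add_nonneg_pos)
    moreover have "d \<le> s * c1 / (L * (\<bar>a\<bar> + 1))" by (simp add: d_def)
    ultimately have "d * (L * (\<bar>a\<bar> + 1)) \<le> s * c1" by (simp only: pos_le_divide_eq)
    then have "\<bar>a\<bar> + 1 \<le> s * (c1 / (L * d))"
      using L_pos d by (simp add: pos_le_divide_eq algebra_simps)
    then have "a \<le> y - s * g y" using 1 state_pos[OF yS] by simp
    then show ?thesis using yS y0y by auto
  qed
  obtain u v where uv: "u \<in> S" "v \<in> S" "u \<le> v" "u - s * g u \<le> a" "a \<le> v - s * g v"
    using lo hi by (metis order_trans)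
  have "\<exists>y\<ge>u. y \<le> v \<and> y - s * g y = a"
    using uv S_between[OF uv(1,2)] step_deriv
    by (intro IVT) (auto intro!: DERIV_isCont)
  then show ?thesis using S_between[OF uv(1,2)] by blast
qed


text \<open>One implicit step of length \<open>d\<close> from \<open>z\<close> with Brownian increment \<open>w\<close> and frozen coefficient
  \<open>c = \<sigma>(z)\<close>.\<close>

definition "stp c z w d = (THE y. y \<in> S \<and> y = z + c * w + d * c\<^sup>2 * (h1 y / h y))"

lemma
  assumes "0 < c" "0 < d"
  shows stp_in_S: "stp c z w d \<in> S"
    and stp_eq: "stp c z w d - c\<^sup>2 * d * g (stp c z w d) = z + c * w"
    and stp_unique: "y \<in> S \<Longrightarrow> y - c\<^sup>2 * d * g y = z + c * w \<Longrightarrow> stp c z w d = y"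
proof -
  have s: "0 < c\<^sup>2 * d" using assms by simp
  have *: "(y = z + c * w + d * c\<^sup>2 * (h1 y / h y)) \<longleftrightarrow> (y - c\<^sup>2 * d * g y = z + c * w)" for y
    by (auto simp: g_def algebra_simps)
  have u: "y = y'" if "y \<in> S" "y' \<in> S" "y - c\<^sup>2 * d * g y = y' - c\<^sup>2 * d * g y'" for y y'
    using step_strict_mono[OF that(1,2) _ less_imp_le[OF s]] step_strict_mono[OF that(2,1) _ less_imp_le[OF s]] that(3)
    by (metis less_irrefl linorder_neqE_linordered_idom)
  have "\<exists>!y. y \<in> S \<and> y - c\<^sup>2 * d * g y = z + c * w"
    using step_bij[OF s, of "z + c * w"] u by metis
  from theI'[OF this]
  show 1: "stp c z w d \<in> S" "stp c z w d - c\<^sup>2 * d * g (stp c z w d) = z + c * w"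
    unfolding stp_def * by auto
  show "y \<in> S \<Longrightarrow> y - c\<^sup>2 * d * g y = z + c * w \<Longrightarrow> stp c z w d = y"
    using u[OF 1(1), of y] 1(2) by simp
qed

text \<open>Monotonicity turns an event about a solution given by \<open>THE\<close> into an
  explicit inequality in the increment; both the measurability and the law of a step come from
  this.\<close>

lemma stp_le_iff:
  assumes "0 < c" "0 < d" "y \<in> S"
  shows "stp c z w d \<le> y \<longleftrightarrow> z + c * w \<le> y - c\<^sup>2 * d * g y"
proof -
  have s: "0 \<le> c\<^sup>2 * d" using assms by simp
  note st = stp_in_S[OF assms(1,2), of z w] stp_eq[OF assms(1,2), of z w]
  show ?thesis
    using step_strict_mono[OF st(1) assms(3) _ s] step_strict_mono[OF assms(3) st(1) _ s] st(2)
    by (cases "stp c z w d" y rule: linorder_cases) auto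
qed

text \<open>The normalised Brownian increment for which the step ends in \<open>y\<close>; thus \<open>Phi \<circ> noise c z d\<close> (with
  the standard normal distribution function \<open>Phi\<close>) is the distribution function of the step.\<close>

definition "noise c z d y = (y - z - c\<^sup>2 * d * g y) / (c * sqrt d)"

lemma stp_noise:
  assumes "0 < c" "0 < d" "y \<in> S"
  shows "stp c z (sqrt d * noise c z d y) d = y"
  using assms by (intro stp_unique) (auto simp: noise_def)

lemma stp_le_noise_iff:
  assumes "0 < c" "0 < d" "y \<in> S"
  shows "stp c z (sqrt d * x) d \<le> y \<longleftrightarrow> x \<le> noise c z d y"
  unfolding stp_le_iff[OF assms] noise_def using assms by (auto simp: field_simps)

lemma noise_deriv:
  assumes "0 < c" "0 < d" "y \<in> S"
  shows "(noise c z d has_real_derivative Hs (c\<^sup>2 * d) y / (c * sqrt d)) (at y)"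
proof -
  have "((\<lambda>y. ((y - c\<^sup>2 * d * g y) - z) / (c * sqrt d)) has_real_derivative (Hs (c\<^sup>2 * d) y - 0) / (c * sqrt d)) (at y)"
    by (intro DERIV_cdivide DERIV_diff step_deriv assms DERIV_const)
  moreover have "(\<lambda>y. ((y - c\<^sup>2 * d * g y) - z) / (c * sqrt d)) = noise c z d"
    by (auto simp: noise_def fun_eq_iff algebra_simps)
  ultimately show ?thesis by simp
qed

lemma noise_strict_mono:
  assumes "0 < c" "0 < d" "x \<in> S" "y \<in> S" "x < y"
  shows "noise c z d x < noise c z d y"
  using step_strict_mono[OF assms(3-5), of "c\<^sup>2 * d"] assms(1,2)
  by (auto simp: noise_def intro!: divide_strict_right_mono)

text \<open>Multiply the implicit equation by its solution y: the drift becomes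
  \<open>c\<^sup>2 * d * (y * g y)\<close>, at most \<open>c\<^sup>2 * d\<close>, and Young's
  inequality splits \<open>y * (z + c * w)\<close>.\<close>

lemma stp_square:
  assumes "0 < c" "0 < d"
  shows "(stp c z w d)\<^sup>2 \<le> (z + c * w)\<^sup>2 + 2 * c\<^sup>2 * d"
proof -
  let ?y = "stp c z w d"
  have "?y * ?y - c\<^sup>2 * d * (?y * g ?y) = ?y * (z + c * w)"
    unfolding stp_eq[OF assms, symmetric] by (simp add: algebra_simps)
  moreover have "c\<^sup>2 * d * (?y * g ?y) \<le> c\<^sup>2 * d * 1"
    using x_g_le_1[OF stp_in_S[OF assms]] assms by (intro mult_left_mono) auto
  moreover have "2 * (?y * (z + c * w)) \<le> ?y * ?y + (z + c * w)\<^sup>2"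
    using zero_le_power2[of "?y - (z + c * w)"] by (simp add: power2_eq_square algebra_simps)
  ultimately show ?thesis unfolding power2_eq_square by linarith
qed

text \<open>By concavity, \<open>h(y) \<le> h(z)/2\<close> implies \<open>h(z)/2 \<le> h'(y) (z - y)\<close>, so the implicit drift points
  back to \<open>z\<close> and only a large increment \<open>w\<close> can have led to \<open>y\<close>.\<close>

lemma stp_near_boundary:
  assumes c: "0 < c" and d: "0 < d" and z: "z \<in> S"
    and le: "h (stp c z w d) \<le> h z / 2"
  shows "1 / h (stp c z w d) \<le> w\<^sup>2 / (2 * d * h z)" "h z / (2 * L) \<le> c * \<bar>w\<bar>"
proof -
  define y where "y = stp c z w d"
  have y: "y \<in> S" "y - c\<^sup>2 * d * g y = z + c * w"
    using stp_in_S[OF c d] stp_eq[OF c d] by (auto simp: y_def)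
  have hy: "0 < h y" "0 < h z" using h_pos y z by auto
  have t: "h z / 2 \<le> h1 y * (z - y)" using h_tangent[OF y(1) z] le by (simp add: y_def)
  then have "h z / 2 / h y \<le> h1 y * (z - y) / h y" using hy by (intro divide_right_mono) auto
  then have "h z / (2 * h y) \<le> g y * (z - y)" by (simp add: g_def)
  then have "c\<^sup>2 * d * (h z / (2 * h y)) \<le> c\<^sup>2 * d * (g y * (z - y))"
    using c d by (intro mult_left_mono) auto
  moreover have "c * w * (y - z) = (y - z)\<^sup>2 + c\<^sup>2 * d * (g y * (z - y))"
  proof -
    have "c * w * (y - z) = (y - c\<^sup>2 * d * g y - z) * (y - z)" using y(2) by simp
    then show ?thesis by (simp add: power2_eq_square algebra_simps)
  qed
  \<comment> \<open>Both conclusions follow from this: the first by completing the square, which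
    cancels (y - z)^2, the second by keeping (y - z)^2 alone, which bounds |y - z| by c |w|.\<close>
  ultimately have main: "(y - z)\<^sup>2 + c\<^sup>2 * d * (h z / (2 * h y)) \<le> c * w * (y - z)" by simp
  have "0 \<le> (c * w / 2 - (y - z))\<^sup>2" by simp
  then have "c * w * (y - z) \<le> (y - z)\<^sup>2 + c\<^sup>2 * (w\<^sup>2 / 4)"
    by (simp add: power2_eq_square algebra_simps)
  moreover have "c\<^sup>2 * (d * (h z / (2 * h y))) = c\<^sup>2 * d * (h z / (2 * h y))" by simp
  ultimately have "c\<^sup>2 * (d * (h z / (2 * h y))) \<le> c\<^sup>2 * (w\<^sup>2 / 4)"
    using main by linarith
  then have "d * (h z / (2 * h y)) \<le> w\<^sup>2 / 4" using c
    by (metis mult_le_cancel_left_pos zero_less_power)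
  then show "1 / h (stp c z w d) \<le> w\<^sup>2 / (2 * d * h z)"
    using hy d by (simp add: y_def[symmetric] field_simps)
  have "\<bar>h1 y * (z - y)\<bar> \<le> L * \<bar>z - y\<bar>" using h1_bound[OF y(1)] by (simp add: abs_mult mult_right_mono)
  then have "h z / 2 \<le> L * \<bar>y - z\<bar>" using t by (simp add: abs_minus_commute)
  then have yz: "h z / (2 * L) \<le> \<bar>y - z\<bar>" using L_pos by (simp add: field_simps)
  then have pos: "0 < \<bar>y - z\<bar>" using hy L_pos by (smt (verit) divide_pos_pos mult_pos_pos)
  have "(y - z)\<^sup>2 \<le> c * w * (y - z)" using main c d hy by (smt (verit) divide_nonneg_nonneg mult_nonneg_nonneg zero_le_power2)
  also have "\<dots> \<le> c * \<bar>w\<bar> * \<bar>y - z\<bar>" using c by (metis abs_ge_self abs_mult abs_of_pos)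
  finally have "\<bar>y - z\<bar> * \<bar>y - z\<bar> \<le> c * \<bar>w\<bar> * \<bar>y - z\<bar>" unfolding abs_mult_self_eq power2_eq_square .
  then have "\<bar>y - z\<bar> \<le> c * \<bar>w\<bar>" using pos by (rule mult_right_le_imp_le)
  then show "h z / (2 * L) \<le> c * \<bar>w\<bar>" using yz by simp
qed

text \<open>If h falls to half of h(z) or below, the ratio 2 L c |w| / h(z) is at least 1; its
  fourth power times w^2/d is a multiple of w^6/d. Sixth powers are the case k = 3 of
  \<open>increment_modulus\<close>.\<close>

lemma inverse_h_stp_le:
  assumes c: "0 < c" and d: "0 < d" and z: "z \<in> S"
  shows "1 / h (stp c z w d) \<le> 2 / h z + (2 * L * c / h z)^4 / (2 * h z) * (w^6 / d)"
proof (cases "h (stp c z w d) \<le> h z / 2")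
  case True
  note hz = h_pos[OF z]
  have "1 \<le> 2 * L * c / h z * \<bar>w\<bar>"
    using stp_near_boundary(2)[OF assms True] hz L_pos by (simp add: field_simps)
  then have "1 \<le> (2 * L * c / h z * \<bar>w\<bar>)^4" by (rule one_le_power)
  moreover have "\<bar>w\<bar>^4 = w^4" by (simp add: power_abs[symmetric] abs_power_minus)
  ultimately have "1 \<le> (2 * L * c / h z)^4 * w^4" by (simp only: power_mult_distrib)
  then have "w\<^sup>2 / (2 * d * h z) * 1 \<le> w\<^sup>2 / (2 * d * h z) * ((2 * L * c / h z)^4 * w^4)"
    using d hz by (intro mult_left_mono) auto
  also have "\<dots> = (2 * L * c / h z)^4 / (2 * h z) * (w^6 / d)"
    by (simp add: field_simps flip: power_add)
  finally show ?thesis using stp_near_boundary(1)[OF assms True] hz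
    by (smt (verit) divide_pos_pos)
next
  case False
  note hz = h_pos[OF z]
  have "1 / h (stp c z w d) \<le> 1 / (h z / 2)" using False hz by (intro divide_left_mono) auto
  moreover have "0 \<le> (2 * L * c / h z)^4 / (2 * h z) * (w^6 / d)" using hz d by simp
  ultimately show ?thesis by (simp del: power_divide)
qed

section \<open>The functions h^-p and their drift along a step\<close>

definition "U p y = h y powr (- p)"
definition "U1 p y = - p * h y powr (- p) * g y"
definition "U2 p y = h y powr (- p) * (p * (p + 1) * (g y)\<^sup>2 - p * (h2 y / h y))"

lemma U_deriv: assumes "y \<in> S" shows "(U p has_real_derivative U1 p y) (at y)"
proof -
  have "((\<lambda>y. h y powr (- p)) has_real_derivative h1 y * (- p) * h y powr (- p - 1)) (at y)"
    using DERIV_chain2[OF has_real_derivative_powr[OF h_pos[OF assms], of "- p"] h_D1[OF assms]]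
    by (simp add: mult_ac)
  then show ?thesis using h_pos[OF assms]
    by (simp add: U_def[abs_def] U1_def g_def powr_diff mult_ac)
qed

lemma U1_deriv: assumes "y \<in> S" shows "(U1 p has_real_derivative U2 p y) (at y)"
proof -
  have "((\<lambda>y. - p * U p y * g y) has_real_derivative U2 p y) (at y)"
    by (rule derivative_eq_intros U_deriv g_deriv assms refl)+
       (simp add: U1_def U_def U2_def g1_def power2_eq_square algebra_simps)
  then show ?thesis by (simp add: U1_def[abs_def] U_def)
qed

lemma powr_le_one_plus:
  fixes x a b :: real
  assumes "0 < x" "0 \<le> a" "a \<le> b"
  shows "x powr (- a) \<le> 1 + x powr (- b)"
proof (cases "x \<le> 1")
  case True
  then have "x powr (- a) \<le> x powr (- b)" using assms by (intro powr_mono') auto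
  then show ?thesis by simp
next
  case False
  then have "x powr (- a) \<le> x powr 0" using assms by (intro powr_mono) auto
  then show ?thesis using assms by (simp add: add_increasing2)
qed

text \<open>\<open>L\<close> accounts for h'' and \<open>sqrt s0 * \<bar>C\<bar>\<close> for the
  third derivative, which enters through H_xx; \<open>s0\<close> is an upper bound for
  \<open>s = c\<^sup>2 * d\<close>.\<close>

definition "K1 s0 = L + sqrt s0 * \<bar>C\<bar>"

lemma K1_pos: "0 \<le> s0 \<Longrightarrow> 0 < K1 s0"
  using L_pos by (simp add: K1_def add_pos_nonneg)

text \<open>\<open>H\<close> absorbs the derivative of \<open>g\<close>: since \<open>H \<ge> 1 + s g\<^sup>2 \<ge> 2 \<surd>s \<bar>g\<bar>\<close>, the only term of
  \<open>g H\<^sub>x\<^sub>x / H\<close> without a sign is of order \<open>h3 / h\<close>.\<close>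

lemma g_Hxx_bound:
  assumes y: "y \<in> S" and s: "0 \<le> s" "s \<le> s0"
  shows "g y * (- s * g2 y) / Hs s y \<le> sqrt s0 * \<bar>C\<bar> * (1 + h y powr (- q)) / h y"
proof -
  define H where "H = Hs s y"
  have hy: "0 < h y" using h_pos[OF y] .
  have H: "1 \<le> H" "1 + s * (g y)\<^sup>2 \<le> H" using Hs_ge Hs_ge_1 y s by (auto simp: H_def)
  have "0 \<le> (1 - sqrt s * \<bar>g y\<bar>)\<^sup>2" by simp
  then have "2 * (sqrt s * \<bar>g y\<bar>) \<le> H" using H(2) s by (simp add: power2_diff power_mult_distrib)
  then have "sqrt s * \<bar>g y\<bar> \<le> H" using H(1) by linarith
  then have "sqrt s * (sqrt s * \<bar>g y\<bar>) \<le> sqrt s0 * H"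
    using s H by (intro mult_mono) auto
  then have sg: "s * \<bar>g y\<bar> / H \<le> sqrt s0" using s H by (simp add: field_simps flip: mult.assoc)
  \<comment> \<open>Substituting \<open>g2\<close>, the terms with h'' and with g^4 are nonpositive;
    only the one with the third derivative needs the bound on
    \<open>s * \<bar>g y\<bar> / H\<close>.\<close>
  have e: "g y * (- s * g2 y) / H = (s * - g y / H) * (h3 y / h y) + 3 * s / H * (g y)\<^sup>2 * (h2 y / h y)
      - 2 * s / H * (g y)^4"
    by (simp add: g2_def power2_eq_square power3_eq_cube power4_eq_xxxx algebra_simps add_divide_distrib diff_divide_distrib)
  have "3 * s / H * (g y)\<^sup>2 * (h2 y / h y) \<le> 0"
    using s H h2_nonpos[OF y] hy by (intro mult_nonneg_nonpos) (auto simp: divide_nonpos_pos)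
  moreover have "0 \<le> 2 * s / H * (g y)^4" using s H by simp
  ultimately have "g y * (- s * g2 y) / H \<le> (s * - g y / H) * (h3 y / h y)" unfolding e by linarith
  also have "\<dots> \<le> \<bar>(s * - g y / H) * (h3 y / h y)\<bar>" by (rule abs_ge_self)
  also have "\<dots> = (s * \<bar>g y\<bar> / H) * (\<bar>h3 y\<bar> / h y)" using s H hy by (simp add: abs_mult)
  also have "\<dots> \<le> sqrt s0 * (\<bar>C\<bar> * (1 + h y powr (- q)) / h y)"
  proof (intro mult_mono sg divide_right_mono)
    have "C * (1 + h y powr (- q)) \<le> \<bar>C\<bar> * (1 + h y powr (- q))" by (intro mult_right_mono) auto
    then show "\<bar>h3 y\<bar> \<le> \<bar>C\<bar> * (1 + h y powr (- q))" using h3_bound[OF y] by linarith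
  qed (use s hy in auto)
  finally show ?thesis by (simp add: H_def)
qed

text \<open>Ito's formula applied to H = z + c w gives \<open>U p\<close> the drift
  \<open>c\<^sup>2 / Hs s y\<close> times this expression, with \<open>s = c\<^sup>2 * t\<close>;
  \<open>- s * g2 y\<close> is the second derivative of H in y.\<close>

definition "drift p s y = (U2 p y / Hs s y - U1 p y * (- s * g2 y) / (Hs s y)\<^sup>2) / 2 + U1 p y * g y"

text \<open>The first-order term contributes -p g^2 H with H >= 1, the second-order term p (p + 1)/2
  g^2; together they are at most -p (1 - p)/2 g^2. The terms with h'' and H_xx go into
  \<open>K1\<close>.\<close>

lemma drift_le:
  assumes y: "y \<in> S" and s: "0 \<le> s" "s \<le> s0" and p: "0 < p" "p \<le> 1"
  shows "drift p s y \<le> h y powr (- p) *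
      (- p * (1 - p) / 2 * (g y)\<^sup>2 + K1 s0 * (1 + h y powr (- q)) / h y) / Hs s y"
proof -
  define H where "H = Hs s y"
  have hy: "0 < h y" using h_pos[OF y] .
  have H: "1 \<le> H" using Hs_ge_1 y s by (auto simp: H_def)
  have eq: "drift p s y = h y powr (- p) * (p * (p + 1) / 2 * (g y)\<^sup>2 - p / 2 * (h2 y / h y)
      + p / 2 * (g y * (- s * g2 y) / H) - p * (g y)\<^sup>2 * H) / H"
  proof -
    have "drift p s y = h y powr (- p) * (((p * (p + 1) * (g y)\<^sup>2 - p * (h2 y / h y)) / H + p * g y * (- s * g2 y) / H\<^sup>2) / 2 - p * g y * g y)"
      unfolding drift_def U1_def U2_def H_def[symmetric] by (simp add: algebra_simps)
    also have "((p * (p + 1) * (g y)\<^sup>2 - p * (h2 y / h y)) / H + p * g y * (- s * g2 y) / H\<^sup>2) / 2 - p * g y * g y =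
      (p * (p + 1) / 2 * (g y)\<^sup>2 - p / 2 * (h2 y / h y) + p / 2 * (g y * (- s * g2 y) / H) - p * (g y)\<^sup>2 * H) / H"
    proof -
      have *: "((a - b) / H + e / H\<^sup>2) / 2 - f = (a / 2 - b / 2 + e / H / 2 - f * H) / H" for a b e f
        using H by (simp add: field_simps power2_eq_square)
      show ?thesis unfolding * by (simp add: power2_eq_square mult.assoc)
    qed
    finally show ?thesis by simp
  qed
  have "p / 2 * (g y * (- s * g2 y) / H) \<le> p / 2 * (sqrt s0 * \<bar>C\<bar> * (1 + h y powr (- q)) / h y)"
    using p g_Hxx_bound[OF y s] by (intro mult_left_mono) (auto simp: H_def)
  also have "\<dots> \<le> 1 * (sqrt s0 * \<bar>C\<bar> * (1 + h y powr (- q)) / h y)"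
    using p hy s by (intro mult_right_mono) auto
  finally have 1: "p / 2 * (g y * (- s * g2 y) / H) \<le> sqrt s0 * \<bar>C\<bar> * (1 + h y powr (- q)) / h y" by simp
  have "- h2 y \<le> L * (1 + h y powr (- q))"
  proof -
    have "L * 1 \<le> L * (1 + h y powr (- q))" using L_pos by (intro mult_left_mono) auto
    then show ?thesis using h2_bound[OF y] by linarith
  qed
  then have "- (h2 y / h y) \<le> L * (1 + h y powr (- q)) / h y"
    using hy divide_right_mono[of "- h2 y" _ "h y"] by auto
  moreover have "p / 2 * - (h2 y / h y) \<le> 1 * - (h2 y / h y)"
    using p h2_nonpos[OF y] hy by (intro mult_right_mono) (auto simp: divide_nonpos_pos)
  ultimately have 2: "- p / 2 * (h2 y / h y) \<le> L * (1 + h y powr (- q)) / h y" by simp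
  have 3: "p * (g y)\<^sup>2 * 1 \<le> p * (g y)\<^sup>2 * H" using p H by (intro mult_left_mono) auto
  have 4: "K1 s0 * (1 + h y powr (- q)) / h y = L * (1 + h y powr (- q)) / h y + sqrt s0 * \<bar>C\<bar> * (1 + h y powr (- q)) / h y"
    by (simp add: K1_def algebra_simps add_divide_distrib)
  have 5: "p * (p + 1) / 2 * (g y)\<^sup>2 - p * (g y)\<^sup>2 * 1 = - p * (1 - p) / 2 * (g y)\<^sup>2"
    by (simp add: field_simps)
  have "p * (p + 1) / 2 * (g y)\<^sup>2 - p / 2 * (h2 y / h y) + p / 2 * (g y * (- s * g2 y) / H) - p * (g y)\<^sup>2 * H
      \<le> - p * (1 - p) / 2 * (g y)\<^sup>2 + K1 s0 * (1 + h y powr (- q)) / h y"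
    using 1 2 3 4 5 by simp
  then show ?thesis unfolding eq H_def[symmetric] using H by (intro divide_right_mono mult_left_mono) auto
qed

text \<open>Near the boundary h' is bounded away from 0, so g^2 is of order h^-2 and beats (1 +
  h^-q)/h because q < 1; elsewhere h is bounded below and the constant \<open>K\<close> covers
  everything.\<close>

lemma drift_le_neg:
  assumes p: "0 < p" "p < 1" and s0: "0 \<le> s0"
  obtains a K where "0 < a" "0 \<le> K"
    "\<And>s y. y \<in> S \<Longrightarrow> 0 \<le> s \<Longrightarrow> s \<le> s0 \<Longrightarrow> drift p s y \<le> (K - a * h y powr (- 2 - p)) / Hs s y"
proof -
  obtain y0 c1 where y0: "y0 \<in> S" and c1: "0 < c1"
    and left: "\<And>y. y \<in> S \<Longrightarrow> y \<le> y0 \<Longrightarrow> h y \<le> h y0 / 2 \<Longrightarrow> c1 \<le> h1 y"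
    and right: "\<And>y. y \<in> S \<Longrightarrow> y0 \<le> y \<Longrightarrow> h y \<le> h y0 / 2 \<Longrightarrow> r < \<infinity> \<and> h1 y \<le> - c1"
    using boundary_slope by blast
  define k where "k = K1 s0"
  have k: "0 < k" using K1_pos[OF s0] by (simp add: k_def)
  \<comment> \<open>Half of the coefficient p (1 - p)/2 \<open>c1\<^sup>2\<close>; the other half
    absorbs the error below the threshold \<eta>.\<close>
  define a where "a = p * (1 - p) / 4 * c1\<^sup>2"
  have a: "0 < a" using p c1 by (simp add: a_def)
  \<comment> \<open>For h <= \<eta> <= 1 both h and h^(1-q) are at most a/(2k), hence k (h +
    h^(1-q)) <= a; the bound h(y0)/2 makes \<open>left\<close> and \<open>right\<close>
    available.\<close>
  define \<eta> where "\<eta> = min (h y0 / 2) (min 1 ((a / (2 * k)) powr (1 / (1 - q))))"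
  have \<eta>: "0 < \<eta>" using h_pos[OF y0] a k by (simp add: \<eta>_def)
  define K where "K = k * (\<eta> powr (- p - 1) * (1 + \<eta> powr (- q))) + a * \<eta> powr (- 2 - p)"
  have K: "0 \<le> K" using k a by (simp add: K_def)
  have "drift p s y \<le> (K - a * h y powr (- 2 - p)) / Hs s y"
    if y: "y \<in> S" and s: "0 \<le> s" "s \<le> s0" for s y
  proof -
    have hy: "0 < h y" using h_pos[OF y] .
    have H: "1 \<le> Hs s y" using Hs_ge_1[OF y s(1)] .
    have "h y powr (- p) * (- p * (1 - p) / 2 * (g y)\<^sup>2 + k * (1 + h y powr (- q)) / h y)
        \<le> K - a * h y powr (- 2 - p)"
    proof (cases "h y \<le> \<eta>")
      case True
      then have "h y \<le> h y0 / 2" by (simp add: \<eta>_def)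
      then have "c1 \<le> \<bar>h1 y\<bar>" using left[OF y] right[OF y] by fastforce
      then have h1: "c1\<^sup>2 \<le> (h1 y)\<^sup>2" using c1 power_mono[of c1 "\<bar>h1 y\<bar>" 2] by simp
      have "h y \<le> 1" using True by (simp add: \<eta>_def)
      then have "h y powr 1 \<le> h y powr (1 - q)" using q_nonneg hy by (intro powr_mono') auto
      moreover have "h y powr (1 - q) \<le> a / (2 * k)"
      proof -
        have "h y \<le> (a / (2 * k)) powr (1 / (1 - q))" using True by (simp add: \<eta>_def)
        then have "h y powr (1 - q) \<le> ((a / (2 * k)) powr (1 / (1 - q))) powr (1 - q)"
          using hy q_less_1 by (intro powr_mono2) auto
        also have "\<dots> = a / (2 * k)" using q_less_1 a k by (simp add: powr_powr)
        finally show ?thesis .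
      qed
      ultimately have "h y + h y powr (1 - q) \<le> a / k" using hy by simp
      then have 1: "k * (h y + h y powr (1 - q)) \<le> a" using k by (simp add: pos_le_divide_eq mult.commute)
      have "h y powr (- p) * (- p * (1 - p) / 2 * (g y)\<^sup>2 + k * (1 + h y powr (- q)) / h y)
        = h y powr (- 2 - p) * (- p * (1 - p) / 2 * (h1 y)\<^sup>2 + k * (h y + h y powr (1 - q)))"
      proof -
        have *: "h y powr (- 2 - p) = h y powr (- p) / (h y)\<^sup>2" "h y powr (1 - q) = h y * h y powr (- q)"
          using hy by (simp_all add: powr_diff powr_minus field_simps)
        have **: "u * (- p * (1 - p) / 2 * (v / w)\<^sup>2 + k * (1 + t) / w)
          = u / w\<^sup>2 * (- p * (1 - p) / 2 * v\<^sup>2 + k * (w + w * t))" if "w > 0" for u v w t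
          using that by (simp add: field_simps power2_eq_square)
        show ?thesis unfolding * g_def by (rule **[OF hy])
      qed
      also have "\<dots> \<le> h y powr (- 2 - p) * (- 2 * a + a)"
      proof (intro mult_left_mono add_mono 1)
        have "p * (1 - p) / 2 * c1\<^sup>2 \<le> p * (1 - p) / 2 * (h1 y)\<^sup>2"
          using h1 p by (intro mult_left_mono) auto
        then show "- p * (1 - p) / 2 * (h1 y)\<^sup>2 \<le> - 2 * a" by (simp add: a_def)
      qed auto
      finally show ?thesis using K by (simp add: mult.commute)
    next
      case False
      have "h y powr (- p) * (- p * (1 - p) / 2 * (g y)\<^sup>2 + k * (1 + h y powr (- q)) / h y)
        \<le> h y powr (- p) * (0 + k * (1 + h y powr (- q)) / h y)"
        using p by (intro mult_left_mono add_right_mono) auto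
      also have "\<dots> = k * (h y powr (- p - 1) * (1 + h y powr (- q)))"
        using hy by (simp add: powr_diff field_simps)
      also have "\<dots> \<le> k * (\<eta> powr (- p - 1) * (1 + \<eta> powr (- q)))"
        using k False \<eta> p q_nonneg hy
        by (intro mult_left_mono mult_mono add_left_mono powr_mono2') auto
      finally have A: "h y powr (- p) * (- p * (1 - p) / 2 * (g y)\<^sup>2 + k * (1 + h y powr (- q)) / h y) \<le>
         k * (\<eta> powr (- p - 1) * (1 + \<eta> powr (- q)))" .
      have "a * h y powr (- 2 - p) \<le> a * \<eta> powr (- 2 - p)"
        using a False \<eta> p hy by (intro mult_left_mono powr_mono2') auto
      then show ?thesis using A by (simp add: K_def)
    qed
    then show ?thesis using H
      by (intro order_trans[OF drift_le[OF y s p(1) less_imp_le[OF p(2)]] divide_right_mono]) (auto simp: k_def)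
  qed
  then show ?thesis using that a K by blast
qed

text \<open>At exponent 1 the coefficient p (1 - p) is zero and nothing negative remains; the error
  term has order h^(-2-q), which the integral in (1) can control because q < 1.\<close>

lemma drift_one_le:
  assumes s0: "0 \<le> s0"
  obtains K where "0 \<le> K"
    "\<And>s y. y \<in> S \<Longrightarrow> 0 \<le> s \<Longrightarrow> s \<le> s0 \<Longrightarrow> drift 1 s y \<le> K * (1 + h y powr (- 2 - q)) / Hs s y"
proof
  show "0 \<le> 2 * K1 s0" using K1_pos[OF s0] by simp
  fix s y assume y: "y \<in> S" and s: "0 \<le> s" "s \<le> s0"
  have hy: "0 < h y" using h_pos[OF y] .
  have H: "1 \<le> Hs s y" using Hs_ge_1[OF y s(1)] .
  have "h y powr (- 2) \<le> 1 + h y powr (- (2 + q))" using powr_le_one_plus[OF hy, of 2 "2 + q"] q_nonneg by simp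
  then have "K1 s0 * (h y powr (- 2) + h y powr (- 2 - q)) \<le> K1 s0 * (2 * (1 + h y powr (- 2 - q)))"
    using K1_pos[OF s0] by (intro mult_left_mono) auto
  moreover have "h y powr (- 1) * (- 1 * (1 - 1) / 2 * (g y)\<^sup>2 + K1 s0 * (1 + h y powr (- q)) / h y)
     = K1 s0 * (h y powr (- 2) + h y powr (- 2 - q))"
  proof -
    have *: "h y powr (- 2) = h y powr (- 1) / h y" "h y powr (- 2 - q) = h y powr (- 1) * h y powr (- q) / h y"
      using hy powr_diff[of "h y" "- 1" 1] powr_add[of "h y" "- 1" "- q"] powr_diff[of "h y" "- 1 - q" 1] by simp_all
    show ?thesis unfolding * by (simp add: algebra_simps add_divide_distrib)
  qed
  ultimately have "h y powr (- 1) * (- 1 * (1 - 1) / 2 * (g y)\<^sup>2 + K1 s0 * (1 + h y powr (- q)) / h y)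
      \<le> 2 * K1 s0 * (1 + h y powr (- 2 - q))" by linarith
  then show "drift 1 s y \<le> 2 * K1 s0 * (1 + h y powr (- 2 - q)) / Hs s y"
    using H by (intro order_trans[OF drift_le[OF y s] divide_right_mono]) auto
qed

end

subsection \<open>Ito's formula for one step\<close>

abbreviation "nd \<equiv> std_normal_density"
abbreviation "N01 \<equiv> std_normal_distribution"

definition "Phi x = (LBINT y:{..x}. nd y)"

lemma nd_integrable: "set_integrable lborel A nd" if "A \<in> sets borel"
  using integrable_std_normal_moment[of 0] that unfolding set_integrable_def
  by (intro integrable_mult_indicator) auto

lemma continuous_on_nd [continuous_intros]:
  "continuous_on A f \<Longrightarrow> continuous_on A (\<lambda>x. nd (f x))" for f :: "'c::topological_space \<Rightarrow> real"
  unfolding std_normal_density_def by (intro continuous_intros) auto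

lemma Phi_deriv: "(Phi has_real_derivative nd x) (at x)"
proof -
  have eq: "Phi y = Phi (x - 1) + integral {x-1..y} nd" if "y \<in> {x-1..x+1}" for y
  proof -
    have "{..y} = {..x-1} \<union> {x-1<..y}" using that by auto
    then have "Phi y = Phi (x - 1) + (LBINT u:{x-1<..y}. nd u)"
      unfolding Phi_def by (simp, subst set_integral_Un) (auto intro!: nd_integrable)
    also have "(LBINT u:{x-1<..y}. nd u) = integral {x-1<..y} nd"
      by (intro set_borel_integral_eq_integral nd_integrable) auto
    also have "\<dots> = integral {x-1..y} nd"
      by (rule integral_spike_set) (auto intro: negligible_subset[of "{x-1}"])
    finally show ?thesis .
  qed
  have "((\<lambda>y. Phi (x - 1) + integral {x-1..y} nd) has_real_derivative 0 + nd x) (at x within {x-1..x+1})"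
    by (intro DERIV_add integral_has_real_derivative continuous_intros) (auto intro: DERIV_const)
  then have "(Phi has_real_derivative nd x) (at x within {x-1..x+1})"
    unfolding has_field_derivative_def by (intro has_derivative_transform[OF _ eq]) simp_all
  then show ?thesis by (simp add: at_within_Icc_at)
qed

lemma nd_deriv: "(nd has_real_derivative - x * nd x) (at x)"
  unfolding std_normal_density_def by (rule derivative_eq_intros refl | simp)+

text \<open>A crude tail bound, enough to make the boundary term \<open>Theta\<close> vanish at
  infinity.\<close>

lemma nd_times_le: "0 < x \<Longrightarrow> nd x \<le> 1 / x"
proof -
  assume x: "0 < x"
  have "x \<le> exp (x\<^sup>2 / 2)"
    using zero_le_power2[of "x - 1"] by (intro order_trans[OF _ exp_ge_add_one_self]) (simp add: power2_diff)
  then have "exp (- x\<^sup>2 / 2) \<le> 1 / x" using x by (simp add: exp_minus field_simps)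
  moreover have "1 / sqrt (2 * pi) * exp (- x\<^sup>2 / 2) \<le> 1 * exp (- x\<^sup>2 / 2)"
    using pi_ge_two by (intro mult_right_mono) (auto simp: field_simps)
  ultimately show ?thesis unfolding std_normal_density_def by linarith
qed

lemma prob_N01: "prob_space N01"
  using real_dist_normal_dist by (simp add: real_distribution_def)

lemma Phi_measure: "Phi x = (\<integral>\<xi>. indicator {..x} \<xi> \<partial>N01)"
  unfolding Phi_def set_lebesgue_integral_def
  by (subst integral_density) (auto simp: mult.commute)

lemma Phi_bounds: "0 \<le> Phi x" "Phi x \<le> 1"
proof -
  interpret prob_space N01 by (rule prob_N01)
  have "Phi x = prob {..x}" unfolding Phi_measure by simp
  then show "0 \<le> Phi x" "Phi x \<le> 1" by auto
qed

lemma Phi_at_bot: "(Phi \<longlongrightarrow> 0) at_bot" and Phi_at_top: "(Phi \<longlongrightarrow> 1) at_top"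
proof -
  interpret real_distribution N01 by (rule real_dist_normal_dist)
  have "Phi = cdf N01" by (auto simp: fun_eq_iff Phi_measure cdf_def)
  then show "(Phi \<longlongrightarrow> 0) at_bot" "(Phi \<longlongrightarrow> 1) at_top"
    using cdf_lim_at_bot cdf_lim_at_top_prob by auto
qed

text \<open>Allows Fatou's lemma to be applied separately to the two terms on the left of
  \<open>one_step\<close>.\<close>

lemma ennreal_liminf_add: "liminf f + liminf g \<le> liminf (\<lambda>n. f n + g n :: ennreal)"
proof -
  have inc: "incseq (\<lambda>n. INF m\<in>{n..}. u m)" for u :: "nat \<Rightarrow> ennreal"
    by (auto simp: incseq_def intro!: INF_superset_mono)
  have "liminf f + liminf g = (SUP n. (INF m\<in>{n..}. f m) + (INF m\<in>{n..}. g m))"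
    unfolding liminf_SUP_INF by (rule ennreal_SUP_add[symmetric]) (rule inc)+
  also have "\<dots> \<le> (SUP n. INF m\<in>{n..}. f m + g m)"
    by (intro SUP_mono') (auto intro!: INF_greatest add_mono INF_lower)
  finally show ?thesis by (simp add: liminf_SUP_INF)
qed

context bem_profile
begin

text \<open>Sublevel sets suffice: \<open>stp_le_iff\<close> makes them explicit for levels in S,
  and any other level lies below or above the whole state space.\<close>

lemma measurable_stp [measurable (raw)]:
  assumes [measurable]: "c \<in> borel_measurable M" "z \<in> borel_measurable M" "w \<in> borel_measurable M" "d \<in> borel_measurable M"
    and pos: "\<And>\<omega>. \<omega> \<in> space M \<Longrightarrow> 0 < c \<omega>" "\<And>\<omega>. \<omega> \<in> space M \<Longrightarrow> 0 < d \<omega>"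
  shows "(\<lambda>\<omega>. stp (c \<omega>) (z \<omega>) (w \<omega>) (d \<omega>)) \<in> borel_measurable M"
proof (subst borel_measurable_iff_le, intro allI)
  fix y
  have st: "stp (c \<omega>) (z \<omega>) (w \<omega>) (d \<omega>) \<in> S" if "\<omega> \<in> space M" for \<omega>
    by (rule stp_in_S[OF pos[OF that]])
  consider "y \<in> S" | "y \<le> 0" | "0 < y" "y \<notin> S" by linarith
  then show "{\<omega> \<in> space M. stp (c \<omega>) (z \<omega>) (w \<omega>) (d \<omega>) \<le> y} \<in> sets M"
  proof cases
    case 1
    have "{\<omega> \<in> space M. stp (c \<omega>) (z \<omega>) (w \<omega>) (d \<omega>) \<le> y}
      = {\<omega> \<in> space M. z \<omega> + c \<omega> * w \<omega> \<le> y - (c \<omega>)\<^sup>2 * d \<omega> * g y}"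
      using stp_le_iff[OF pos 1] by auto
    then show ?thesis by simp
  next
    case 2
    then have "{\<omega> \<in> space M. stp (c \<omega>) (z \<omega>) (w \<omega>) (d \<omega>) \<le> y} = {}"
      using state_pos[OF st] by fastforce
    then show ?thesis by (simp only: sets.empty_sets)
  next
    case 3
    then have "{\<omega> \<in> space M. stp (c \<omega>) (z \<omega>) (w \<omega>) (d \<omega>) \<le> y} = space M"
      using S_below[OF st] by fastforce
    then show ?thesis by simp
  qed
qed

lemma measurable_on_S:
  assumes "continuous_on S f" and [measurable]: "Y \<in> borel_measurable M" and "\<And>\<omega>. \<omega> \<in> space M \<Longrightarrow> Y \<omega> \<in> S"
  shows "(\<lambda>\<omega>. f (Y \<omega>)) \<in> borel_measurable M"
proof -
  have "Y \<in> measurable M (restrict_space borel S)"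
    using assms by (intro measurable_restrict_space2) auto
  from measurable_compose[OF this borel_measurable_continuous_on_restrict[OF assms(1)]]
  show ?thesis by simp
qed

lemma continuous_U: "continuous_on S (U p)" and continuous_U1: "continuous_on S (U1 p)"
  by (meson DERIV_isCont continuous_at_imp_continuous_on U_deriv U1_deriv)+

definition "clip \<alpha> \<beta> x = max \<alpha> (min \<beta> (x::real))"

lemma clip_in_S: "\<alpha> \<in> S \<Longrightarrow> \<beta> \<in> S \<Longrightarrow> \<alpha> \<le> \<beta> \<Longrightarrow> clip \<alpha> \<beta> x \<in> S"
  by (rule S_between[of \<alpha> \<beta>]) (auto simp: clip_def)

text \<open>The distribution function, unlike the step itself, can be differentiated explicitly in time.\<close>

definition "Psi p c z \<alpha> \<beta> t = U p \<beta> - integral {\<alpha>..\<beta>} (\<lambda>y. U1 p y * Phi (noise c z t y))"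

lemma Phi_continuous [continuous_intros]:
  "continuous_on A f \<Longrightarrow> continuous_on A (\<lambda>x. Phi (f x))" for f :: "'c::topological_space \<Rightarrow> real"
  by (rule continuous_on_compose2[of UNIV Phi])
     (auto intro!: continuous_at_imp_continuous_on DERIV_isCont Phi_deriv)

text \<open>\<open>U p (clip \<alpha> \<beta> x)\<close> equals \<open>U p \<beta>\<close> minus the
  integral of \<open>U1 p\<close> over the y >= x in [\<alpha>, \<beta>]. Exchanging integrals, the
  inner expectation is the probability that the step ends at or below y. Clipping keeps
  \<open>U1 p\<close> bounded, as Fubini's theorem requires.\<close>

lemma Psi_eq:
  assumes c: "0 < c" and t: "0 < t" and \<alpha>: "\<alpha> \<in> S" and \<beta>: "\<beta> \<in> S" and le: "\<alpha> \<le> \<beta>"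
  shows "Psi p c z \<alpha> \<beta> t = (\<integral>\<xi>. U p (clip \<alpha> \<beta> (stp c z (sqrt t * \<xi>) t)) \<partial>N01)"
proof -
  interpret N: prob_space N01 by (rule prob_N01)
  interpret pair_sigma_finite N01 lborel ..
  define X where "X \<xi> = stp c z (sqrt t * \<xi>) t" for \<xi>
  have X[measurable]: "X \<in> borel_measurable borel" unfolding X_def using c t by measurable
  have sub: "{\<alpha>..\<beta>} \<subseteq> S" using S_between[OF \<alpha> \<beta>] by auto
  define u where "u y = indicator {\<alpha>..\<beta>} y *\<^sub>R U1 p y" for y
  have u[measurable]: "u \<in> borel_measurable borel"
    unfolding u_def by (intro borel_measurable_continuous_on_indicator continuous_on_subset[OF continuous_U1 sub]) auto
  obtain B where B: "\<And>y. y \<in> {\<alpha>..\<beta>} \<Longrightarrow> \<bar>U1 p y\<bar> \<le> B"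
    using compact_imp_bounded[OF compact_continuous_image[OF continuous_on_subset[OF continuous_U1 sub] compact_Icc], of p]
    by (force simp: bounded_iff)
  have path: "U p (clip \<alpha> \<beta> x) = U p \<beta> - (\<integral>y. u y * indicator {x..} y \<partial>lborel)" for x
  proof -
    define k where "k = clip \<alpha> \<beta> x"
    have k: "\<alpha> \<le> k" "k \<le> \<beta>" using le by (auto simp: k_def clip_def)
    have sub2: "{k..\<beta>} \<subseteq> {\<alpha>..\<beta>}" using k by auto
    then have sub3: "{k..\<beta>} \<subseteq> S" using sub by blast
    have "(\<integral>y. u y * indicator {x..} y \<partial>lborel) = (\<integral>y. indicator {k..\<beta>} y *\<^sub>R U1 p y \<partial>lborel)"
    proof (rule integral_cong_AE)
      \<comment> \<open>For x > \<beta> the two integrands differ at the single point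
        \<beta>.\<close>
      show "AE y in lborel. u y * indicator {x..} y = indicator {k..\<beta>} y *\<^sub>R U1 p y"
        using AE_lborel_singleton[of \<beta>]
        by eventually_elim (use le in \<open>auto simp: u_def k_def clip_def indicator_def split: if_splits\<close>)
      show "(\<lambda>y. indicator {k..\<beta>} y *\<^sub>R U1 p y) \<in> borel_measurable lborel"
        using borel_measurable_continuous_on_indicator[OF _ continuous_on_subset[OF continuous_U1 sub3], of p]
        by auto
    qed measurable
    also have "\<dots> = integral {k..\<beta>} (U1 p)"
      using set_borel_integral_eq_integral[of "{k..\<beta>}" "U1 p"] borel_integrable_atLeastAtMost'[OF continuous_on_subset[OF continuous_U1], of k \<beta> p] sub sub2
      by (auto simp: set_lebesgue_integral_def)
    also have "(U1 p has_integral (U p \<beta> - U p k)) {k..\<beta>}"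
      using k sub3 by (intro fundamental_theorem_of_calculus)
        (auto simp flip: has_real_derivative_iff_has_vector_derivative intro!: has_field_derivative_at_within U_deriv)
    then have "integral {k..\<beta>} (U1 p) = U p \<beta> - U p k" by (rule integral_unique)
    finally show ?thesis by (simp add: k_def)
  qed
  have int: "integrable (N01 \<Otimes>\<^sub>M lborel) (\<lambda>(\<xi>, y). u y * indicator {X \<xi>..} y)"
  proof (rule integrableI_bounded_set[where A = "UNIV \<times> {\<alpha>..\<beta>}" and B = "\<bar>B\<bar>"])
    show "UNIV \<times> {\<alpha>..\<beta>} \<in> sets (N01 \<Otimes>\<^sub>M lborel)" by simp
    have "(\<lambda>(\<xi>, y). u y * (if X \<xi> \<le> y then 1 else 0)) \<in> borel_measurable (N01 \<Otimes>\<^sub>M lborel)" by measurable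
    then show "(\<lambda>(\<xi>, y). u y * indicator {X \<xi>..} y) \<in> borel_measurable (N01 \<Otimes>\<^sub>M lborel)"
      by (simp add: indicator_def)
    show "emeasure (N01 \<Otimes>\<^sub>M lborel) (UNIV \<times> {\<alpha>..\<beta>}) < \<infinity>"
      using N.emeasure_space_1 le
      by (subst lborel.emeasure_pair_measure_Times) (auto simp: ennreal_mult_less_top)
  qed (auto simp: u_def indicator_def intro!: AE_I2 order_trans[OF B])
  have "(\<integral>\<xi>. U p (clip \<alpha> \<beta> (X \<xi>)) \<partial>N01) = (\<integral>\<xi>. U p \<beta> - (\<integral>y. u y * indicator {X \<xi>..} y \<partial>lborel) \<partial>N01)"
    by (simp add: path)
  also have "\<dots> = U p \<beta> - (\<integral>\<xi>. (\<integral>y. u y * indicator {X \<xi>..} y \<partial>lborel) \<partial>N01)"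
    using integrable_fst'[OF int] by (subst Bochner_Integration.integral_diff) (auto simp: N.prob_space[simplified])
  also have "(\<integral>\<xi>. (\<integral>y. u y * indicator {X \<xi>..} y \<partial>lborel) \<partial>N01) = (\<integral>y. (\<integral>\<xi>. u y * indicator {X \<xi>..} y \<partial>N01) \<partial>lborel)"
    using Fubini_integral[OF int] by simp
  also have "\<dots> = (\<integral>y. indicator {\<alpha>..\<beta>} y *\<^sub>R (U1 p y * Phi (noise c z t y)) \<partial>lborel)"
  proof (rule Bochner_Integration.integral_cong)
    fix y
    show "(\<integral>\<xi>. u y * indicator {X \<xi>..} y \<partial>N01) = indicator {\<alpha>..\<beta>} y *\<^sub>R (U1 p y * Phi (noise c z t y))"
    proof (cases "y \<in> {\<alpha>..\<beta>}")
      case True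
      then have "indicator {X \<xi>..} y = (indicator {..noise c z t y} \<xi> :: real)" for \<xi>
        using stp_le_noise_iff[OF c t, of y z \<xi>] sub by (auto simp: X_def indicator_def)
      then have "(\<integral>\<xi>. u y * indicator {X \<xi>..} y \<partial>N01) = u y * Phi (noise c z t y)"
        unfolding Phi_measure by simp
      then show ?thesis using True by (simp add: u_def)
    qed (simp add: u_def)
  qed simp
  also have "\<dots> = integral {\<alpha>..\<beta>} (\<lambda>y. U1 p y * Phi (noise c z t y))"
  proof -
    have "continuous_on {\<alpha>..\<beta>} (\<lambda>y. U1 p y * Phi (noise c z t y))"
      unfolding noise_def using c t
      by (intro continuous_intros continuous_on_subset[OF continuous_U1 sub] continuous_on_subset[OF continuous_g sub]) auto
    from set_borel_integral_eq_integral(2)[OF borel_integrable_atLeastAtMost'[OF this]]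
    show ?thesis by (simp add: set_lebesgue_integral_def)
  qed
  finally show ?thesis by (simp add: Psi_def X_def)
qed


section \<open>Time evolution of the law of a step\<close>

definition "noise_dt c z t y = - (y - z) / (2 * c * t * sqrt t) - c * g y / (2 * sqrt t)"

lemma noise_deriv_t:
  assumes c: "0 < c" and t: "0 < t"
  shows "((\<lambda>t. noise c z t y) has_real_derivative noise_dt c z t y) (at t within A)"
proof -
  have *: "noise c z t y = (y - z) / c * (1 / sqrt t) - c * g y * sqrt t" if "0 < t" for t
    using that c by (simp add: noise_def field_simps power2_eq_square)
  have "((\<lambda>t. (y - z) / c * (1 / sqrt t) - c * g y * sqrt t) has_real_derivative noise_dt c z t y) (at t)"
    using t c unfolding noise_dt_def
    by (auto intro!: derivative_eq_intros simp: field_simps power2_eq_square)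
  moreover have "\<forall>\<^sub>F t in nhds t. noise c z t y = (y - z) / c * (1 / sqrt t) - c * g y * sqrt t"
    using t * by (auto intro: eventually_mono[OF eventually_nhds_in_open[of "{0<..}" t]])
  ultimately have "((\<lambda>t. noise c z t y) has_real_derivative noise_dt c z t y) (at t)"
    by (subst DERIV_cong_ev[OF refl _ refl]) auto
  then show ?thesis by (rule has_field_derivative_at_within)
qed

text \<open>Lebesgue density of the step of length t at y: the y-derivative of
  \<open>Phi (noise c z t y)\<close>.\<close>

definition "rho c z t y = nd (noise c z t y) * (Hs (c\<^sup>2 * t) y / (c * sqrt t))"

text \<open>Equal to \<open>U1 p\<close> times half the squared diffusion coefficient
  \<open>(c / Hs (c\<^sup>2 * t) y)\<^sup>2\<close> times the density \<open>rho\<close>: the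
  boundary term of the integration by parts.\<close>

definition "Theta p c z t y = U1 p y / Hs (c\<^sup>2 * t) y * (c / (2 * sqrt t)) * nd (noise c z t y)"

text \<open>The Fokker--Planck equation, integrated once in y and tested with \<open>U1 p\<close>.
  The first summand is \<open>U1 p\<close> times the time derivative of the distribution function,
  the second is the drift of \<open>U p\<close> times the density.\<close>

lemma Theta_deriv:
  assumes c: "0 < c" and t: "0 < t" and y: "y \<in> S"
  shows "(Theta p c z t has_real_derivative
      (U1 p y * nd (noise c z t y) * noise_dt c z t y + c / sqrt t * nd (noise c z t y) * drift p (c\<^sup>2 * t) y)) (at y)"
proof -
  define s where "s = c\<^sup>2 * t"
  have s: "0 \<le> s" using c t by (simp add: s_def)
  have H: "1 \<le> Hs s y" using Hs_ge_1[OF y s] .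
  have HD: "(Hs s has_real_derivative - s * g2 y) (at y)"
    unfolding Hs_def [abs_def] by (rule derivative_eq_intros g1_deriv y refl)+ simp
  have nD: "((\<lambda>y. nd (noise c z t y)) has_real_derivative
      - noise c z t y * nd (noise c z t y) * (Hs s y / (c * sqrt t))) (at y)"
    unfolding s_def by (rule DERIV_chain2[OF nd_deriv noise_deriv[OF c t y]])
  define n where "n = nd (noise c z t y)"
  define v where "v = noise c z t y"
  have "((\<lambda>y. U1 p y / Hs s y * (c / (2 * sqrt t)) * nd (noise c z t y)) has_real_derivative
     ((U2 p y * Hs s y - U1 p y * (- s * g2 y)) / (Hs s y * Hs s y) * (c / (2 * sqrt t))) * n
     + U1 p y / Hs s y * (c / (2 * sqrt t)) * (- v * n * (Hs s y / (c * sqrt t)))) (at y)"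
    unfolding n_def v_def
    by (rule derivative_eq_intros U1_deriv HD nD y refl | use H in force)+ (simp add: algebra_simps)
  moreover have "((U2 p y * Hs s y - U1 p y * (- s * g2 y)) / (Hs s y * Hs s y) * (c / (2 * sqrt t))) * n
     + U1 p y / Hs s y * (c / (2 * sqrt t)) * (- v * n * (Hs s y / (c * sqrt t)))
    = U1 p y * n * noise_dt c z t y + c / sqrt t * n * drift p s y"
  proof -
    have "c / sqrt t * n * drift p s y - ((U2 p y * Hs s y - U1 p y * (- s * g2 y)) / (Hs s y * Hs s y) * (c / (2 * sqrt t))) * n
       = U1 p y * n * (c / sqrt t * g y)"
      using H t by (simp add: drift_def field_simps power2_eq_square)
    moreover have "U1 p y / Hs s y * (c / (2 * sqrt t)) * (- v * n * (Hs s y / (c * sqrt t))) = U1 p y * n * (- v / (2 * t))"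
      using H c t by (simp add: field_simps)
    \<comment> \<open>The spatial derivative of \<open>nd\<close> produces -v/(2t); up to the drift
      contribution this is the time derivative of the noise.\<close>
    moreover have "- v / (2 * t) = noise_dt c z t y + c / sqrt t * g y"
    proof -
      define q where "q = sqrt t"
      have q: "0 < q" "t = q * q" using t by (auto simp: q_def)
      show ?thesis using q(1) c unfolding v_def noise_def noise_dt_def q_def[symmetric] unfolding q(2)
        by (simp add: field_simps power2_eq_square)
    qed
    ultimately show ?thesis by (simp only: distrib_left)
  qed
  ultimately show ?thesis by (simp add: Theta_def[abs_def] s_def n_def)
qed

lemma continuous_noise:
  assumes "0 < c" and "\<And>x. x \<in> A \<Longrightarrow> 0 < fst x \<and> snd x \<in> S"
  shows "continuous_on A (\<lambda>x. noise c z (fst x) (snd x))" "continuous_on A (\<lambda>x. noise_dt c z (fst x) (snd x))"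
    "continuous_on A (\<lambda>x. Hs (c\<^sup>2 * fst x) (snd x))" "continuous_on A (\<lambda>x. rho c z (fst x) (snd x))"
proof -
  have [continuous_intros]: "continuous_on A (\<lambda>x. g (snd x))" "continuous_on A (\<lambda>x. g1 (snd x))"
    using assms by (auto intro!: continuous_on_compose2[OF continuous_g] continuous_on_compose2[OF continuous_g1] continuous_intros)
  show 1: "continuous_on A (\<lambda>x. noise c z (fst x) (snd x))"
    unfolding noise_def using assms by (intro continuous_intros) fastforce+
  show "continuous_on A (\<lambda>x. noise_dt c z (fst x) (snd x))"
    unfolding noise_dt_def using assms by (intro continuous_intros) fastforce+
  show 2: "continuous_on A (\<lambda>x. Hs (c\<^sup>2 * fst x) (snd x))"
    unfolding Hs_def by (intro continuous_intros)
  show "continuous_on A (\<lambda>x. rho c z (fst x) (snd x))"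
    unfolding rho_def using assms by (intro continuous_intros 1 2) fastforce+
qed

text \<open>Times stay above some a > 0, where the integrand is jointly continuous in time and
  space, as the Leibniz rule requires.\<close>

lemma Psi_deriv:
  assumes c: "0 < c" and a: "0 < a" and t: "t \<in> {a..b}" and \<alpha>: "\<alpha> \<in> S" and \<beta>: "\<beta> \<in> S"
  shows "(Psi p c z \<alpha> \<beta> has_real_derivative
     - integral {\<alpha>..\<beta>} (\<lambda>y. U1 p y * (nd (noise c z t y) * noise_dt c z t y))) (at t within {a..b})"
proof -
  have sub: "{\<alpha>..\<beta>} \<subseteq> S" using S_between[OF \<alpha> \<beta>] by auto
  have "((\<lambda>t. integral (cbox \<alpha> \<beta>) (\<lambda>y. U1 p y * Phi (noise c z t y))) has_real_derivative
     integral (cbox \<alpha> \<beta>) (\<lambda>y. U1 p y * (nd (noise c z t y) * noise_dt c z t y))) (at t within {a..b})"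
  proof (rule leibniz_rule_field_derivative)
    fix t y assume "t \<in> {a..b}"
    then show "((\<lambda>t. U1 p y * Phi (noise c z t y)) has_real_derivative U1 p y * (nd (noise c z t y) * noise_dt c z t y)) (at t within {a..b})"
      using a by (intro DERIV_cmult DERIV_chain2[OF Phi_deriv] noise_deriv_t[OF c]) auto
  next
    fix t assume t: "t \<in> {a..b}"
    have "continuous_on {\<alpha>..\<beta>} (\<lambda>y. U1 p y * Phi (noise c z t y))"
      unfolding noise_def using c t a
      by (intro continuous_intros continuous_on_subset[OF continuous_U1 sub] continuous_on_subset[OF continuous_g sub]) auto
    then show "(\<lambda>y. U1 p y * Phi (noise c z t y)) integrable_on cbox \<alpha> \<beta>"
      using integrable_continuous_real by simp
  next
    have "continuous_on ({a..b} \<times> cbox \<alpha> \<beta>) (\<lambda>x. U1 p (snd x) * (nd (noise c z (fst x) (snd x)) * noise_dt c z (fst x) (snd x)))"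
      using c a sub by (intro continuous_intros continuous_noise continuous_on_compose2[OF continuous_U1]) (auto simp: subset_iff)
    then show "continuous_on ({a..b} \<times> cbox \<alpha> \<beta>) (\<lambda>(t, y). U1 p y * (nd (noise c z t y) * noise_dt c z t y))"
      by (simp add: split_beta')
  qed (use t in auto)
  then have "((\<lambda>t. U p \<beta> - integral {\<alpha>..\<beta>} (\<lambda>y. U1 p y * Phi (noise c z t y))) has_real_derivative
     0 - integral {\<alpha>..\<beta>} (\<lambda>y. U1 p y * (nd (noise c z t y) * noise_dt c z t y))) (at t within {a..b})"
    by (intro DERIV_diff DERIV_const) simp
  then show ?thesis by (simp add: Psi_def[abs_def])
qed

text \<open>The density of the step with respect to the state solves the Fokker--Planck equation; testing
  it against \<open>U p\<close> and integrating by parts once is all that is used of Ito's formula.\<close>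

lemma Psi_deriv_le:
  assumes c: "0 < c" and t: "0 < t" and \<alpha>: "\<alpha> \<in> S" and \<beta>: "\<beta> \<in> S" and le: "\<alpha> \<le> \<beta>"
    and e: "continuous_on S e" and drift: "\<And>y. y \<in> S \<Longrightarrow> drift p (c\<^sup>2 * t) y \<le> e y / Hs (c\<^sup>2 * t) y"
  shows "- integral {\<alpha>..\<beta>} (\<lambda>y. U1 p y * (nd (noise c z t y) * noise_dt c z t y))
    \<le> integral {\<alpha>..\<beta>} (\<lambda>y. c\<^sup>2 * e y / (Hs (c\<^sup>2 * t) y)\<^sup>2 * rho c z t y) + Theta p c z t \<alpha> - Theta p c z t \<beta>"
proof -
  have sub: "{\<alpha>..\<beta>} \<subseteq> S" using S_between[OF \<alpha> \<beta>] by auto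
  have s: "0 \<le> c\<^sup>2 * t" using c t by simp
  have H0: "Hs (c\<^sup>2 * t) y \<noteq> 0" if "y \<in> S" for y using Hs_ge_1[OF that s] by simp
  define f where "f y = U1 p y * nd (noise c z t y) * noise_dt c z t y" for y
  define k where "k y = c / sqrt t * nd (noise c z t y) * drift p (c\<^sup>2 * t) y" for y
  have "continuous_on {\<alpha>..\<beta>} f"
    unfolding f_def noise_def noise_dt_def using c t
    by (intro continuous_intros continuous_on_subset[OF continuous_U1 sub] continuous_on_subset[OF continuous_g sub]) auto
  then have f: "(f has_integral integral {\<alpha>..\<beta>} f) {\<alpha>..\<beta>}"
    using integrable_continuous_real integrable_integral by blast
  have "((\<lambda>y. f y + k y) has_integral (Theta p c z t \<beta> - Theta p c z t \<alpha>)) {\<alpha>..\<beta>}"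
  proof (rule fundamental_theorem_of_calculus[OF le])
    fix y assume "y \<in> {\<alpha>..\<beta>}"
    then have "y \<in> S" using sub by blast
    from has_field_derivative_at_within[OF Theta_deriv[OF c t this]]
    show "(Theta p c z t has_vector_derivative f y + k y) (at y within {\<alpha>..\<beta>})"
      unfolding has_real_derivative_iff_has_vector_derivative[symmetric] f_def k_def .
  qed
  from has_integral_diff[OF this f]
  have k: "(k has_integral (Theta p c z t \<beta> - Theta p c z t \<alpha> - integral {\<alpha>..\<beta>} f)) {\<alpha>..\<beta>}" by simp
  have "continuous_on {\<alpha>..\<beta>} (\<lambda>y. c\<^sup>2 * e y / (Hs (c\<^sup>2 * t) y)\<^sup>2 * rho c z t y)"
    unfolding rho_def noise_def Hs_def using c t H0 sub
    by (intro continuous_intros continuous_on_subset[OF e sub] continuous_on_subset[OF continuous_g sub]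
        continuous_on_subset[OF continuous_g1 sub]) (auto simp: Hs_def)
  then have R: "((\<lambda>y. c\<^sup>2 * e y / (Hs (c\<^sup>2 * t) y)\<^sup>2 * rho c z t y) has_integral
      integral {\<alpha>..\<beta>} (\<lambda>y. c\<^sup>2 * e y / (Hs (c\<^sup>2 * t) y)\<^sup>2 * rho c z t y)) {\<alpha>..\<beta>}"
    using integrable_continuous_real integrable_integral by blast
  have "k y \<le> c\<^sup>2 * e y / (Hs (c\<^sup>2 * t) y)\<^sup>2 * rho c z t y" if "y \<in> {\<alpha>..\<beta>}" for y
  proof -
    have yS: "y \<in> S" using that sub by auto
    have "k y \<le> c / sqrt t * nd (noise c z t y) * (e y / Hs (c\<^sup>2 * t) y)"
      unfolding k_def using drift[OF yS] c t by (intro mult_left_mono) auto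
    also have "\<dots> = c\<^sup>2 * e y / (Hs (c\<^sup>2 * t) y)\<^sup>2 * rho c z t y"
      using H0[OF yS] c t by (simp add: rho_def power2_eq_square mult_ac)
    finally show ?thesis .
  qed
  from has_integral_le[OF k R this] show ?thesis by (simp add: f_def[abs_def] mult.assoc)
qed

text \<open>The drift bound is split into \<open>e2 - e1\<close>, so that the negative part can be
  kept on the left as a gain while the positive part appears on the right as a cost; \<epsilon> is
  the price of clipping per unit of time.\<close>

lemma Psi_increment_le:
  assumes c: "0 < c" and a: "0 < a" "a \<le> b" and \<alpha>: "\<alpha> \<in> S" and \<beta>: "\<beta> \<in> S" and le: "\<alpha> \<le> \<beta>"
    and e: "continuous_on S e1" "continuous_on S e2"
    and drift: "\<And>y t. y \<in> S \<Longrightarrow> t \<in> {a..b} \<Longrightarrow> drift p (c\<^sup>2 * t) y \<le> (e2 y - e1 y) / Hs (c\<^sup>2 * t) y"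
    and bdry: "\<And>t. t \<in> {a..b} \<Longrightarrow> Theta p c z t \<alpha> - Theta p c z t \<beta> \<le> \<epsilon>"
  defines "I \<equiv> \<lambda>e t. integral {\<alpha>..\<beta>} (\<lambda>y. c\<^sup>2 * e y / (Hs (c\<^sup>2 * t) y)\<^sup>2 * rho c z t y)"
  shows "continuous_on {a..b} (I e1)" "continuous_on {a..b} (I e2)"
    "Psi p c z \<alpha> \<beta> b + integral {a..b} (I e1) \<le> Psi p c z \<alpha> \<beta> a + integral {a..b} (I e2) + \<epsilon> * (b - a)"
proof -
  have sub: "{\<alpha>..\<beta>} \<subseteq> S" using S_between[OF \<alpha> \<beta>] by auto
  have H0: "Hs (c\<^sup>2 * t) y \<noteq> 0" if "y \<in> S" "0 < t" for y t using Hs_ge_1[OF that(1), of "c\<^sup>2 * t"] that by simp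
  have co: "continuous_on ({a..b} \<times> cbox \<alpha> \<beta>) (\<lambda>(t, y). c\<^sup>2 * e y / (Hs (c\<^sup>2 * t) y)\<^sup>2 * rho c z t y)"
    if e: "continuous_on S e" for e
    unfolding split_beta using c a sub H0
    by (intro continuous_intros continuous_noise continuous_on_compose2[OF e]) (auto simp: subset_iff)
  have coI: "continuous_on {a..b} (I e)" if "continuous_on S e" for e
    using integral_continuous_on_param[OF co[OF that]] by (simp add: I_def)
  show I: "continuous_on {a..b} (I e1)" "continuous_on {a..b} (I e2)" using coI e by auto
  define D where "D t = - integral {\<alpha>..\<beta>} (\<lambda>y. U1 p y * (nd (noise c z t y) * noise_dt c z t y))" for t
  have D: "(D has_integral (Psi p c z \<alpha> \<beta> b - Psi p c z \<alpha> \<beta> a)) {a..b}"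
    using a Psi_deriv[OF c a(1) _ \<alpha> \<beta>] unfolding D_def
    by (intro fundamental_theorem_of_calculus) (auto simp only: has_real_derivative_iff_has_vector_derivative[symmetric])
  have hi: "(I e has_integral integral {a..b} (I e)) {a..b}" if "continuous_on S e" for e
    using coI[OF that] integrable_continuous_real integrable_integral by blast
  have R: "((\<lambda>t. I e2 t - I e1 t + \<epsilon>) has_integral (integral {a..b} (I e2) - integral {a..b} (I e1) + \<epsilon> * (b - a))) {a..b}"
    using has_integral_const_real[of \<epsilon> a b] a
    by (intro has_integral_add has_integral_diff hi e) (auto simp: mult.commute)
  have "D t \<le> I e2 t - I e1 t + \<epsilon>" if t: "t \<in> {a..b}" for t
  proof -
    have t0: "0 < t" using t a by auto
    have int: "(\<lambda>y. c\<^sup>2 * e y / (Hs (c\<^sup>2 * t) y)\<^sup>2 * rho c z t y) integrable_on {\<alpha>..\<beta>}" if "continuous_on S e" for e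
    proof (rule integrable_continuous_real)
      show "continuous_on {\<alpha>..\<beta>} (\<lambda>y. c\<^sup>2 * e y / (Hs (c\<^sup>2 * t) y)\<^sup>2 * rho c z t y)"
      proof -
        have 1: "continuous_on {\<alpha>..\<beta>} (Pair t)" by (intro continuous_intros)
        have 2: "Pair t ` {\<alpha>..\<beta>} \<subseteq> {a..b} \<times> cbox \<alpha> \<beta>" using t by auto
        from continuous_on_compose2[OF co[OF that] 1 2] show ?thesis by simp
      qed
    qed
    have "D t \<le> integral {\<alpha>..\<beta>} (\<lambda>y. c\<^sup>2 * (e2 y - e1 y) / (Hs (c\<^sup>2 * t) y)\<^sup>2 * rho c z t y)
        + Theta p c z t \<alpha> - Theta p c z t \<beta>"
      unfolding D_def using drift t e
      by (intro Psi_deriv_le c t0 \<alpha> \<beta> le) (auto intro: continuous_intros)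
    also have "integral {\<alpha>..\<beta>} (\<lambda>y. c\<^sup>2 * (e2 y - e1 y) / (Hs (c\<^sup>2 * t) y)\<^sup>2 * rho c z t y) = I e2 t - I e1 t"
      unfolding I_def using Henstock_Kurzweil_Integration.integral_diff[OF int[OF e(2)] int[OF e(1)]]
      by (simp add: algebra_simps diff_divide_distrib)
    finally show ?thesis using bdry[OF t] by simp
  qed
  from has_integral_le[OF D R this]
  show "Psi p c z \<alpha> \<beta> b + integral {a..b} (I e1) \<le> Psi p c z \<alpha> \<beta> a + integral {a..b} (I e2) + \<epsilon> * (b - a)"
    by simp
qed

end

lemma nn_integral_Icc_continuous:
  fixes f :: "real \<Rightarrow> real"
  assumes f: "continuous_on {a..b} f" and nn: "\<And>x. x \<in> {a..b} \<Longrightarrow> 0 \<le> f x"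
  shows "(\<integral>\<^sup>+x\<in>{a..b}. ennreal (f x) \<partial>lborel) = ennreal (integral {a..b} f)"
proof -
  have "(\<integral>\<^sup>+x. ennreal (if x \<in> {a..b} then f x else 0) \<partial>lborel) = ennreal (integral {a..b} f)"
  proof (rule nn_integral_has_integral_lborel)
    have "(\<lambda>x. indicator {a..b} x *\<^sub>R f x) \<in> borel_measurable borel"
      by (intro borel_measurable_continuous_on_indicator f) auto
    also have "(\<lambda>x. indicator {a..b} x *\<^sub>R f x) = (\<lambda>x. if x \<in> {a..b} then f x else 0)" by auto
    finally show "(\<lambda>x. if x \<in> {a..b} then f x else 0) \<in> borel_measurable borel" .
    show "((\<lambda>x. if x \<in> {a..b} then f x else 0) has_integral integral {a..b} f) UNIV"
      unfolding has_integral_restrict_UNIV using f integrable_continuous_real integrable_integral by blast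
  qed (use nn in auto)
  also have "(\<integral>\<^sup>+x. ennreal (if x \<in> {a..b} then f x else 0) \<partial>lborel) = (\<integral>\<^sup>+x\<in>{a..b}. ennreal (f x) \<partial>lborel)"
    by (intro nn_integral_cong) (auto simp: indicator_def)
  finally show ?thesis .
qed

section \<open>From clipped paths to the whole state space\<close>

context bem_profile
begin

text \<open>The function e times the squared diffusion coefficient of the step; e = h^(-2-p) gives
  the integrand in (1).\<close>

definition "psi c e t x = c\<^sup>2 * e x / (Hs (c\<^sup>2 * t) x)\<^sup>2"

lemma psi_nonneg: "0 \<le> e x \<Longrightarrow> 0 \<le> psi c e t x"
  by (simp add: psi_def)

lemma continuous_psi:
  assumes "continuous_on S e" "0 \<le> t"
  shows "continuous_on S (psi c e t)"
proof -
  have "Hs (c\<^sup>2 * t) y \<noteq> 0" if "y \<in> S" for y using Hs_ge_1[OF that, of "c\<^sup>2 * t"] assms by simp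
  then show ?thesis unfolding psi_def Hs_def using assms
    by (intro continuous_intros continuous_g1) (auto simp: Hs_def)
qed

text \<open>Substitute \<xi> = noise(y): the event that the step ends in [\<alpha>, \<beta>] becomes
  an interval in \<xi>, and the Jacobian H_x/(c sqrt t) completes the density
  \<open>rho\<close>.\<close>

lemma step_density:
  assumes c: "0 < c" and t: "0 < t" and \<alpha>: "\<alpha> \<in> S" and \<beta>: "\<beta> \<in> S" and le: "\<alpha> \<le> \<beta>"
    and e: "continuous_on S e" and nn: "\<And>x. x \<in> S \<Longrightarrow> 0 \<le> e x"
  shows "(\<integral>\<^sup>+\<xi>. ennreal (psi c e t (stp c z (sqrt t * \<xi>) t)) * indicator {\<alpha>..\<beta>} (stp c z (sqrt t * \<xi>) t) \<partial>N01)
    = ennreal (integral {\<alpha>..\<beta>} (\<lambda>y. c\<^sup>2 * e y / (Hs (c\<^sup>2 * t) y)\<^sup>2 * rho c z t y))"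
proof -
  define X where "X \<xi> = stp c z (sqrt t * \<xi>) t" for \<xi>
  have [measurable]: "X \<in> borel_measurable borel" unfolding X_def using c t by measurable
  have XS: "X \<xi> \<in> S" for \<xi> unfolding X_def by (rule stp_in_S[OF c t])
  have sub: "{\<alpha>..\<beta>} \<subseteq> S" using S_between[OF \<alpha> \<beta>] by auto
  have [measurable]: "(\<lambda>\<xi>. psi c e t (X \<xi>)) \<in> borel_measurable borel"
    by (rule measurable_on_S[OF continuous_psi]) (use e t XS in auto)
  have s: "0 \<le> c\<^sup>2 * t" using t by simp
  have ge: "noise c z t y \<le> \<xi> \<longleftrightarrow> y \<le> X \<xi>" if "y \<in> S" for y \<xi>
  proof -
    have "y \<le> X \<xi> \<longleftrightarrow> noise c z t y \<le> noise c z t (X \<xi>)"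
      using noise_strict_mono[OF c t that XS, of \<xi> z] noise_strict_mono[OF c t XS that, of \<xi> z] by (smt (verit))
    moreover have "noise c z t (X \<xi>) = \<xi>"
    proof -
      have "X \<xi> - z - c\<^sup>2 * t * g (X \<xi>) = c * (sqrt t * \<xi>)"
        using stp_eq[OF c t, of z "sqrt t * \<xi>"] unfolding X_def by linarith
      then show ?thesis using c t by (simp add: noise_def)
    qed
    ultimately show ?thesis by simp
  qed
  have "(\<integral>\<^sup>+\<xi>. ennreal (psi c e t (X \<xi>)) * indicator {\<alpha>..\<beta>} (X \<xi>) \<partial>N01)
      = (\<integral>\<^sup>+\<xi>. ennreal (nd \<xi>) * (ennreal (psi c e t (X \<xi>)) * indicator {\<alpha>..\<beta>} (X \<xi>)) \<partial>lborel)"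
    by (rule nn_integral_density) measurable
  also have "\<dots> = (\<integral>\<^sup>+\<xi>. ennreal (psi c e t (X \<xi>) * nd \<xi> * indicator {noise c z t \<alpha>..noise c z t \<beta>} \<xi>) \<partial>lborel)"
  proof (intro nn_integral_cong)
    fix \<xi>
    have "indicator {\<alpha>..\<beta>} (X \<xi>) = (indicator {noise c z t \<alpha>..noise c z t \<beta>} \<xi> :: ennreal)"
      using ge[OF \<alpha>, of \<xi>] stp_le_noise_iff[OF c t \<beta>, of z \<xi>] by (auto simp: indicator_def X_def)
    then show "ennreal (nd \<xi>) * (ennreal (psi c e t (X \<xi>)) * indicator {\<alpha>..\<beta>} (X \<xi>)) =
        ennreal (psi c e t (X \<xi>) * nd \<xi> * indicator {noise c z t \<alpha>..noise c z t \<beta>} \<xi>)"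
      using psi_nonneg[of e "X \<xi>" c t] nn[OF XS, of \<xi>] by (auto simp: indicator_def ennreal_mult mult.commute)
  qed
  also have "\<dots> = (\<integral>\<^sup>+y. ennreal (psi c e t (X (noise c z t y)) * nd (noise c z t y) * (Hs (c\<^sup>2 * t) y / (c * sqrt t)) * indicator {\<alpha>..\<beta>} y) \<partial>lborel)"
  proof (rule nn_integral_substitution)
    show "set_borel_measurable borel {noise c z t \<alpha>..noise c z t \<beta>} (\<lambda>\<xi>. psi c e t (X \<xi>) * nd \<xi>)"
      unfolding set_borel_measurable_def by measurable
    show "(noise c z t has_real_derivative Hs (c\<^sup>2 * t) y / (c * sqrt t)) (at y)" if "y \<in> {\<alpha>..\<beta>}" for y
      using noise_deriv[OF c t] that sub by blast
    show "continuous_on {\<alpha>..\<beta>} (\<lambda>y. Hs (c\<^sup>2 * t) y / (c * sqrt t))"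
      unfolding Hs_def using c t by (intro continuous_intros continuous_on_subset[OF continuous_g1 sub]) auto
    show "0 \<le> Hs (c\<^sup>2 * t) y / (c * sqrt t)" if "y \<in> {\<alpha>..\<beta>}" for y
    proof -
      have "1 \<le> Hs (c\<^sup>2 * t) y" using that sub by (intro Hs_ge_1 s) auto
      then show ?thesis using c t by simp
    qed
  qed (use le in auto)
  also have "\<dots> = (\<integral>\<^sup>+y\<in>{\<alpha>..\<beta>}. ennreal (c\<^sup>2 * e y / (Hs (c\<^sup>2 * t) y)\<^sup>2 * rho c z t y) \<partial>lborel)"
  proof (intro nn_integral_cong)
    fix y
    show "ennreal (psi c e t (X (noise c z t y)) * nd (noise c z t y) * (Hs (c\<^sup>2 * t) y / (c * sqrt t)) * indicator {\<alpha>..\<beta>} y)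
      = ennreal (c\<^sup>2 * e y / (Hs (c\<^sup>2 * t) y)\<^sup>2 * rho c z t y) * indicator {\<alpha>..\<beta>} y"
    proof (cases "y \<in> {\<alpha>..\<beta>}")
      case True
      then have "X (noise c z t y) = y" using stp_noise[OF c t] sub by (auto simp: X_def)
      then show ?thesis using True by (simp add: psi_def rho_def mult.assoc)
    qed simp
  qed
  also have "\<dots> = ennreal (integral {\<alpha>..\<beta>} (\<lambda>y. c\<^sup>2 * e y / (Hs (c\<^sup>2 * t) y)\<^sup>2 * rho c z t y))"
  proof (rule nn_integral_Icc_continuous)
    have "continuous_on {\<alpha>..\<beta>} (\<lambda>y. psi c e t y * rho c z t y)"
      unfolding rho_def noise_def Hs_def using c t sub
      by (intro continuous_intros continuous_on_subset[OF continuous_psi sub] continuous_on_subset[OF continuous_g sub]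
        continuous_on_subset[OF continuous_g1 sub] e) auto
    then show "continuous_on {\<alpha>..\<beta>} (\<lambda>y. c\<^sup>2 * e y / (Hs (c\<^sup>2 * t) y)\<^sup>2 * rho c z t y)" by (simp add: psi_def)
    show "0 \<le> c\<^sup>2 * e y / (Hs (c\<^sup>2 * t) y)\<^sup>2 * rho c z t y" if "y \<in> {\<alpha>..\<beta>}" for y
    proof -
      have yS: "y \<in> S" using that sub by auto
      have "1 \<le> Hs (c\<^sup>2 * t) y" by (intro Hs_ge_1 s yS)
      then show ?thesis using nn[OF yS] c t by (simp add: rho_def)
    qed
  qed
  finally show ?thesis by (simp add: X_def)
qed

text \<open>As t tends to 0, the noise needed to end in y tends to minus infinity for y < z and to
  plus infinity for y > z, so the distribution function tends to a jump at z, with the value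
  \<open>Phi 0\<close> at the single point z. The dominating function is
  \<open>\<bar>U1 p y\<bar>\<close>.\<close>

lemma Psi_limit:
  assumes c: "0 < c" and \<alpha>: "\<alpha> \<in> S" and \<beta>: "\<beta> \<in> S" and z: "\<alpha> < z" "z < \<beta>"
  shows "(Psi p c z \<alpha> \<beta> \<longlongrightarrow> U p z) (at_right 0)"
proof (rule tendsto_at_right_sequentially[of _ 1])
  fix t :: "nat \<Rightarrow> real" assume t: "\<And>n. 0 < t n" "\<And>n. t n < 1" "decseq t" "t \<longlonglongrightarrow> 0"
  have sub: "{\<alpha>..\<beta>} \<subseteq> S" using S_between[OF \<alpha> \<beta>] by auto
  have t': "filterlim t (at_right 0) sequentially"
    using t by (intro filterlim_at_withinI) auto
  define l where "l y = (if y < z then 0 else if y = z then U1 p y * Phi 0 else U1 p y)" for y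
  have lim: "(\<lambda>n. U1 p y * Phi (noise c z (t n) y)) \<longlonglongrightarrow> l y" for y
  proof -
    have eq: "noise c z (t n) y = (y - z) / c * (1 / sqrt (t n)) - c * g y * sqrt (t n)" for n
      using t(1)[of n] c by (simp add: noise_def field_simps power2_eq_square)
    have "(\<lambda>n. Phi (noise c z (t n) y)) \<longlonglongrightarrow> (if y < z then 0 else if y = z then Phi 0 else 1)"
    proof (cases y z rule: linorder_cases)
      case less
      then have A: "(y - z) / c < 0" using c by (simp add: field_simps)
      have "filterlim (\<lambda>s. A * (1 / sqrt s) - B * sqrt s) at_bot (at_right 0)" if "A < 0" for A B :: real
        using that by real_asymp
      from filterlim_compose[OF this[OF A] t'] have "filterlim (\<lambda>n. noise c z (t n) y) at_bot sequentially"
        unfolding eq .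
      from filterlim_compose[OF Phi_at_bot this] show ?thesis using less by simp
    next
      case equal
      have "((\<lambda>s. - (B * sqrt s)) \<longlongrightarrow> 0) (at_right 0)" for B :: real
        by real_asymp
      from filterlim_compose[OF this[of "c * g y"] t'] have "(\<lambda>n. noise c z (t n) y) \<longlonglongrightarrow> 0"
        unfolding eq using equal by simp
      from isCont_tendsto_compose[OF DERIV_isCont[OF Phi_deriv] this] show ?thesis using equal by simp
    next
      case greater
      then have A: "0 < (y - z) / c" using c by (simp add: field_simps)
      have "filterlim (\<lambda>s. A * (1 / sqrt s) - B * sqrt s) at_top (at_right 0)" if "0 < A" for A B :: real
        using that by real_asymp
      from filterlim_compose[OF this[OF A] t'] have "filterlim (\<lambda>n. noise c z (t n) y) at_top sequentially"
        unfolding eq .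
      from filterlim_compose[OF Phi_at_top this] show ?thesis using greater by simp
    qed
    from tendsto_mult[OF tendsto_const[of "U1 p y"] this] show ?thesis
      by (auto simp: l_def split: if_splits)
  qed
  have "(\<lambda>n. integral {\<alpha>..\<beta>} (\<lambda>y. U1 p y * Phi (noise c z (t n) y))) \<longlonglongrightarrow> integral {\<alpha>..\<beta>} l"
  proof (rule dominated_convergence(2)[where h = "\<lambda>y. \<bar>U1 p y\<bar>"])
    show "(\<lambda>y. U1 p y * Phi (noise c z (t n) y)) integrable_on {\<alpha>..\<beta>}" for n
      unfolding noise_def using c t(1)[of n]
      by (intro integrable_continuous_real continuous_intros continuous_on_subset[OF continuous_U1 sub] continuous_on_subset[OF continuous_g sub]) auto
    show "(\<lambda>y. \<bar>U1 p y\<bar>) integrable_on {\<alpha>..\<beta>}"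
      by (intro integrable_continuous_real continuous_intros continuous_on_subset[OF continuous_U1 sub])
    show "norm (U1 p y * Phi (noise c z (t n) y)) \<le> \<bar>U1 p y\<bar>" for n y
      using Phi_bounds[of "noise c z (t n) y"] by (auto simp: abs_mult intro: mult_left_le)
  qed (use lim in auto)
  moreover have "(l has_integral (U p \<beta> - U p z)) {\<alpha>..\<beta>}"
  proof -
    have sub2: "{z..\<beta>} \<subseteq> {\<alpha>..\<beta>}" using z by auto
    have "(U1 p has_integral (U p \<beta> - U p z)) {z..\<beta>}"
    proof (rule fundamental_theorem_of_calculus)
      fix y assume "y \<in> {z..\<beta>}"
      then have "y \<in> S" using sub sub2 by blast
      from has_field_derivative_at_within[OF U_deriv[OF this]]
      show "(U p has_vector_derivative U1 p y) (at y within {z..\<beta>})"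
        unfolding has_real_derivative_iff_has_vector_derivative[symmetric] .
    qed (use z in auto)
    then have "((\<lambda>y. if y \<in> {z..\<beta>} then U1 p y else 0) has_integral (U p \<beta> - U p z)) {\<alpha>..\<beta>}"
      by (simp only: has_integral_restrict[OF sub2])
    then show ?thesis
      by (rule has_integral_spike[of "{z}", rotated 2]) (auto simp: l_def)
  qed
  ultimately have "(\<lambda>n. U p \<beta> - integral {\<alpha>..\<beta>} (\<lambda>y. U1 p y * Phi (noise c z (t n) y))) \<longlonglongrightarrow> U p \<beta> - (U p \<beta> - U p z)"
    by (intro tendsto_diff tendsto_const) (simp add: integral_unique)
  then show "(\<lambda>n. Psi p c z \<alpha> \<beta> (t n)) \<longlonglongrightarrow> U p z" by (simp add: Psi_def)
qed simp


lemma Theta_le_0: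
  assumes "y \<in> S" "0 < c" "0 < t" "0 < p" "0 \<le> g y"
  shows "Theta p c z t y \<le> 0"
  using assms Hs_ge_1[OF assms(1), of "c\<^sup>2 * t"]
  by (auto simp: Theta_def U1_def intro!: mult_nonpos_nonneg divide_nonpos_nonneg)

lemma Theta_ge_0:
  assumes "y \<in> S" "0 < c" "0 < t" "0 < p" "g y \<le> 0"
  shows "0 \<le> Theta p c z t y"
proof -
  have "p * h y powr (- p) * g y \<le> 0" using assms by (intro mult_nonneg_nonpos) auto
  then have "0 \<le> U1 p y" by (simp add: U1_def)
  then show ?thesis using assms Hs_ge_1[OF assms(1), of "c\<^sup>2 * t"] by (simp add: Theta_def)
qed

text \<open>\<open>Theta\<close> carries the factor \<open>c / (2 * sqrt t)\<close>, singular at t =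
  0. For large y the noise is at least y/(2 c sqrt t), so the tail bound for \<open>nd\<close>
  returns a factor sqrt t; at most k/y^2 remains, uniformly in t.\<close>

lemma Theta_at_infinity:
  assumes r: "r = \<infinity>" and z: "z \<in> S" and c: "0 < c" and b: "0 < b" and p: "0 < p" and \<epsilon>: "0 < \<epsilon>"
  obtains B where "\<And>y t. B \<le> y \<Longrightarrow> 0 < t \<Longrightarrow> t \<le> b \<Longrightarrow> - Theta p c z t y \<le> \<epsilon>"
proof
  define k where "k = p * h z powr (- p) * c\<^sup>2"
  \<comment> \<open>For y >= 1 the drift is at most \<open>c\<^sup>2 * b\<close>, so y >= 2 (z +
    \<open>c\<^sup>2 * b\<close>) leaves half of y after subtracting z and the drift.\<close>
  fix y t assume y: "max (max 1 z) (max (2 * (z + c\<^sup>2 * b)) (k / \<epsilon>)) \<le> y" and t: "0 < t" "t \<le> b"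
  have yS: "y \<in> S" using S_infinite[OF r] y by auto
  have y1: "1 \<le> y" "z \<le> y" "2 * (z + c\<^sup>2 * b) \<le> y" "k / \<epsilon> \<le> y" using y by auto
  have H: "1 \<le> Hs (c\<^sup>2 * t) y" using t by (intro Hs_ge_1 yS) simp
  have g1: "g y \<le> 1 / y" using x_g_le_1[OF yS] y1 by (simp add: field_simps)
  have g0: "0 \<le> g y"
  proof -
    have "0 \<le> h1 y"
      using h_tangent[OF yS, of "y + 1"] h_mono[OF r yS, of "y + 1"] S_infinite[OF r, of "y + 1"] y1 by simp
    then show ?thesis using h_pos[OF yS] by (simp add: g_def)
  qed
  have "1 / y \<le> 1" using y1 by simp
  then have "g y \<le> 1" using g1 by linarith
  have v: "y / (2 * (c * sqrt t)) \<le> noise c z t y"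
  proof -
    have "c\<^sup>2 * t * g y \<le> c\<^sup>2 * b * 1" using \<open>g y \<le> 1\<close> g0 t b by (intro mult_mono) auto
    then have "c\<^sup>2 * t * g y \<le> c\<^sup>2 * b" by simp
    then have "y / 2 \<le> y - z - c\<^sup>2 * t * g y" using y1(3) by argo
    then have "y / 2 / (c * sqrt t) \<le> noise c z t y" unfolding noise_def using c t by (intro divide_right_mono) auto
    then show ?thesis by simp
  qed
  have v0: "0 < y / (2 * (c * sqrt t))" using y1 c t by simp
  then have "nd (noise c z t y) \<le> 1 / noise c z t y" using v by (intro nd_times_le) linarith
  also have "\<dots> \<le> 1 / (y / (2 * (c * sqrt t)))" using v v0 by (intro divide_left_mono mult_pos_pos) linarith+
  finally have n: "nd (noise c z t y) \<le> 2 * (c * sqrt t) / y" by simp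
  have hz: "h y powr (- p) \<le> h z powr (- p)"
    using h_mono[OF r z y1(2)] h_pos[OF z] p by (intro powr_mono2') auto
  have "- Theta p c z t y = (p * h y powr (- p) * g y) / Hs (c\<^sup>2 * t) y * (c / (2 * sqrt t)) * nd (noise c z t y)"
    by (simp add: Theta_def U1_def)
  also have "\<dots> \<le> (p * h z powr (- p) * (1 / y)) / 1 * (c / (2 * sqrt t)) * (2 * (c * sqrt t) / y)"
    using H p g0 g1 hz c t n y1 by (intro mult_mono frac_le) auto
  also have "\<dots> = k / y * (1 / y)" using t y1 by (simp add: k_def field_simps power2_eq_square)
  also have "\<dots> \<le> \<epsilon> * 1"
  proof (intro mult_mono)
    show "k / y \<le> \<epsilon>" using y1 \<epsilon> by (simp add: field_simps)
  qed (use y1 \<epsilon> in auto)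
  finally show "- Theta p c z t y \<le> \<epsilon>" by simp
qed

text \<open>Clipping the paths to \<open>[\<alpha>, \<beta>]\<close> creates the boundary terms \<open>Theta\<close>; they have the good sign where
  \<open>U p\<close> decreases away from \<open>0\<close> or increases towards a finite \<open>r\<close>, and vanish at infinity.\<close>

lemma truncation:
  assumes z: "z \<in> S" and c: "0 < c" and b: "0 < b" and p: "0 < p" and \<epsilon>: "0 < \<epsilon>"
  obtains \<alpha> \<beta> where "\<alpha> \<in> S" "\<beta> \<in> S" "\<alpha> < z" "z < \<beta>" "\<alpha> \<le> \<epsilon>"
    "if r = \<infinity> then 1 / \<epsilon> \<le> \<beta> else real_of_ereal r - \<epsilon> \<le> \<beta>"
    "\<And>t. 0 < t \<Longrightarrow> t \<le> b \<Longrightarrow> Theta p c z t \<alpha> - Theta p c z t \<beta> \<le> \<epsilon>"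
proof -
  obtain y0 c1 where y0: "y0 \<in> S" and c1: "0 < c1"
    and left: "\<And>y. y \<in> S \<Longrightarrow> y \<le> y0 \<Longrightarrow> h y \<le> h y0 / 2 \<Longrightarrow> c1 \<le> h1 y"
    and right: "\<And>y. y \<in> S \<Longrightarrow> y0 \<le> y \<Longrightarrow> h y \<le> h y0 / 2 \<Longrightarrow> r < \<infinity> \<and> h1 y \<le> - c1"
    using boundary_slope by blast
  obtain \<delta> where \<delta>: "0 < \<delta>" "\<And>y. y \<in> S \<Longrightarrow> y \<le> \<delta> \<Longrightarrow> h y \<le> h y0 / 2"
    using near_left[of "h y0 / 2"] h_pos[OF y0] by auto
  \<comment> \<open>\<open>y0\<close> and \<delta> make h' positive at \<alpha>, z/2 keeps \<alpha>
    below z, and \<epsilon> lets the intervals exhaust the state space as \<epsilon> tends to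
    0.\<close>
  define \<alpha> where "\<alpha> = min (min y0 \<delta>) (min (z / 2) \<epsilon>)"
  have a0: "0 < \<alpha>" using state_pos[OF y0] state_pos[OF z] \<delta> \<epsilon> by (simp add: \<alpha>_def)
  have az: "\<alpha> < z" using state_pos[OF z] by (auto simp: \<alpha>_def)
  have aS: "\<alpha> \<in> S" using S_below[OF z a0] az by simp
  have "c1 \<le> h1 \<alpha>" using left[OF aS] \<delta>(2)[OF aS] by (auto simp: \<alpha>_def)
  then have ga: "0 \<le> g \<alpha>" using c1 h_pos[OF aS] by (simp add: g_def)
  note Ta = Theta_le_0[OF aS c _ p ga]
  show ?thesis
  proof (cases "r = \<infinity>")
    case True
    obtain B where B: "\<And>y t. B \<le> y \<Longrightarrow> 0 < t \<Longrightarrow> t \<le> b \<Longrightarrow> - Theta p c z t y \<le> \<epsilon>"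
      using Theta_at_infinity[OF True z c b p \<epsilon>] by blast
    define \<beta> where "\<beta> = max (z + 1) (max (1 / \<epsilon>) B)"
    have "\<beta> \<in> S" using S_infinite[OF True] state_pos[OF z] by (auto simp: \<beta>_def)
    moreover have "Theta p c z t \<alpha> - Theta p c z t \<beta> \<le> \<epsilon>" if "0 < t" "t \<le> b" for t
    proof -
      have "B \<le> \<beta>" by (simp add: \<beta>_def)
      from B[OF this that] Ta[OF that(1), of z] show ?thesis by linarith
    qed
    ultimately show ?thesis using True aS az
      by (intro that[of \<alpha> \<beta>]) (auto simp: \<alpha>_def \<beta>_def)
  next
    case False
    then have r: "r < \<infinity>" by simp
    define R where "R = real_of_ereal r"
    have zR: "z < R" "y0 < R" using S_finite[OF r] z y0 by (auto simp: R_def)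
    define d where "d = min (min ((R - z) / 2) (R - y0)) (min \<epsilon> (h y0 / (2 * L)))"
    define \<beta> where "\<beta> = R - d"
    have "d \<le> (R - z) / 2" unfolding d_def by (rule order_trans[OF min.cobounded1 min.cobounded1])
    then have d: "0 < d" "d \<le> (R - z) / 2" "d \<le> R - y0" "d \<le> \<epsilon>" "d \<le> h y0 / (2 * L)"
      using zR \<epsilon> h_pos[OF y0] L_pos by (auto simp: d_def)
    have b: "z < \<beta>" "y0 \<le> \<beta>" using d zR by (auto simp: \<beta>_def field_simps)
    have bS: "\<beta> \<in> S" using S_finite[OF r] b d state_pos[OF z] by (auto simp: \<beta>_def R_def[symmetric])
    have "h \<beta> \<le> L * d" using h_le_right[OF bS r] by (simp add: \<beta>_def R_def)
    also have "\<dots> \<le> h y0 / 2" using d L_pos by (simp add: field_simps)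
    finally have "h1 \<beta> \<le> - c1" using right[OF bS b(2)] by simp
    then have gb: "g \<beta> \<le> 0" using c1 h_pos[OF bS] by (simp add: g_def divide_nonpos_pos)
    have "Theta p c z t \<alpha> - Theta p c z t \<beta> \<le> \<epsilon>" if "0 < t" "t \<le> b" for t
      using Theta_ge_0[OF bS c that(1) p gb, of z] Ta[OF that(1), of z] \<epsilon> by linarith
    then show ?thesis using False aS az bS b d
      by (intro that[of \<alpha> \<beta>]) (auto simp: \<alpha>_def \<beta>_def R_def)
  qed
qed

definition "step_mean c z e t = (\<integral>\<^sup>+\<xi>. ennreal (psi c e t (stp c z (sqrt t * \<xi>) t)) \<partial>N01)"

text \<open>Ito's formula as an inequality for the unclipped step. Since \<open>e1\<close> and
  \<open>e2\<close> are nonnegative, Fatou's lemma treats the left side and monotonicity the right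
  side, so that no integrability has to be known beforehand although \<open>U p\<close> is unbounded
  near the boundary.\<close>

lemma one_step:
  assumes z: "z \<in> S" and c: "0 < c" and b: "0 < b" and p: "0 < p"
    and e: "continuous_on S e1" "continuous_on S e2"
    and nn: "\<And>x. x \<in> S \<Longrightarrow> 0 \<le> e1 x" "\<And>x. x \<in> S \<Longrightarrow> 0 \<le> e2 x"
    and drift: "\<And>y t. y \<in> S \<Longrightarrow> 0 < t \<Longrightarrow> t \<le> b \<Longrightarrow> drift p (c\<^sup>2 * t) y \<le> (e2 y - e1 y) / Hs (c\<^sup>2 * t) y"
  shows "(\<integral>\<^sup>+\<xi>. ennreal (U p (stp c z (sqrt b * \<xi>) b)) \<partial>N01) + (\<integral>\<^sup>+t\<in>{0<..b}. step_mean c z e1 t \<partial>lborel)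
    \<le> ennreal (U p z) + (\<integral>\<^sup>+t\<in>{0<..b}. step_mean c z e2 t \<partial>lborel)"
proof -
  interpret N: prob_space N01 by (rule prob_N01)
  define \<epsilon> where "\<epsilon> j = 1 / real (Suc j)" for j
  have \<epsilon>: "0 < \<epsilon> j" for j by (simp add: \<epsilon>_def)
  have \<epsilon>0: "\<epsilon> \<longlonglongrightarrow> 0" unfolding \<epsilon>_def by (rule LIMSEQ_Suc[OF lim_1_over_n])
  have "\<exists>\<alpha> \<beta>. \<alpha> \<in> S \<and> \<beta> \<in> S \<and> \<alpha> < z \<and> z < \<beta> \<and> \<alpha> \<le> \<epsilon> j \<and>
    (if r = \<infinity> then 1 / \<epsilon> j \<le> \<beta> else real_of_ereal r - \<epsilon> j \<le> \<beta>) \<and>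
    (\<forall>t. 0 < t \<and> t \<le> b \<longrightarrow> Theta p c z t \<alpha> - Theta p c z t \<beta> \<le> \<epsilon> j)" for j
    using truncation[OF z c b p \<epsilon>[of j]] by metis
  then obtain \<alpha> \<beta> where \<alpha>: "\<And>j. \<alpha> j \<in> S" and \<beta>: "\<And>j. \<beta> j \<in> S" and \<alpha>z: "\<And>j. \<alpha> j < z" and z\<beta>: "\<And>j. z < \<beta> j"
    and \<alpha>0: "\<And>j. \<alpha> j \<le> \<epsilon> j" and \<beta>r: "\<And>j. if r = \<infinity> then 1 / \<epsilon> j \<le> \<beta> j else real_of_ereal r - \<epsilon> j \<le> \<beta> j"
    and bd: "\<And>j t. 0 < t \<Longrightarrow> t \<le> b \<Longrightarrow> Theta p c z t (\<alpha> j) - Theta p c z t (\<beta> j) \<le> \<epsilon> j"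
    by metis
  have le: "\<alpha> j \<le> \<beta> j" for j using \<alpha>z[of j] z\<beta>[of j] by simp
  \<comment> \<open>The starting time is chosen after the clipping interval, by
    \<open>Psi_limit\<close> for that interval; staying below \<open>\<epsilon> j\<close> makes the
    time intervals exhaust (0, b].\<close>
  have "\<exists>a>0. a < b \<and> a < \<epsilon> j \<and> Psi p c z (\<alpha> j) (\<beta> j) a \<le> U p z + \<epsilon> j" for j
  proof -
    have "\<forall>\<^sub>F a in at_right 0. Psi p c z (\<alpha> j) (\<beta> j) a < U p z + \<epsilon> j"
      by (rule order_tendstoD(2)[OF Psi_limit[OF c \<alpha> \<beta> \<alpha>z z\<beta>]]) (simp add: \<epsilon>)
    moreover have "\<forall>\<^sub>F a in at_right (0::real). 0 < a \<and> a < min b (\<epsilon> j)"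
      using eventually_at_right_real[of 0 "min b (\<epsilon> j)"] b \<epsilon>[of j] by (auto elim: eventually_mono)
    ultimately have "\<forall>\<^sub>F a in at_right 0. 0 < a \<and> a < b \<and> a < \<epsilon> j \<and> Psi p c z (\<alpha> j) (\<beta> j) a \<le> U p z + \<epsilon> j"
      by eventually_elim auto
    then show ?thesis using eventually_happens' trivial_limit_at_right_real by blast
  qed
  then obtain a where a0: "\<And>j. 0 < a j" and ab: "\<And>j. a j < b" and a\<epsilon>: "\<And>j. a j < \<epsilon> j"
    and Pa: "\<And>j. Psi p c z (\<alpha> j) (\<beta> j) (a j) \<le> U p z + \<epsilon> j" by metis
  have ev: "\<forall>\<^sub>F j in sequentially. \<alpha> j \<le> y \<and> y \<le> \<beta> j" if y: "y \<in> S" for y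
  proof -
    have 1: "\<forall>\<^sub>F j in sequentially. \<epsilon> j < y" by (rule order_tendstoD(2)[OF \<epsilon>0 state_pos[OF y]])
    show ?thesis
    proof (cases "r = \<infinity>")
      case True
      have "\<forall>\<^sub>F j in sequentially. y \<le> real (Suc j)"
        using eventually_ge_at_top[of "nat \<lceil>y\<rceil>"] by eventually_elim linarith
      with 1 show ?thesis
      proof eventually_elim
        case (elim j)
        then show ?case using \<alpha>0[of j] \<beta>r[of j] True by (simp add: \<epsilon>_def)
      qed
    next
      case False
      then have "0 < real_of_ereal r - y" using S_finite[of y] y by auto
      from order_tendstoD(2)[OF \<epsilon>0 this] 1 show ?thesis
      proof eventually_elim
        case (elim j)
        then show ?case using \<alpha>0[of j] \<beta>r[of j] False by simp
      qed
    qed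
  qed
  define X where "X t \<xi> = stp c z (sqrt t * \<xi>) t" for t \<xi>
  have XS: "X t \<xi> \<in> S" if "0 < t" for t \<xi> unfolding X_def by (rule stp_in_S[OF c that])
  have Xm: "X t \<in> borel_measurable borel" if "0 < t" for t unfolding X_def using c that by measurable
  have psiX: "(\<lambda>\<xi>. psi c e t (X t \<xi>)) \<in> borel_measurable borel" if "continuous_on S e" "0 < t" for e t
    by (rule measurable_on_S[OF continuous_psi]) (use that XS Xm in auto)
  have psinn: "0 \<le> psi c e2 t (X t \<xi>)" "0 \<le> psi c e1 t (X t \<xi>)" if "0 < t" for t \<xi>
    using nn XS[OF that] by (auto intro!: psi_nonneg)
  define I where "I e j t = integral {\<alpha> j..\<beta> j} (\<lambda>y. c\<^sup>2 * e y / (Hs (c\<^sup>2 * t) y)\<^sup>2 * rho c z t y)" for e j t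
  have dr: "drift p (c\<^sup>2 * t) y \<le> (e2 y - e1 y) / Hs (c\<^sup>2 * t) y" if "y \<in> S" "t \<in> {a j..b}" for y t j
    using drift[OF that(1), of t] that(2) a0[of j] by auto
  have bd': "Theta p c z t (\<alpha> j) - Theta p c z t (\<beta> j) \<le> \<epsilon> j" if "t \<in> {a j..b}" for t j
    using bd[of t j] that a0[of j] by auto
  have I_abs: "I e j = (\<lambda>t. integral {\<alpha> j..\<beta> j} (\<lambda>y. c\<^sup>2 * e y / (Hs (c\<^sup>2 * t) y)\<^sup>2 * rho c z t y))" for e j
    by (simp add: I_def fun_eq_iff)
  have inc: "continuous_on {a j..b} (I e1 j)" "continuous_on {a j..b} (I e2 j)"
    "Psi p c z (\<alpha> j) (\<beta> j) b + integral {a j..b} (I e1 j)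
      \<le> Psi p c z (\<alpha> j) (\<beta> j) (a j) + integral {a j..b} (I e2 j) + \<epsilon> j * (b - a j)" for j
  proof -
    note * = Psi_increment_le[OF c a0[of j] less_imp_le[OF ab[of j]] \<alpha>[of j] \<beta>[of j] le[of j] e dr[of _ _ j] bd'[of _ j]]
    show "continuous_on {a j..b} (I e1 j)" unfolding I_abs by (rule *(1))
    show "continuous_on {a j..b} (I e2 j)" unfolding I_abs by (rule *(2))
    show "Psi p c z (\<alpha> j) (\<beta> j) b + integral {a j..b} (I e1 j)
      \<le> Psi p c z (\<alpha> j) (\<beta> j) (a j) + integral {a j..b} (I e2 j) + \<epsilon> j * (b - a j)"
      unfolding I_abs by (rule *(3))
  qed
  have I_nn: "ennreal (I e j t) = (\<integral>\<^sup>+\<xi>. ennreal (psi c e t (X t \<xi>)) * indicator {\<alpha> j..\<beta> j} (X t \<xi>) \<partial>N01)"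
    if "continuous_on S e" "\<And>x. x \<in> S \<Longrightarrow> 0 \<le> e x" "0 < t" for e j t
    unfolding I_def X_def by (rule step_density[symmetric, OF c that(3) \<alpha> \<beta> le that(1,2)])
  have I0: "0 \<le> I e j t" if e: "continuous_on S e" "\<And>x. x \<in> S \<Longrightarrow> 0 \<le> e x" "0 < t" for e j t
    unfolding I_def
  proof (rule integral_nonneg)
    have sub: "{\<alpha> j..\<beta> j} \<subseteq> S" using S_between[OF \<alpha> \<beta>] by auto
    have H0: "1 \<le> Hs (c\<^sup>2 * t) y" if "y \<in> S" for y using Hs_ge_1[OF that, of "c\<^sup>2 * t"] \<open>0 < t\<close> by simp
    show "0 \<le> c\<^sup>2 * e y / (Hs (c\<^sup>2 * t) y)\<^sup>2 * rho c z t y" if "y \<in> {\<alpha> j..\<beta> j}" for y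
    proof -
      have "y \<in> S" using that sub by blast
      from H0[OF this] e(2)[OF this] show ?thesis using e(3) c by (simp add: rho_def)
    qed
    have "continuous_on {\<alpha> j..\<beta> j} (\<lambda>y. psi c e t y * rho c z t y)"
      unfolding rho_def noise_def Hs_def using c e sub
      by (intro continuous_intros continuous_on_subset[OF continuous_psi sub] continuous_on_subset[OF continuous_g sub]
        continuous_on_subset[OF continuous_g1 sub] e) auto
    then show "(\<lambda>y. c\<^sup>2 * e y / (Hs (c\<^sup>2 * t) y)\<^sup>2 * rho c z t y) integrable_on {\<alpha> j..\<beta> j}"
      by (intro integrable_continuous_real) (simp add: psi_def)
  qed
  have II_nn: "ennreal (integral {a j..b} (I e j)) = (\<integral>\<^sup>+t\<in>{a j..b}. ennreal (I e j t) \<partial>lborel)"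
    if "continuous_on {a j..b} (I e j)" "continuous_on S e" "\<And>x. x \<in> S \<Longrightarrow> 0 \<le> e x" for e j
    using that a0[of j] by (intro nn_integral_Icc_continuous[symmetric] I0) auto
  define F where "F j = (\<integral>\<^sup>+\<xi>. ennreal (U p (clip (\<alpha> j) (\<beta> j) (X b \<xi>))) \<partial>N01)" for j
  define G where "G j t = (\<integral>\<^sup>+\<xi>. ennreal (psi c e1 t (X t \<xi>)) * indicator {\<alpha> j..\<beta> j} (X t \<xi>) \<partial>N01) * indicator {a j..b} t" for j t
  define R where "R = (\<integral>\<^sup>+t\<in>{0<..b}. step_mean c z e2 t \<partial>lborel)"
  have Umeas: "(\<lambda>\<xi>. U p (clip (\<alpha> j) (\<beta> j) (X b \<xi>))) \<in> borel_measurable borel" for j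
    by (rule measurable_on_S[OF continuous_U]) (use b Xm[OF b] clip_in_S[OF \<alpha> \<beta> le] in \<open>auto simp: clip_def\<close>)
  have Unn: "0 \<le> U p x" for x by (simp add: U_def)
  have FPsi: "F j = ennreal (Psi p c z (\<alpha> j) (\<beta> j) b)" for j
  proof -
    have sub: "{\<alpha> j..\<beta> j} \<subseteq> S" using S_between[OF \<alpha> \<beta>] by auto
    obtain B where B: "\<And>y. y \<in> {\<alpha> j..\<beta> j} \<Longrightarrow> \<bar>U p y\<bar> \<le> B"
      using compact_imp_bounded[OF compact_continuous_image[OF continuous_on_subset[OF continuous_U sub] compact_Icc], of p]
      by (force simp: bounded_iff)
    have "clip (\<alpha> j) (\<beta> j) x \<in> {\<alpha> j..\<beta> j}" for x using le[of j] by (auto simp: clip_def)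
    then have "integrable N01 (\<lambda>\<xi>. U p (clip (\<alpha> j) (\<beta> j) (X b \<xi>)))"
      using Umeas[of j] B by (intro N.integrable_const_bound[where B = B]) auto
    then have "F j = ennreal (\<integral>\<xi>. U p (clip (\<alpha> j) (\<beta> j) (X b \<xi>)) \<partial>N01)"
      unfolding F_def using Unn by (intro nn_integral_eq_integral) auto
    then show ?thesis unfolding Psi_eq[OF c b \<alpha> \<beta> le] X_def .
  qed
  have main: "F j + (\<integral>\<^sup>+t. G j t \<partial>lborel) \<le> ennreal (U p z) + R + ennreal (\<epsilon> j + \<epsilon> j * b)" for j
  proof -
    have E1: "(\<integral>\<^sup>+t. G j t \<partial>lborel) = ennreal (integral {a j..b} (I e1 j))"
    proof -
      have "ennreal (integral {a j..b} (I e1 j)) = (\<integral>\<^sup>+t\<in>{a j..b}. ennreal (I e1 j t) \<partial>lborel)"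
        by (rule II_nn[OF inc(1) e(1) nn(1)])
      also have "\<dots> = (\<integral>\<^sup>+t. G j t \<partial>lborel)"
        unfolding G_def using a0[of j]
        by (intro nn_integral_cong) (auto simp: I_nn[OF e(1) nn(1)] indicator_def)
      finally show ?thesis by simp
    qed
    have "ennreal (integral {a j..b} (I e2 j)) = (\<integral>\<^sup>+t\<in>{a j..b}. ennreal (I e2 j t) \<partial>lborel)"
      by (rule II_nn[OF inc(2) e(2) nn(2)])
    also have "\<dots> \<le> R"
      unfolding R_def step_mean_def X_def[symmetric]
    proof (intro nn_integral_mono)
      fix t
      show "ennreal (I e2 j t) * indicator {a j..b} t \<le> (\<integral>\<^sup>+\<xi>. ennreal (psi c e2 t (X t \<xi>)) \<partial>N01) * indicator {0<..b} t"
        using a0[of j] by (auto simp: indicator_def I_nn[OF e(2) nn(2)] intro!: nn_integral_mono)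
    qed
    finally have IR: "ennreal (integral {a j..b} (I e2 j)) \<le> R" .
    have P0: "0 \<le> integral {a j..b} (I e i)" if "i = j" "continuous_on {a j..b} (I e i)" "continuous_on S e" "\<And>x. x \<in> S \<Longrightarrow> 0 \<le> e x" for e i
      using that a0[of j] by (intro integral_nonneg integrable_continuous_real I0) auto
    have "Psi p c z (\<alpha> j) (\<beta> j) b + integral {a j..b} (I e1 j)
      \<le> U p z + integral {a j..b} (I e2 j) + (\<epsilon> j + \<epsilon> j * b)"
    proof -
      have "\<epsilon> j * (b - a j) \<le> \<epsilon> j * b" using a0[of j] \<epsilon>[of j] by (intro mult_left_mono) auto
      then show ?thesis using inc(3)[of j] Pa[of j] by linarith
    qed
    then have "ennreal (Psi p c z (\<alpha> j) (\<beta> j) b + integral {a j..b} (I e1 j))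
      \<le> ennreal (U p z + integral {a j..b} (I e2 j) + (\<epsilon> j + \<epsilon> j * b))" by (rule ennreal_leI)
    moreover have "0 \<le> Psi p c z (\<alpha> j) (\<beta> j) b"
      unfolding Psi_eq[OF c b \<alpha> \<beta> le] by (intro integral_nonneg_AE AE_I2 Unn)
    ultimately have "F j + (\<integral>\<^sup>+t. G j t \<partial>lborel) \<le> ennreal (U p z) + ennreal (integral {a j..b} (I e2 j)) + ennreal (\<epsilon> j + \<epsilon> j * b)"
      unfolding FPsi E1 using P0[OF refl inc(1) e(1) nn(1)] P0[OF refl inc(2) e(2) nn(2)] Unn[of z] \<epsilon>[of j] b
      by (simp add: ennreal_plus[symmetric] del: ennreal_plus)
    also have "\<dots> \<le> ennreal (U p z) + R + ennreal (\<epsilon> j + \<epsilon> j * b)"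
      using IR by (intro add_mono) auto
    finally show ?thesis .
  qed
  have ind: "(\<lambda>j. indicator {\<alpha> j..\<beta> j} y :: ennreal) \<longlonglongrightarrow> 1" if "y \<in> S" for y
    by (rule tendsto_eventually) (use ev[OF that] in eventually_elim, auto)
  \<comment> \<open>Each point eventually lies inside the clipping intervals, so the clipped values
    converge by being eventually constant.\<close>
  have LF: "(\<integral>\<^sup>+\<xi>. ennreal (U p (X b \<xi>)) \<partial>N01) \<le> liminf F"
  proof -
    have "(\<integral>\<^sup>+\<xi>. ennreal (U p (X b \<xi>)) \<partial>N01) \<le> (\<integral>\<^sup>+\<xi>. liminf (\<lambda>j. ennreal (U p (clip (\<alpha> j) (\<beta> j) (X b \<xi>)))) \<partial>N01)"
    proof (intro nn_integral_mono)
      fix \<xi>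
      have "(\<lambda>j. ennreal (U p (clip (\<alpha> j) (\<beta> j) (X b \<xi>)))) \<longlonglongrightarrow> ennreal (U p (X b \<xi>))"
        by (rule tendsto_eventually) (use ev[OF XS[OF b], of \<xi>] in eventually_elim, auto simp: clip_def)
      from lim_imp_Liminf[OF _ this]
      show "ennreal (U p (X b \<xi>)) \<le> liminf (\<lambda>j. ennreal (U p (clip (\<alpha> j) (\<beta> j) (X b \<xi>))))" by simp
    qed
    also have "\<dots> \<le> liminf F" unfolding F_def
      by (rule nn_integral_liminf) (use Umeas in auto)
    finally show ?thesis .
  qed
  have LG: "(\<integral>\<^sup>+t\<in>{0<..b}. step_mean c z e1 t \<partial>lborel) \<le> liminf (\<lambda>j. \<integral>\<^sup>+t. G j t \<partial>lborel)"
  proof -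
    have "(\<integral>\<^sup>+t\<in>{0<..b}. step_mean c z e1 t \<partial>lborel) \<le> (\<integral>\<^sup>+t. liminf (\<lambda>j. G j t) \<partial>lborel)"
    proof (intro nn_integral_mono)
      fix t
      show "step_mean c z e1 t * indicator {0<..b} t \<le> liminf (\<lambda>j. G j t)"
      proof (cases "t \<in> {0<..b}")
        case True
        then have t: "0 < t" "t \<le> b" by auto
        have "(\<integral>\<^sup>+\<xi>. ennreal (psi c e1 t (X t \<xi>)) \<partial>N01) \<le> (\<integral>\<^sup>+\<xi>. liminf (\<lambda>j. ennreal (psi c e1 t (X t \<xi>)) * indicator {\<alpha> j..\<beta> j} (X t \<xi>)) \<partial>N01)"
        proof (intro nn_integral_mono)
          fix \<xi>
          have "(\<lambda>j. ennreal (psi c e1 t (X t \<xi>)) * indicator {\<alpha> j..\<beta> j} (X t \<xi>)) \<longlonglongrightarrow> ennreal (psi c e1 t (X t \<xi>))"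
            by (rule tendsto_eventually) (use ev[OF XS[OF t(1)], of \<xi>] in eventually_elim, auto)
          from lim_imp_Liminf[OF _ this]
          show "ennreal (psi c e1 t (X t \<xi>)) \<le> liminf (\<lambda>j. ennreal (psi c e1 t (X t \<xi>)) * indicator {\<alpha> j..\<beta> j} (X t \<xi>))" by simp
        qed
        also have "\<dots> \<le> liminf (\<lambda>j. \<integral>\<^sup>+\<xi>. ennreal (psi c e1 t (X t \<xi>)) * indicator {\<alpha> j..\<beta> j} (X t \<xi>) \<partial>N01)"
        proof (rule nn_integral_liminf)
          note [measurable] = psiX[OF e(1) t(1)] Xm[OF t(1)]
          show "(\<lambda>\<xi>. ennreal (psi c e1 t (X t \<xi>)) * indicator {\<alpha> j..\<beta> j} (X t \<xi>)) \<in> borel_measurable N01" for j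
            by measurable
        qed
        also have "\<dots> = liminf (\<lambda>j. G j t)"
        proof (rule Liminf_eq)
          have "\<forall>\<^sub>F j in sequentially. \<epsilon> j < t" by (rule order_tendstoD(2)[OF \<epsilon>0 t(1)])
          then show "\<forall>\<^sub>F j in sequentially. (\<integral>\<^sup>+\<xi>. ennreal (psi c e1 t (X t \<xi>)) * indicator {\<alpha> j..\<beta> j} (X t \<xi>) \<partial>N01) = G j t"
          proof eventually_elim
            case (elim j)
            then have "t \<in> {a j..b}" using a\<epsilon>[of j] t by auto
            then show ?case by (simp add: G_def)
          qed
        qed
        finally show ?thesis using True by (simp add: step_mean_def X_def)
      qed simp
    qed
    also have "\<dots> \<le> liminf (\<lambda>j. \<integral>\<^sup>+t. G j t \<partial>lborel)"
    proof (rule nn_integral_liminf)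
      fix j
      have "(\<lambda>t. indicator {a j..b} t *\<^sub>R I e1 j t) \<in> borel_measurable borel"
        by (intro borel_measurable_continuous_on_indicator inc(1)) auto
      then have "(\<lambda>t. ennreal (indicator {a j..b} t *\<^sub>R I e1 j t)) \<in> borel_measurable borel" by measurable
      also have "(\<lambda>t. ennreal (indicator {a j..b} t *\<^sub>R I e1 j t)) = G j"
        using a0[of j] by (auto simp: fun_eq_iff G_def indicator_def I_nn[OF e(1) nn(1)])
      finally show "G j \<in> borel_measurable lborel" by simp
    qed
    finally show ?thesis .
  qed
  \<comment> \<open>The two limits inferior are joined by superadditivity; the errors
    \<open>\<epsilon> j + \<epsilon> j * b\<close> disappear in the limit.\<close>
  have "(\<integral>\<^sup>+\<xi>. ennreal (U p (X b \<xi>)) \<partial>N01) + (\<integral>\<^sup>+t\<in>{0<..b}. step_mean c z e1 t \<partial>lborel)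
    \<le> liminf (\<lambda>j. F j + (\<integral>\<^sup>+t. G j t \<partial>lborel))"
    by (rule order_trans[OF add_mono[OF LF LG] ennreal_liminf_add])
  also have "\<dots> \<le> liminf (\<lambda>j. ennreal (U p z) + R + ennreal (\<epsilon> j + \<epsilon> j * b))"
    by (intro Liminf_mono always_eventually allI main)
  also have "\<dots> = ennreal (U p z) + R"
  proof -
    have "(\<lambda>j. \<epsilon> j + \<epsilon> j * b) \<longlonglongrightarrow> 0 + 0 * b" by (intro tendsto_intros \<epsilon>0)
    from tendsto_add[OF tendsto_const[of "ennreal (U p z) + R"] tendsto_ennrealI[OF this]]
    show ?thesis by (intro lim_imp_Liminf) simp_all
  qed
  finally show ?thesis by (simp add: R_def X_def)
qed

end

subsection \<open>One-step estimates\<close>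

lemma N01_integrable_one_plus_square: "integrable N01 (\<lambda>x. (1 + x\<^sup>2) ^ n)"
proof -
  have "(\<lambda>x::real. (1 + x\<^sup>2) ^ n) = (\<lambda>x. \<Sum>k\<le>n. of_nat (n choose k) * x ^ (2 * (n - k)))"
    by (simp add: binomial_ring power_mult)
  then show ?thesis by (auto intro!: integrable_mult_right integrable_std_normal_distribution_moment)
qed

lemma N01_mean: "(\<integral>x. x \<partial>N01) = 0" "(\<integral>x. x\<^sup>2 \<partial>N01) = 1"
  using integral_std_normal_distribution_moment_odd[of 1] std_normal_distribution_even_moments[of 1] by simp_all

text \<open>The linear term is kept exact because in \<open>moment_step\<close> its mean is of
  smaller order than its size; only the quadratic remainder is estimated.\<close>

lemma power_taylor_bound:
  fixes u :: real
  assumes "- 1 \<le> u"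
  shows "(1 + u) ^ m \<le> 1 + m * u + (real m)\<^sup>2 * (u\<^sup>2 * (1 + \<bar>u\<bar>) ^ m)"
proof (induction m)
  case (Suc m)
  define A where "A = (1 + \<bar>u\<bar>) ^ m"
  have A: "1 \<le> A" by (simp add: A_def)
  have "(1 + u) ^ Suc m \<le> (1 + u) * (1 + m * u + (real m)\<^sup>2 * (u\<^sup>2 * A))"
    using Suc assms by (simp add: A_def mult_left_mono)
  also have "\<dots> = 1 + Suc m * u + (real m * u\<^sup>2 + (real m)\<^sup>2 * (u\<^sup>2 * ((1 + u) * A)))"
    by (simp add: power2_eq_square algebra_simps)
  also have "real m * u\<^sup>2 + (real m)\<^sup>2 * (u\<^sup>2 * ((1 + u) * A)) \<le> (real (Suc m))\<^sup>2 * (u\<^sup>2 * ((1 + \<bar>u\<bar>) * A))"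
  proof -
    have "(real m)\<^sup>2 * (u\<^sup>2 * ((1 + u) * A)) \<le> (real m)\<^sup>2 * (u\<^sup>2 * ((1 + \<bar>u\<bar>) * A))"
      using A by (intro mult_left_mono mult_right_mono) auto
    moreover have "real m * u\<^sup>2 \<le> (2 * real m + 1) * (u\<^sup>2 * ((1 + \<bar>u\<bar>) * A))"
    proof (intro mult_mono)
      have "u\<^sup>2 * (1 * 1) \<le> u\<^sup>2 * ((1 + \<bar>u\<bar>) * A)" using A by (intro mult_left_mono mult_mono) auto
      then show "u\<^sup>2 \<le> u\<^sup>2 * ((1 + \<bar>u\<bar>) * A)" by simp
    qed auto
    moreover have "(real (Suc m))\<^sup>2 = (real m)\<^sup>2 + (2 * real m + 1)" by (simp add: power2_eq_square algebra_simps)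
    ultimately show ?thesis by (simp add: distrib_right)
  qed
  finally show ?case by (simp add: A_def mult_ac)
qed simp

context bem_profile
begin

text \<open>By \<open>stp_square\<close>, 1 + X^2 <= A (1 + u) with A = 1 + z^2, where u has size
  sqrt s but mean at most 3 s for \<open>s = c\<^sup>2 * b\<close>. With the linear term kept exact,
  the moment grows by a factor 1 + O(s) per step, as Gronwall's argument demands.\<close>

lemma moment_step:
  assumes s0: "0 \<le> s0"
  obtains K where "0 \<le> K"
    "\<And>z c b. z \<in> S \<Longrightarrow> 0 < c \<Longrightarrow> 0 < b \<Longrightarrow> c\<^sup>2 * b \<le> s0 \<Longrightarrow>
      (\<integral>\<^sup>+\<xi>. ennreal ((1 + (stp c z (sqrt b * \<xi>) b)\<^sup>2) ^ m) \<partial>N01) \<le> ennreal ((1 + K * (c\<^sup>2 * b)) * (1 + z\<^sup>2) ^ m)"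
proof -
  interpret N: prob_space N01 by (rule prob_N01)
  \<comment> \<open>\<open>D\<close> bounds |u| by sqrt s D (1 + x^2), \<open>D'\<close> bounds 1 +
    |u| by D' (1 + x^2), \<open>C1\<close> is the resulting factor of the remainder and
    \<open>M\<close> its Gaussian moment.\<close>
  define D where "D = 1 + 2 * sqrt s0"
  define D' where "D' = 1 + sqrt s0 * D"
  define C1 where "C1 = (real m)\<^sup>2 * (D\<^sup>2 * D' ^ m)"
  define M where "M = (\<integral>x. (1 + x\<^sup>2) ^ (m + 2) \<partial>N01)"
  have D: "1 \<le> D" "1 \<le> D'" using s0 by (auto simp: D_def D'_def)
  have C1: "0 \<le> C1" using D by (simp add: C1_def)
  have M: "0 \<le> M" unfolding M_def by (intro integral_nonneg_AE AE_I2) simp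
  show ?thesis
  proof (rule that[of "3 * real m + C1 * M"])
    show "0 \<le> 3 * real m + C1 * M" using C1 M by simp
    fix z c b assume z: "z \<in> S" and c: "0 < c" and b: "0 < b" and s0b: "c\<^sup>2 * b \<le> s0"
    define s where "s = c\<^sup>2 * b"
    define A where "A = 1 + z\<^sup>2"
    have s: "0 < s" "s \<le> s0" using c b s0b by (auto simp: s_def)
    have A: "1 \<le> A" by (simp add: A_def)
    define u where "u x = (2 * z * sqrt s * x + s * x\<^sup>2 + 2 * s) / A" for x
    have ss: "c * sqrt b = sqrt s" using c by (simp add: s_def real_sqrt_mult)
    have Au: "A * (1 + u x) = 1 + (z + sqrt s * x)\<^sup>2 + 2 * s" for x
      using A s by (simp add: u_def field_simps power2_eq_square) (simp add: A_def power2_eq_square algebra_simps)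
    have u1: "- 1 \<le> u x" for x
    proof -
      have "0 \<le> A * (1 + u x)" unfolding Au using s by simp
      then show ?thesis using A by (simp add: zero_le_mult_iff)
    qed
    have ub: "\<bar>u x\<bar> \<le> sqrt s * (D * (1 + x\<^sup>2))" for x
    proof -
      have "\<bar>2 * z\<bar> \<le> A" using zero_le_power2[of "\<bar>z\<bar> - 1"] by (simp add: A_def power2_diff)
      have "\<bar>x\<bar> \<le> 1 + x\<^sup>2" using zero_le_power2[of "\<bar>x\<bar> - 1"] by (simp add: power2_diff)
      have "\<bar>2 * z * sqrt s * x + s * x\<^sup>2 + 2 * s\<bar> \<le> \<bar>2 * z\<bar> * (sqrt s * \<bar>x\<bar>) + s * (x\<^sup>2 + 2)"
        using s by (auto simp: abs_mult algebra_simps intro!: order_trans[OF abs_triangle_ineq])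
      also have "\<dots> \<le> A * (sqrt s * (1 + x\<^sup>2)) + A * (sqrt s * (sqrt s0 * (2 * (1 + x\<^sup>2))))"
      proof (rule add_mono)
        show "\<bar>2 * z\<bar> * (sqrt s * \<bar>x\<bar>) \<le> A * (sqrt s * (1 + x\<^sup>2))"
          using A s \<open>\<bar>2 * z\<bar> \<le> A\<close> \<open>\<bar>x\<bar> \<le> 1 + x\<^sup>2\<close> by (intro mult_mono) auto
        have "s = sqrt s * sqrt s" using s by simp
        also have "\<dots> \<le> sqrt s * sqrt s0" using s by (intro mult_left_mono) auto
        finally have "s * (x\<^sup>2 + 2) \<le> (sqrt s * sqrt s0) * (2 * (1 + x\<^sup>2))" using s s0 by (intro mult_mono) auto
        also have "\<dots> \<le> A * ((sqrt s * sqrt s0) * (2 * (1 + x\<^sup>2)))"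
          using A s s0 mult_right_mono[of 1 A "(sqrt s * sqrt s0) * (2 * (1 + x\<^sup>2))"] by simp
        finally show "s * (x\<^sup>2 + 2) \<le> A * (sqrt s * (sqrt s0 * (2 * (1 + x\<^sup>2))))" by (simp add: mult.assoc)
      qed
      also have "\<dots> = A * (sqrt s * (D * (1 + x\<^sup>2)))" by (simp add: D_def algebra_simps)
      finally show ?thesis using A by (simp add: u_def abs_divide field_simps)
    qed
    have rem: "(1 + u x) ^ m \<le> 1 + m * u x + s * (C1 * (1 + x\<^sup>2) ^ (m + 2))" for x
    proof -
      have "(u x)\<^sup>2 \<le> (sqrt s * (D * (1 + x\<^sup>2)))\<^sup>2" using power_mono[OF ub[of x], of 2] by simp
      then have 1: "(u x)\<^sup>2 \<le> s * (D\<^sup>2 * (1 + x\<^sup>2)\<^sup>2)" using s by (simp add: power_mult_distrib)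
      have "\<bar>u x\<bar> \<le> sqrt s0 * (D * (1 + x\<^sup>2))"
      proof -
        have "sqrt s * (D * (1 + x\<^sup>2)) \<le> sqrt s0 * (D * (1 + x\<^sup>2))" using s D by (intro mult_right_mono) auto
        then show ?thesis using ub[of x] by linarith
      qed
      then have "1 + \<bar>u x\<bar> \<le> (1 + x\<^sup>2) + sqrt s0 * (D * (1 + x\<^sup>2))" using zero_le_power2[of x] by linarith
      then have "1 + \<bar>u x\<bar> \<le> D' * (1 + x\<^sup>2)" by (simp add: D'_def algebra_simps)
      then have 2: "(1 + \<bar>u x\<bar>) ^ m \<le> D' ^ m * (1 + x\<^sup>2) ^ m" by (metis abs_ge_zero add_nonneg_nonneg power_mono power_mult_distrib zero_le_one)
      have "(real m)\<^sup>2 * ((u x)\<^sup>2 * (1 + \<bar>u x\<bar>) ^ m) \<le> (real m)\<^sup>2 * ((s * (D\<^sup>2 * (1 + x\<^sup>2)\<^sup>2)) * (D' ^ m * (1 + x\<^sup>2) ^ m))"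
        using s D by (intro mult_left_mono mult_mono 1 2) auto
      also have "\<dots> = s * (C1 * (1 + x\<^sup>2) ^ (m + 2))" by (simp add: C1_def power_add power2_eq_square mult_ac)
      finally show ?thesis using power_taylor_bound[OF u1, of x m] by linarith
    qed
    have X: "(1 + (stp c z (sqrt b * x) b)\<^sup>2) ^ m \<le> A ^ m * (1 + m * u x + s * (C1 * (1 + x\<^sup>2) ^ (m + 2)))" for x
    proof -
      have "1 + (stp c z (sqrt b * x) b)\<^sup>2 \<le> 1 + ((z + c * (sqrt b * x))\<^sup>2 + 2 * c\<^sup>2 * b)"
        using stp_square[OF c b] by simp
      also have "\<dots> = A * (1 + u x)"
      proof -
        have "c * (sqrt b * x) = sqrt s * x" unfolding ss[symmetric] by simp
        then show ?thesis unfolding Au by (simp only:) (simp add: s_def)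
      qed
      finally have "(1 + (stp c z (sqrt b * x) b)\<^sup>2) ^ m \<le> A ^ m * (1 + u x) ^ m"
        unfolding power_mult_distrib[symmetric] by (intro power_mono) auto
      also have "\<dots> \<le> A ^ m * (1 + m * u x + s * (C1 * (1 + x\<^sup>2) ^ (m + 2)))"
        using A rem[of x] by (intro mult_left_mono) auto
      finally show ?thesis .
    qed
    have iu: "integrable N01 u" "(\<integral>x. u x \<partial>N01) \<le> 3 * s"
    proof -
      have i: "integrable N01 (\<lambda>x. x)" "integrable N01 (\<lambda>x. x\<^sup>2)"
        using integrable_std_normal_distribution_moment[of 1] integrable_std_normal_distribution_moment[of 2] by auto
      show "integrable N01 u" unfolding u_def using i by auto
      \<comment> \<open>The odd term of size sqrt s has mean 0; s x^2 + 2 s leaves 3 s.\<close>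
      have "(\<integral>x. u x \<partial>N01) = 3 * s / A" unfolding u_def using i N01_mean N.prob_space by simp
      also have "\<dots> \<le> 3 * s" using A s by (simp add: field_simps)
      finally show "(\<integral>x. u x \<partial>N01) \<le> 3 * s" .
    qed
    have "(\<integral>\<^sup>+x. ennreal ((1 + (stp c z (sqrt b * x) b)\<^sup>2) ^ m) \<partial>N01)
        \<le> (\<integral>\<^sup>+x. ennreal (A ^ m * (1 + m * u x + s * (C1 * (1 + x\<^sup>2) ^ (m + 2)))) \<partial>N01)"
      by (intro nn_integral_mono ennreal_leI X)
    also have "\<dots> = ennreal (\<integral>x. A ^ m * (1 + m * u x + s * (C1 * (1 + x\<^sup>2) ^ (m + 2))) \<partial>N01)"
    proof (rule nn_integral_eq_integral)
      show "AE x in N01. 0 \<le> A ^ m * (1 + m * u x + s * (C1 * (1 + x\<^sup>2) ^ (m + 2)))"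
        by (intro AE_I2 order_trans[OF _ X]) simp
    qed (use iu N01_integrable_one_plus_square[of "m + 2"] in auto)
    also have "(\<integral>x. A ^ m * (1 + m * u x + s * (C1 * (1 + x\<^sup>2) ^ (m + 2))) \<partial>N01)
        = A ^ m * (1 + m * (\<integral>x. u x \<partial>N01) + s * (C1 * M))"
      using iu N01_integrable_one_plus_square[of "m + 2"] N.prob_space by (simp add: M_def)
    also have "\<dots> \<le> A ^ m * (1 + m * (3 * s) + s * (C1 * M))"
      using A iu by (intro mult_left_mono add_right_mono add_left_mono) auto
    also have "\<dots> = (1 + (3 * real m + C1 * M) * (c\<^sup>2 * b)) * (1 + z\<^sup>2) ^ m"
      by (simp add: s_def A_def algebra_simps)
    finally show "(\<integral>\<^sup>+x. ennreal ((1 + (stp c z (sqrt b * x) b)\<^sup>2) ^ m) \<partial>N01) \<le> ennreal ((1 + (3 * real m + C1 * M) * (c\<^sup>2 * b)) * (1 + z\<^sup>2) ^ m)"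
      by (auto intro: ennreal_leI)
  qed
qed

section \<open>Expected time integrals over one step\<close>

lemma measurable_psi:
  assumes [measurable]: "c \<in> borel_measurable M" "t \<in> borel_measurable M" "Y \<in> borel_measurable M"
    and YS: "\<And>\<omega>. \<omega> \<in> space M \<Longrightarrow> Y \<omega> \<in> S" and e: "continuous_on S e"
  shows "(\<lambda>\<omega>. psi (c \<omega>) e (t \<omega>) (Y \<omega>)) \<in> borel_measurable M"
proof -
  have [measurable]: "(\<lambda>\<omega>. e (Y \<omega>)) \<in> borel_measurable M" "(\<lambda>\<omega>. g1 (Y \<omega>)) \<in> borel_measurable M"
    by (rule measurable_on_S[OF e assms(3) YS], simp) (rule measurable_on_S[OF continuous_g1 assms(3) YS])
  show ?thesis unfolding psi_def Hs_def by measurable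
qed

lemma measurable_step_mean:
  assumes c: "0 < c" and e: "continuous_on S e"
  shows "(\<lambda>t. step_mean c z e t * indicator {0<..b} t) \<in> borel_measurable lborel"
proof -
  interpret N: prob_space N01 by (rule prob_N01)
  \<comment> \<open>Nonpositive times are replaced by 1, so that the step is defined and measurable
    for every t; the indicator removes them again.\<close>
  define t' where "t' t = (if 0 < t then t else 1)" for t :: real
  have [measurable]: "t' \<in> borel_measurable borel" unfolding t'_def by measurable
  have t'0: "0 < t' t" for t by (simp add: t'_def)
  have 1: "(\<lambda>x. stp c z (sqrt (t' (fst x)) * snd x) (t' (fst x))) \<in> borel_measurable (lborel \<Otimes>\<^sub>M N01)"
    using c t'0 by measurable
  have "(\<lambda>x. psi c e (t' (fst x)) (stp c z (sqrt (t' (fst x)) * snd x) (t' (fst x)))) \<in> borel_measurable (lborel \<Otimes>\<^sub>M N01)"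
    by (rule measurable_psi[OF _ _ 1]) (use stp_in_S[OF c t'0] e in auto)
  then have "(\<lambda>(t, \<xi>). ennreal (psi c e (t' t) (stp c z (sqrt (t' t) * \<xi>) (t' t)))) \<in> borel_measurable (lborel \<Otimes>\<^sub>M N01)"
    by (simp add: split_beta')
  from N.borel_measurable_nn_integral[OF this]
  have "(\<lambda>t. step_mean c z e (t' t) * indicator {0<..b} t) \<in> borel_measurable lborel" unfolding step_mean_def by measurable
  also have "(\<lambda>t. step_mean c z e (t' t) * indicator {0<..b} t) = (\<lambda>t. step_mean c z e t * indicator {0<..b} t)"
    by (auto simp: t'_def indicator_def)
  finally show ?thesis .
qed

lemma step_mean_measurable:
  assumes "0 < c" "0 < t" "continuous_on S e"
  shows "(\<lambda>\<xi>. psi c e t (stp c z (sqrt t * \<xi>) t)) \<in> borel_measurable N01"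
  by (rule measurable_psi) (use assms stp_in_S in auto)

text \<open>As H_x >= 1, the constant part k contributes at most
  \<open>k * c\<^sup>2\<close>.\<close>

lemma step_mean_affine:
  assumes c: "0 < c" and t: "0 < t" and a: "0 \<le> a" "0 \<le> k" and e: "continuous_on S e" "\<And>x. x \<in> S \<Longrightarrow> 0 \<le> e x"
  shows "step_mean c z (\<lambda>y. k + a * e y) t \<le> ennreal (k * c\<^sup>2) + ennreal a * step_mean c z e t"
proof -
  interpret N: prob_space N01 by (rule prob_N01)
  note [measurable] = step_mean_measurable[OF c t e(1)]
  have "step_mean c z (\<lambda>y. k + a * e y) t \<le> (\<integral>\<^sup>+\<xi>. ennreal (k * c\<^sup>2) + ennreal a * ennreal (psi c e t (stp c z (sqrt t * \<xi>) t)) \<partial>N01)"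
    unfolding step_mean_def
  proof (intro nn_integral_mono)
    fix \<xi>
    define x where "x = stp c z (sqrt t * \<xi>) t"
    have x: "x \<in> S" unfolding x_def by (rule stp_in_S[OF c t])
    have H: "1 \<le> Hs (c\<^sup>2 * t) x" using t by (intro Hs_ge_1 x) auto
    have "k * c\<^sup>2 / (Hs (c\<^sup>2 * t) x)\<^sup>2 \<le> k * c\<^sup>2 / 1"
      using a H by (intro divide_left_mono) auto
    then have "psi c (\<lambda>y. k + a * e y) t x \<le> k * c\<^sup>2 + a * psi c e t x"
      by (simp add: psi_def add_divide_distrib algebra_simps)
    then have "ennreal (psi c (\<lambda>y. k + a * e y) t x) \<le> ennreal (k * c\<^sup>2 + a * psi c e t x)" by (rule ennreal_leI)
    also have "\<dots> = ennreal (k * c\<^sup>2) + ennreal a * ennreal (psi c e t x)"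
      using a e(2)[OF x] by (simp add: psi_nonneg ennreal_mult)
    finally show "ennreal (psi c (\<lambda>y. k + a * e y) t (stp c z (sqrt t * \<xi>) t)) \<le> ennreal (k * c\<^sup>2) + ennreal a * ennreal (psi c e t (stp c z (sqrt t * \<xi>) t))"
      by (simp add: x_def)
  qed
  also have "\<dots> = ennreal (k * c\<^sup>2) + ennreal a * step_mean c z e t"
    by (subst nn_integral_add) (auto simp: nn_integral_cmult N.emeasure_space_1[simplified] step_mean_def)
  finally show ?thesis .
qed

text \<open>The expected contribution to the integral in (1) of one step of length b from z.\<close>

definition "occ p c z b = (\<integral>\<^sup>+t\<in>{0<..b}. step_mean c z (\<lambda>y. h y powr (- 2 - p)) t \<partial>lborel)"

lemma continuous_h_powr: "continuous_on S (\<lambda>y. h y powr a)"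
  by (intro continuous_intros continuous_h) (auto dest: h_pos)

lemma step_mean_affine_integral:
  assumes c: "0 < c" and b: "0 < b" and a: "0 \<le> a" "0 \<le> k"
  shows "(\<integral>\<^sup>+t\<in>{0<..b}. step_mean c z (\<lambda>y. k + a * h y powr (- 2 - p)) t \<partial>lborel)
    \<le> ennreal (k * c\<^sup>2 * b) + ennreal a * occ p c z b"
proof -
  note [measurable] = measurable_step_mean[OF c continuous_h_powr]
  have "(\<integral>\<^sup>+t\<in>{0<..b}. step_mean c z (\<lambda>y. k + a * h y powr (- 2 - p)) t \<partial>lborel)
    \<le> (\<integral>\<^sup>+t. ennreal (k * c\<^sup>2) * indicator {0<..b} t + ennreal a * (step_mean c z (\<lambda>y. h y powr (- 2 - p)) t * indicator {0<..b} t) \<partial>lborel)"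
    using step_mean_affine[OF c _ a continuous_h_powr] by (intro nn_integral_mono) (auto simp: indicator_def)
  also have "\<dots> = ennreal (k * c\<^sup>2) * ennreal b + ennreal a * occ p c z b"
    using b by (subst nn_integral_add) (auto simp: nn_integral_cmult nn_integral_cmult_indicator occ_def)
  finally show ?thesis using a b by (simp add: ennreal_mult)
qed

text \<open>\<open>one_step\<close> with e1 = a h^(-2-p) and constant e2: the time integral is paid
  for by the decrease of the mean of \<open>U p\<close>, up to an error proportional to the length
  of the step.\<close>

lemma U_step:
  assumes p: "0 < p" "p < 1" and s0: "0 \<le> s0"
  obtains a K where "0 < a" "0 \<le> K"
    "\<And>z c b. z \<in> S \<Longrightarrow> 0 < c \<Longrightarrow> 0 < b \<Longrightarrow> c\<^sup>2 * b \<le> s0 \<Longrightarrow>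
      (\<integral>\<^sup>+\<xi>. ennreal (U p (stp c z (sqrt b * \<xi>) b)) \<partial>N01) + ennreal a * occ p c z b
        \<le> ennreal (U p z) + ennreal (K * (c\<^sup>2 * b))"
proof -
  obtain a K where a: "0 < a" and K: "0 \<le> K"
    and d: "\<And>s y. y \<in> S \<Longrightarrow> 0 \<le> s \<Longrightarrow> s \<le> s0 \<Longrightarrow> drift p s y \<le> (K - a * h y powr (- 2 - p)) / Hs s y"
    using drift_le_neg[OF p s0] by blast
  show ?thesis
  proof (rule that[OF a K])
    fix z c b assume z: "z \<in> S" and c: "0 < c" and b: "0 < b" and s: "c\<^sup>2 * b \<le> s0"
    have "(\<integral>\<^sup>+\<xi>. ennreal (U p (stp c z (sqrt b * \<xi>) b)) \<partial>N01) + (\<integral>\<^sup>+t\<in>{0<..b}. step_mean c z (\<lambda>y. a * h y powr (- 2 - p)) t \<partial>lborel)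
      \<le> ennreal (U p z) + (\<integral>\<^sup>+t\<in>{0<..b}. step_mean c z (\<lambda>y. K) t \<partial>lborel)"
    proof (rule one_step[OF z c b p(1)])
      fix y t assume y: "y \<in> S" and t: "0 < t" "t \<le> b"
      have "c\<^sup>2 * t \<le> s0" using s mult_left_mono[OF t(2), of "c\<^sup>2"] by simp
      then show "drift p (c\<^sup>2 * t) y \<le> (K - a * h y powr (- 2 - p)) / Hs (c\<^sup>2 * t) y"
        using t by (intro d y) auto
    qed (use a K in \<open>auto intro!: continuous_intros continuous_h_powr\<close>)
    also have "(\<integral>\<^sup>+t\<in>{0<..b}. step_mean c z (\<lambda>y. K) t \<partial>lborel) \<le> ennreal (K * (c\<^sup>2 * b))"
      using step_mean_affine_integral[OF c b order_refl K, of z 0] by (simp add: mult.assoc)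
    also have "(\<integral>\<^sup>+t\<in>{0<..b}. step_mean c z (\<lambda>y. a * h y powr (- 2 - p)) t \<partial>lborel) = ennreal a * occ p c z b"
    proof -
      note [measurable] = measurable_step_mean[OF c continuous_h_powr]
      have "step_mean c z (\<lambda>y. a * h y powr (- 2 - p)) t = ennreal a * step_mean c z (\<lambda>y. h y powr (- 2 - p)) t" if "0 < t" for t
      proof -
        note [measurable] = step_mean_measurable[OF c that continuous_h_powr]
        have "step_mean c z (\<lambda>y. a * h y powr (- 2 - p)) t = (\<integral>\<^sup>+\<xi>. ennreal a * ennreal (psi c (\<lambda>y. h y powr (- 2 - p)) t (stp c z (sqrt t * \<xi>) t)) \<partial>N01)"
          unfolding step_mean_def using a by (intro nn_integral_cong) (auto simp: psi_def ennreal_mult[symmetric] mult_ac)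
        also have "\<dots> = ennreal a * step_mean c z (\<lambda>y. h y powr (- 2 - p)) t"
          unfolding step_mean_def by (rule nn_integral_cmult) measurable
        finally show ?thesis .
      qed
      then have "(\<integral>\<^sup>+t\<in>{0<..b}. step_mean c z (\<lambda>y. a * h y powr (- 2 - p)) t \<partial>lborel)
        = (\<integral>\<^sup>+t. ennreal a * (step_mean c z (\<lambda>y. h y powr (- 2 - p)) t * indicator {0<..b} t) \<partial>lborel)"
        by (intro nn_integral_cong) (auto simp: indicator_def)
      then show ?thesis by (simp add: nn_integral_cmult occ_def)
    qed
    finally show "(\<integral>\<^sup>+\<xi>. ennreal (U p (stp c z (sqrt b * \<xi>) b)) \<partial>N01) + ennreal a * occ p c z b
        \<le> ennreal (U p z) + ennreal (K * (c\<^sup>2 * b))"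
      by (simp add: add_left_mono)
  qed
qed

text \<open>Here e1 = 0 and the whole drift of 1/h is a cost; its order h^(-2-q) is covered by
  \<open>occ p\<close> once p >= q.\<close>

lemma inverse_h_step:
  assumes p: "q \<le> p" and s0: "0 \<le> s0"
  obtains K where "0 \<le> K"
    "\<And>z c b. z \<in> S \<Longrightarrow> 0 < c \<Longrightarrow> 0 < b \<Longrightarrow> c\<^sup>2 * b \<le> s0 \<Longrightarrow>
      (\<integral>\<^sup>+\<xi>. ennreal (1 / h (stp c z (sqrt b * \<xi>) b)) \<partial>N01)
        \<le> ennreal (1 / h z) + ennreal (K * (c\<^sup>2 * b)) + ennreal K * occ p c z b"
proof -
  obtain K where K: "0 \<le> K"
    and d: "\<And>s y. y \<in> S \<Longrightarrow> 0 \<le> s \<Longrightarrow> s \<le> s0 \<Longrightarrow> drift 1 s y \<le> K * (1 + h y powr (- 2 - q)) / Hs s y"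
    using drift_one_le[OF s0] by blast
  show ?thesis
  proof (rule that[of "2 * K"])
    show "0 \<le> 2 * K" using K by simp
    fix z c b assume z: "z \<in> S" and c: "0 < c" and b: "0 < b" and s: "c\<^sup>2 * b \<le> s0"
    have U: "U 1 y = 1 / h y" if "y \<in> S" for y using h_pos[OF that] by (simp add: U_def powr_minus_divide)
    have "(\<integral>\<^sup>+\<xi>. ennreal (U 1 (stp c z (sqrt b * \<xi>) b)) \<partial>N01) + (\<integral>\<^sup>+t\<in>{0<..b}. step_mean c z (\<lambda>y. 0) t \<partial>lborel)
      \<le> ennreal (U 1 z) + (\<integral>\<^sup>+t\<in>{0<..b}. step_mean c z (\<lambda>y. 2 * K + 2 * K * h y powr (- 2 - p)) t \<partial>lborel)"
    proof (rule one_step[OF z c b zero_less_one])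
      fix y t assume y: "y \<in> S" and t: "0 < t" "t \<le> b"
      have "c\<^sup>2 * t \<le> s0" using s mult_left_mono[OF t(2), of "c\<^sup>2"] by simp
      then have "drift 1 (c\<^sup>2 * t) y \<le> K * (1 + h y powr (- 2 - q)) / Hs (c\<^sup>2 * t) y"
        using t by (intro d y) auto
      also have "\<dots> \<le> (2 * K + 2 * K * h y powr (- 2 - p) - 0) / Hs (c\<^sup>2 * t) y"
      proof (rule divide_right_mono)
        have "h y powr (- (2 + q)) \<le> 1 + h y powr (- (2 + p))"
          using powr_le_one_plus[OF h_pos[OF y], of "2 + q" "2 + p"] p q_nonneg by simp
        then have "K * (1 + h y powr (- 2 - q)) \<le> K * (2 + 2 * h y powr (- 2 - p))"
          using K by (intro mult_left_mono) (auto intro: order_trans)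
        then show "K * (1 + h y powr (- 2 - q)) \<le> 2 * K + 2 * K * h y powr (- 2 - p) - 0" by (simp add: algebra_simps)
        show "0 \<le> Hs (c\<^sup>2 * t) y" using Hs_ge_1[OF y, of "c\<^sup>2 * t"] t by simp
      qed
      finally show "drift 1 (c\<^sup>2 * t) y \<le> (2 * K + 2 * K * h y powr (- 2 - p) - 0) / Hs (c\<^sup>2 * t) y" .
    qed (use K in \<open>auto intro!: continuous_intros continuous_h_powr\<close>)
    also have "(\<integral>\<^sup>+t\<in>{0<..b}. step_mean c z (\<lambda>y. 2 * K + 2 * K * h y powr (- 2 - p)) t \<partial>lborel)
        \<le> ennreal (2 * K * c\<^sup>2 * b) + ennreal (2 * K) * occ p c z b"
      using K by (intro step_mean_affine_integral[OF c b]) auto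
    finally show "(\<integral>\<^sup>+\<xi>. ennreal (1 / h (stp c z (sqrt b * \<xi>) b)) \<partial>N01)
        \<le> ennreal (1 / h z) + ennreal (2 * K * (c\<^sup>2 * b)) + ennreal (2 * K) * occ p c z b"
      using U[OF stp_in_S[OF c b]] U[OF z] by (simp add: add_left_mono step_mean_def psi_def mult.assoc add.assoc)
  qed
qed

end

subsection \<open>The scheme along the grid\<close>

text \<open>Rounding the time down to a multiple of 1/(k+1) leaves countably many times, hence a
  jointly measurable map, and path continuity gives convergence as k grows.\<close>

lemma measurable_continuous_paths:
  fixes W :: "real \<Rightarrow> 'a \<Rightarrow> real"
  assumes W [measurable]: "\<And>t. 0 \<le> t \<Longrightarrow> W t \<in> borel_measurable M"
    and cont: "\<And>\<omega>. \<omega> \<in> space M \<Longrightarrow> continuous_on {0..} (\<lambda>t. W t \<omega>)"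
  shows "(\<lambda>(s, \<omega>). W (max 0 s) \<omega>) \<in> borel_measurable (borel \<Otimes>\<^sub>M M)"
proof (rule borel_measurable_LIMSEQ_metric)
  define a where "a k s = real (nat \<lfloor>real (Suc k) * max 0 s\<rfloor>) / real (Suc k)" for k s
  show "(\<lambda>x. W (a k (fst x)) (snd x)) \<in> borel_measurable (borel \<Otimes>\<^sub>M M)" for k
  proof -
    have "(\<lambda>x. (\<lambda>i x. W (real i / real (Suc k)) (snd x)) (nat \<lfloor>real (Suc k) * max 0 (fst x)\<rfloor>) x) \<in> borel_measurable (borel \<Otimes>\<^sub>M M)"
      by (rule measurable_compose_countable) measurable
    then show ?thesis by (simp add: a_def)
  qed
  fix x :: "real \<times> 'a" assume "x \<in> space (borel \<Otimes>\<^sub>M M)"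
  then have "snd x \<in> space M" by (auto simp: space_pair_measure)
  note c = cont[OF this]
  have a0: "0 \<le> a k s" for k s by (simp add: a_def)
  have "(\<lambda>k. a k (fst x)) \<longlonglongrightarrow> max 0 (fst x)"
  proof (rule real_tendsto_sandwich)
    define s where "s = max 0 (fst x)"
    have s: "0 \<le> s" by (simp add: s_def)
    have fl: "real (Suc k) * s - 1 \<le> real (nat \<lfloor>real (Suc k) * s\<rfloor>)" "real (nat \<lfloor>real (Suc k) * s\<rfloor>) \<le> real (Suc k) * s" for k
      using s by (auto simp: of_nat_nat)
    show "\<forall>\<^sub>F k in sequentially. s - 1 / real (Suc k) \<le> a k (fst x)"
    proof (intro always_eventually allI)
      fix k
      have "s - 1 / real (Suc k) = (real (Suc k) * s - 1) / real (Suc k)" by (simp add: field_simps)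
      also have "\<dots> \<le> a k (fst x)" unfolding a_def s_def[symmetric] by (intro divide_right_mono fl) simp
      finally show "s - 1 / real (Suc k) \<le> a k (fst x)" .
    qed
    show "\<forall>\<^sub>F k in sequentially. a k (fst x) \<le> s"
      using fl(2) by (intro always_eventually allI) (simp add: a_def s_def[symmetric] field_simps)
    have "(\<lambda>k. s - 1 / real (Suc k)) \<longlonglongrightarrow> s - 0" by (intro tendsto_diff tendsto_const LIMSEQ_Suc[OF lim_1_over_n])
    then show "(\<lambda>k. s - 1 / real (Suc k)) \<longlonglongrightarrow> max 0 (fst x)" by (simp add: s_def)
    show "(\<lambda>k. s) \<longlonglongrightarrow> max 0 (fst x)" by (simp add: s_def)
  qed
  from continuous_on_tendsto_compose[OF c this] show "(\<lambda>k. W (a k (fst x)) (snd x)) \<longlonglongrightarrow> (case x of (s, \<omega>) \<Rightarrow> W (max 0 s) \<omega>)"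
    by (simp add: a0 split_beta)
qed

text \<open>The increment divided by sqrt(t - s) is standard normal and independent of Z, so the
  joint law is a product and Fubini's theorem applies. This is the passage from the process to the
  kernel of a single step.\<close>

lemma brownian_increment_integral:
  fixes Z :: "'a \<Rightarrow> real"
  assumes F: "filtered_prob_space M F" and W: "brownian_motion M F W" and s: "0 \<le> s" "s < t"
    and Z: "Z \<in> borel_measurable (F s)" and f: "f \<in> borel_measurable (borel \<Otimes>\<^sub>M borel)"
  shows "(\<integral>\<^sup>+\<omega>. f (Z \<omega>, W t \<omega> - W s \<omega>) \<partial>M) = (\<integral>\<^sup>+\<omega>. (\<integral>\<^sup>+\<xi>. f (Z \<omega>, sqrt (t - s) * \<xi>) \<partial>N01) \<partial>M)"
proof -
  interpret prob_space M using F by (simp add: filtered_prob_space_def)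
  interpret N: prob_space N01 by (rule prob_N01)
  have sub: "subalgebra M (F s)" using F by (simp add: filtered_prob_space_def)
  define D where "D \<omega> = W t \<omega> - W s \<omega>" for \<omega>
  define D' where "D' \<omega> = (D \<omega> - 0) / sqrt (t - s)" for \<omega>
  have ts: "0 < sqrt (t - s)" using s by simp
  have dist: "distributed M lborel D (normal_density 0 (sqrt (t - s)))"
    and ind: "indep_set (sets (F s)) {D -` A \<inter> space M | A. A \<in> sets borel}"
    using W s unfolding brownian_motion_def D_def[abs_def] by blast+
  have dist': "distributed M lborel D' std_normal_density"
    using dist normal_standard_normal_convert[OF ts, of D 0] by (simp add: D'_def[abs_def])
  have D[measurable]: "D \<in> borel_measurable M" using distributed_measurable[OF dist] by simp
  have Z'[measurable]: "Z \<in> borel_measurable M" by (rule measurable_from_subalg[OF sub Z])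
  have "indep_var borel Z borel D"
    unfolding indep_var_eq
  proof (intro conjI)
    have sp: "space (F s) = space M" using sub by (simp add: subalgebra_def)
    have A: "{Z -` A \<inter> space M | A. A \<in> sets borel} \<subseteq> sets (F s)"
      using measurable_sets[OF Z] sp by auto
    have "sigma_sets (space M) {Z -` A \<inter> space M | A. A \<in> sets borel} \<subseteq> sets (F s)"
      using sets.sigma_sets_subset[OF A] sp by simp
    note Zsub = this
    \<comment> \<open>The preimages of Borel sets already form a sigma-algebra, so the independence
      in \<open>brownian_motion\<close> carries over as it stands.\<close>
    have Deq: "sigma_sets (space M) {D -` A \<inter> space M | A. A \<in> sets borel} = {D -` A \<inter> space M | A. A \<in> sets borel}"
    proof -
      have "sigma_sets UNIV (sets (borel :: real measure)) = sets borel"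
        by (rule sets.sigma_sets_eq[of "borel :: real measure", unfolded space_borel])
      note eq = this
      have "D \<in> space M \<rightarrow> UNIV" by simp
      from sigma_sets_vimage_commute[OF this, of "sets borel", unfolded eq] show ?thesis by (rule sym)
    qed
    show "indep_set (sigma_sets (space M) {Z -` A \<inter> space M | A. A \<in> sets borel}) (sigma_sets (space M) {D -` A \<inter> space M | A. A \<in> sets borel})"
      using ind unfolding indep_set_def Deq
      by (rule indep_sets_mono_sets) (use Zsub in \<open>auto split: bool.split\<close>)
  qed auto
  then have "indep_var borel ((\<lambda>x. x) \<circ> Z) borel ((\<lambda>d. (d - 0) / sqrt (t - s)) \<circ> D)"
    by (rule indep_var_compose) measurable
  then have "indep_var borel Z borel D'" by (simp add: D'_def[abs_def] comp_def)
  then have eq: "distr M borel Z \<Otimes>\<^sub>M distr M borel D' = distr M (borel \<Otimes>\<^sub>M borel) (\<lambda>\<omega>. (Z \<omega>, D' \<omega>))"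
    by (simp add: indep_var_distribution_eq)
  have D': "distr M borel D' = N01"
    using distributed_distr_eq_density[OF dist'] by (metis distr_cong sets_lborel)
  have [measurable]: "D' \<in> borel_measurable M" unfolding D'_def by measurable
  define f' where "f' x = f (fst x, sqrt (t - s) * snd x)" for x
  have f'[measurable]: "f' \<in> borel_measurable (borel \<Otimes>\<^sub>M borel)"
    unfolding f'_def using f by measurable
  have "(\<integral>\<^sup>+\<omega>. f (Z \<omega>, W t \<omega> - W s \<omega>) \<partial>M) = (\<integral>\<^sup>+\<omega>. f' (Z \<omega>, D' \<omega>) \<partial>M)"
    using ts by (simp add: f'_def D'_def D_def)
  also have "\<dots> = (\<integral>\<^sup>+x. f' x \<partial>distr M (borel \<Otimes>\<^sub>M borel) (\<lambda>\<omega>. (Z \<omega>, D' \<omega>)))"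
    by (subst nn_integral_distr) auto
  also have "\<dots> = (\<integral>\<^sup>+x. f' x \<partial>(distr M borel Z \<Otimes>\<^sub>M N01))" by (simp only: eq[symmetric] D')
  also have "\<dots> = (\<integral>\<^sup>+z. (\<integral>\<^sup>+\<xi>. f' (z, \<xi>) \<partial>N01) \<partial>distr M borel Z)"
    by (rule N.nn_integral_fst[symmetric]) measurable
  also have "\<dots> = (\<integral>\<^sup>+\<omega>. (\<integral>\<^sup>+\<xi>. f' (Z \<omega>, \<xi>) \<partial>N01) \<partial>M)"
    by (rule nn_integral_distr) measurable
  finally show ?thesis by (simp add: f'_def)
qed

section \<open>Grid values and interpolation of the scheme\<close>

locale bem_scheme = bem_profile +
  fixes \<sigma> :: "real \<Rightarrow> real" and x0 T Sg :: real
    and M :: "'a measure" and F :: "real \<Rightarrow> 'a measure" and W :: "real \<Rightarrow> 'a \<Rightarrow> real"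
  assumes h1_eq: "h1 = deriv h"
    and \<sigma>_pos: "x \<in> S \<Longrightarrow> 0 < \<sigma> x" and \<sigma>_le: "x \<in> S \<Longrightarrow> \<sigma> x \<le> Sg"
    and \<sigma>_cont: "continuous_on S \<sigma>"
    and x0_in_S: "x0 \<in> S" and T_pos: "0 < T"
    and filt: "filtered_prob_space M F" and bm: "brownian_motion M F W"
begin

sublocale prob_space M using filt by (simp add: filtered_prob_space_def)

text \<open>Off the state space \<open>\<sigma>\<close> is arbitrary, possibly not measurable; \<open>\<sigma>'\<close> is Borel and positive
  everywhere.\<close>

definition "\<sigma>' z = (if z \<in> S then \<sigma> z else 1)"
definition "dt N = T / real N"
abbreviation "tn N n \<equiv> grid T N n"
abbreviation "Y \<equiv> bem_grid r \<sigma> h x0 W T"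
abbreviation "Xh \<equiv> bem r \<sigma> h x0 W T"

lemma \<sigma>'_pos: "0 < \<sigma>' z" by (simp add: \<sigma>'_def \<sigma>_pos)

lemma S_borel [measurable]: "S \<in> sets borel" using open_state_space by simp

lemma \<sigma>'_measurable [measurable]: "\<sigma>' \<in> borel_measurable borel"
proof -
  have "(\<lambda>z. indicator S z *\<^sub>R \<sigma> z + (1 - indicator S z)) \<in> borel_measurable borel"
    using borel_measurable_continuous_on_indicator[OF _ \<sigma>_cont] by measurable
  also have "(\<lambda>z. indicator S z *\<^sub>R \<sigma> z + (1 - indicator S z)) = \<sigma>'"
    by (auto simp: \<sigma>'_def fun_eq_iff)
  finally show ?thesis .
qed

lemma bem_step_eq: "z \<in> S \<Longrightarrow> bem_step r \<sigma> h z w d = stp (\<sigma>' z) z w d"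
  by (simp add: bem_step_def stp_def \<sigma>'_def flip: h1_eq)

lemma dt_pos: "0 < N \<Longrightarrow> 0 < dt N" using T_pos by (simp add: dt_def)

lemma tn_Suc: "tn N (Suc n) = tn N n + dt N"
  by (simp add: grid_def dt_def add_divide_distrib distrib_right)

lemma tn_0: "tn N 0 = 0" by (simp add: grid_def)

lemma tn_nonneg: "0 \<le> tn N n" using T_pos by (simp add: grid_def)

lemma Y_in_S: "0 < N \<Longrightarrow> Y N n \<omega> \<in> S"
proof (induction n)
  case (Suc n)
  then show ?case
    using stp_in_S[OF \<sigma>'_pos dt_pos] by (simp add: bem_step_eq tn_Suc)
qed (simp add: x0_in_S)

lemma Y_Suc: "0 < N \<Longrightarrow> Y N (Suc n) \<omega> = stp (\<sigma>' (Y N n \<omega>)) (Y N n \<omega>) (W (tn N (Suc n)) \<omega> - W (tn N n) \<omega>) (dt N)"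
  by (simp add: bem_step_eq Y_in_S tn_Suc)

lemma Xh_eq:
  assumes N: "0 < N" and t: "tn N n < t" "t \<le> tn N (Suc n)"
  shows "Xh N t \<omega> = stp (\<sigma>' (Y N n \<omega>)) (Y N n \<omega>) (W t \<omega> - W (tn N n) \<omega>) (t - tn N n)"
proof -
  have t0: "0 < t" using t tn_nonneg[of N n] by linarith
  have "real n < t * real N / T" "t * real N / T \<le> real n + 1"
    using t N T_pos by (auto simp: grid_def field_simps)
  \<comment> \<open>The ceiling assigns a grid time to the step that ends there.\<close>
  then have "\<lceil>t * real N / T\<rceil> = int n + 1" by (intro ceiling_unique) auto
  then have "nat (\<lceil>t * real N / T\<rceil> - 1) = n" by simp
  then show ?thesis using t0 by (simp add: bem_def Let_def bem_step_eq Y_in_S N)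
qed

lemma Xh_grid: assumes N: "0 < N" shows "Xh N (tn N n) \<omega> = Y N n \<omega>"
proof (cases n)
  case 0 then show ?thesis by (simp add: bem_def tn_0)
next
  case (Suc k)
  show ?thesis unfolding Suc Y_Suc[OF N]
    by (subst Xh_eq[OF N, where n = k]) (use dt_pos[OF N] in \<open>auto simp: tn_Suc\<close>)
qed

lemma Xh_in_S: assumes N: "0 < N" and t: "tn N n \<le> t" "t \<le> tn N (Suc n)" shows "Xh N t \<omega> \<in> S"
proof (cases "t = tn N n")
  case True then show ?thesis using Xh_grid[OF N] Y_in_S[OF N] by simp
next
  case False
  then have t': "tn N n < t" using t by simp
  show ?thesis unfolding Xh_eq[OF N t' t(2)] using t' by (intro stp_in_S \<sigma>'_pos) simp
qed

lemma space_F: "space (F t) = space M"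
  using filt by (simp add: filtered_prob_space_def subalgebra_def)

lemma sub_F: "subalgebra M (F t)" using filt by (simp add: filtered_prob_space_def)

lemma F_mono: "s \<le> t \<Longrightarrow> f \<in> borel_measurable (F s) \<Longrightarrow> f \<in> borel_measurable (F t)"
proof -
  assume "s \<le> t" and f: "f \<in> borel_measurable (F s)"
  then have "sets (F s) \<subseteq> sets (F t)" using filt filtration.sets_F_mono[of "space M" F s t] by (simp add: filtered_prob_space_def)
  then have "subalgebra (F t) (F s)" by (simp add: subalgebra_def space_F)
  from measurable_from_subalg[OF this f] show ?thesis .
qed

lemma W_adapted: "0 \<le> t \<Longrightarrow> W t \<in> borel_measurable (F t)"
  using bm by (simp add: brownian_motion_def adapted_def)

lemma W_measurable [measurable]: "0 \<le> t \<Longrightarrow> W t \<in> borel_measurable M"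
  by (rule measurable_from_subalg[OF sub_F W_adapted])

lemma Y_adapted: assumes N: "0 < N" shows "Y N n \<in> borel_measurable (F (tn N n))"
proof (induction n)
  case 0 show ?case by simp
next
  case (Suc n)
  have le: "tn N n \<le> tn N (Suc n)" using dt_pos[OF N] by (simp add: tn_Suc)
  have [measurable]: "Y N n \<in> borel_measurable (F (tn N (Suc n)))" "W (tn N n) \<in> borel_measurable (F (tn N (Suc n)))"
     "W (tn N (Suc n)) \<in> borel_measurable (F (tn N (Suc n)))"
    by (rule F_mono[OF le Suc], rule F_mono[OF le W_adapted[OF tn_nonneg]], rule W_adapted[OF tn_nonneg])
  have "(\<lambda>\<omega>. stp (\<sigma>' (Y N n \<omega>)) (Y N n \<omega>) (W (tn N (Suc n)) \<omega> - W (tn N n) \<omega>) (dt N)) \<in> borel_measurable (F (tn N (Suc n)))"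
    by (rule measurable_stp) (auto simp: \<sigma>'_pos dt_pos[OF N])
  then show ?case by (simp add: Y_Suc[OF N, abs_def] del: bem_grid.simps cong: measurable_cong)
qed

lemma Y_measurable: "0 < N \<Longrightarrow> Y N n \<in> borel_measurable M"
  by (rule measurable_from_subalg[OF sub_F Y_adapted])

lemma Xh_measurable:
  assumes N: "0 < N" and t: "tn N n \<le> t" "t \<le> tn N (Suc n)"
  shows "Xh N t \<in> borel_measurable M"
proof (cases "t = tn N n")
  case True then show ?thesis using Xh_grid[OF N] Y_measurable[OF N] by (simp cong: measurable_cong)
next
  case False
  then have t': "tn N n < t" "0 \<le> t" using t tn_nonneg[of N n] by auto
  note [measurable] = Y_measurable[OF N] W_measurable[OF tn_nonneg] W_measurable[OF t'(2)]
  have "(\<lambda>\<omega>. stp (\<sigma>' (Y N n \<omega>)) (Y N n \<omega>) (W t \<omega> - W (tn N n) \<omega>) (t - tn N n)) \<in> borel_measurable M"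
    using t' by (intro measurable_stp) (auto simp: \<sigma>'_pos)
  then show ?thesis by (simp add: Xh_eq[OF N t'(1) t(2)] cong: measurable_cong)
qed

text \<open>The Markov property at t_n. Measurability in the second argument is asked on S alone,
  because h and its derivatives are arbitrary outside S.\<close>

lemma Xh_step_integral:
  assumes N: "0 < N" and t: "tn N n < t" "t \<le> tn N (Suc n)"
    and f: "(\<lambda>(z, x). f z x) \<in> borel_measurable (borel \<Otimes>\<^sub>M restrict_space borel S)"
  shows "(\<integral>\<^sup>+\<omega>. f (Y N n \<omega>) (Xh N t \<omega>) \<partial>M) =
    (\<integral>\<^sup>+\<omega>. (\<integral>\<^sup>+\<xi>. f (Y N n \<omega>) (stp (\<sigma>' (Y N n \<omega>)) (Y N n \<omega>) (sqrt (t - tn N n) * \<xi>) (t - tn N n)) \<partial>N01) \<partial>M)"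
proof -
  define d where "d = t - tn N n"
  have d: "0 < d" using t by (simp add: d_def)
  define G where "G x = f (fst x) (stp (\<sigma>' (fst x)) (fst x) (snd x) d)" for x
  have "(\<lambda>x. stp (\<sigma>' (fst x)) (fst x) (snd x) d) \<in> borel_measurable (borel \<Otimes>\<^sub>M borel)"
    using d by (intro measurable_stp) (auto simp: \<sigma>'_pos)
  then have "(\<lambda>x. (fst x, stp (\<sigma>' (fst x)) (fst x) (snd x) d)) \<in> measurable (borel \<Otimes>\<^sub>M borel) (borel \<Otimes>\<^sub>M restrict_space borel S)"
    using stp_in_S[OF \<sigma>'_pos d] by (intro measurable_Pair measurable_restrict_space2) auto
  from measurable_compose[OF this f] have G: "G \<in> borel_measurable (borel \<Otimes>\<^sub>M borel)"
    by (simp add: G_def[abs_def])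
  from brownian_increment_integral[OF filt bm tn_nonneg t(1) Y_adapted[OF N] G]
  show ?thesis by (simp add: G_def Xh_eq[OF N t] d_def)
qed

lemma measurable_on_S_snd:
  assumes "continuous_on S e"
  shows "(\<lambda>(z::real, x). ennreal (e x)) \<in> borel_measurable (borel \<Otimes>\<^sub>M restrict_space borel S)"
  using measurable_compose[OF measurable_compose[OF measurable_snd borel_measurable_continuous_on_restrict[OF assms]] measurable_ennreal]
  by (simp add: split_beta')

end

text \<open>As 1 <= e, every inhomogeneity may carry the full factor \<open>e ^ n\<close>. Working
  in \<open>ennreal\<close> allows its use before any expectation is known to be finite.\<close>

lemma discrete_gronwall:
  fixes u w :: "nat \<Rightarrow> ennreal"
  assumes rec: "\<And>i. i < n \<Longrightarrow> u (Suc i) \<le> e * u i + b + w i" and e: "1 \<le> e"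
  shows "u n \<le> e ^ n * (u 0 + of_nat n * b + (\<Sum>i<n. w i))"
  using rec
proof (induction n)
  case (Suc n)
  let ?v = "u 0 + of_nat n * b + (\<Sum>i<n. w i)"
  have "u (Suc n) \<le> e * u n + (b + w n)" using Suc.prems[of n] by (simp add: add.assoc)
  also have "\<dots> \<le> e * (e ^ n * ?v) + e ^ Suc n * (b + w n)"
    using Suc one_le_power[OF e, of "Suc n"] mult_right_mono[of 1 "e ^ Suc n" "b + w n"]
    by (intro add_mono mult_left_mono) auto
  also have "\<dots> = e ^ Suc n * (?v + (b + w n))" by (simp add: distrib_left mult.assoc)
  also have "?v + (b + w n) = u 0 + of_nat (Suc n) * b + (\<Sum>i<Suc n. w i)"
    by (simp add: distrib_right add_ac)
  finally show ?case .
qed simp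

section \<open>Summation of the one-step estimates\<close>

context bem_scheme
begin

lemma one_step_expectation:
  assumes N: "0 < N" and t: "tn N n < t" "t \<le> tn N (Suc n)" and e: "continuous_on S e"
  shows "(\<integral>\<^sup>+\<omega>. ennreal (e (Xh N t \<omega>)) \<partial>M) =
    (\<integral>\<^sup>+\<omega>. (\<integral>\<^sup>+\<xi>. ennreal (e (stp (\<sigma>' (Y N n \<omega>)) (Y N n \<omega>) (sqrt (t - tn N n) * \<xi>) (t - tn N n))) \<partial>N01) \<partial>M)"
  by (rule Xh_step_integral[OF N t measurable_on_S_snd[OF e]])

text \<open>Bounds \<open>(\<sigma>' z)\<^sup>2 * d\<close> for every d <= T/N and every N, so that
  the constants of the one-step lemmas depend neither on N nor on z.\<close>

definition "s0 = Sg\<^sup>2 * T"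

lemma s0_nonneg: "0 \<le> s0" using T_pos by (simp add: s0_def)

lemma \<sigma>'_sq_le: assumes "z \<in> S" shows "(\<sigma>' z)\<^sup>2 \<le> Sg\<^sup>2"
  using \<sigma>_pos[OF assms] \<sigma>_le[OF assms] assms by (auto simp: \<sigma>'_def intro!: power_mono)

lemma dt_sum: "0 < N \<Longrightarrow> real N * dt N = T" by (simp add: dt_def)

lemma tn_le_T: assumes "0 < N" "n \<le> N" shows "tn N n \<le> T"
proof -
  have "real n * T \<le> real N * T" using assms T_pos by (intro mult_right_mono) auto
  then show ?thesis using assms by (simp add: grid_def field_simps)
qed

lemma step_small:
  assumes z: "z \<in> S" and N: "0 < N" and d: "0 \<le> d" "d \<le> dt N"
  shows "(\<sigma>' z)\<^sup>2 * d \<le> s0" "(\<sigma>' z)\<^sup>2 * d \<le> Sg\<^sup>2 * dt N"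
proof -
  show "(\<sigma>' z)\<^sup>2 * d \<le> Sg\<^sup>2 * dt N" using \<sigma>'_sq_le[OF z] d by (intro mult_mono) auto
  also have "dt N * 1 \<le> dt N * real N" using dt_pos[OF N] N by (intro mult_left_mono) auto
  then have "dt N \<le> T" using dt_sum[OF N] by (simp add: mult.commute)
  then have "Sg\<^sup>2 * dt N \<le> s0" unfolding s0_def by (intro mult_left_mono) auto
  finally show "(\<sigma>' z)\<^sup>2 * d \<le> s0" .
qed

lemma measurable_joint_step:
  assumes e: "continuous_on S e"
  defines "t' \<equiv> \<lambda>t::real. if 0 < t then t else 1"
  shows "(\<lambda>x. psi (\<sigma>' (fst (fst x))) e (t' (snd (fst x)))
      (stp (\<sigma>' (fst (fst x))) (fst (fst x)) (sqrt (t' (snd (fst x))) * snd x) (t' (snd (fst x)))))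
    \<in> borel_measurable ((borel \<Otimes>\<^sub>M lborel) \<Otimes>\<^sub>M N01)"
proof -
  have [measurable]: "t' \<in> borel_measurable borel" unfolding t'_def by measurable
  have t'0: "0 < t' t" for t by (simp add: t'_def)
  have 1: "(\<lambda>x. stp (\<sigma>' (fst (fst x))) (fst (fst x)) (sqrt (t' (snd (fst x))) * snd x) (t' (snd (fst x))))
     \<in> borel_measurable ((borel \<Otimes>\<^sub>M lborel) \<Otimes>\<^sub>M N01)"
    by (intro measurable_stp) (auto simp: \<sigma>'_pos t'0)
  show ?thesis by (rule measurable_psi[OF _ _ 1]) (use stp_in_S[OF \<sigma>'_pos t'0] e in auto)
qed

lemma measurable_step_mean_joint:
  assumes e: "continuous_on S e"
  shows "(\<lambda>(z, t). step_mean (\<sigma>' z) z e t * indicator {0<..b} t) \<in> borel_measurable (borel \<Otimes>\<^sub>M lborel)"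
proof -
  interpret N: prob_space N01 by (rule prob_N01)
  define t' where "t' t = (if 0 < t then t else 1)" for t :: real
  have "(\<lambda>x. step_mean (\<sigma>' (fst x)) (fst x) e (t' (snd x))) \<in> borel_measurable (borel \<Otimes>\<^sub>M lborel)"
    unfolding step_mean_def
    using measurable_joint_step[OF e] unfolding t'_def
    by (intro N.borel_measurable_nn_integral) (auto simp: split_beta')
  then have "(\<lambda>x. step_mean (\<sigma>' (fst x)) (fst x) e (t' (snd x)) * indicator {0<..b} (snd x)) \<in> borel_measurable (borel \<Otimes>\<^sub>M lborel)"
    by measurable
  also have "(\<lambda>x. step_mean (\<sigma>' (fst x)) (fst x) e (t' (snd x)) * indicator {0<..b} (snd x)) = (\<lambda>(z, t). step_mean (\<sigma>' z) z e t * indicator {0<..b} t)"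
    by (auto simp: t'_def indicator_def fun_eq_iff)
  finally show ?thesis .
qed

lemma measurable_occ [measurable]: "(\<lambda>z. occ p (\<sigma>' z) z b) \<in> borel_measurable borel"
  unfolding occ_def using lborel.borel_measurable_nn_integral[OF measurable_step_mean_joint[OF continuous_h_powr]] by simp

definition "Eocc p N n = (\<integral>\<^sup>+\<omega>. occ p (\<sigma>' (Y N n \<omega>)) (Y N n \<omega>) (dt N) \<partial>M)"

lemma occ_mono: "b \<le> b' \<Longrightarrow> occ p c z b \<le> occ p c z b'"
  unfolding occ_def by (intro nn_integral_mono) (auto simp: indicator_def)

text \<open>Covers both kinds of one-step estimate: the coefficient a keeps the time integral on the
  left, for \<open>U p\<close>; \<kappa> admits it as an error on the right, for 1/h. Replacing
  \<sigma>' by its bound \<open>Sg\<close> makes the growth factor deterministic, so it leaves the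
  expectation.\<close>

lemma expectation_step:
  assumes \<phi>: "continuous_on S \<phi>" "\<And>x. x \<in> S \<Longrightarrow> 0 \<le> \<phi> x" and A: "0 \<le> A" and B: "0 \<le> B"
    and kernel: "\<And>z c b. z \<in> S \<Longrightarrow> 0 < c \<Longrightarrow> 0 < b \<Longrightarrow> c\<^sup>2 * b \<le> s0 \<Longrightarrow>
      (\<integral>\<^sup>+\<xi>. ennreal (\<phi> (stp c z (sqrt b * \<xi>) b)) \<partial>N01) + ennreal a * occ p c z b
        \<le> ennreal ((1 + A * (c\<^sup>2 * b)) * \<phi> z + B * (c\<^sup>2 * b)) + ennreal \<kappa> * occ p c z b"
    and N: "0 < N" and t: "tn N n < t" "t \<le> tn N (Suc n)"
  shows "(\<integral>\<^sup>+\<omega>. ennreal (\<phi> (Xh N t \<omega>)) \<partial>M)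
      + ennreal a * (\<integral>\<^sup>+\<omega>. occ p (\<sigma>' (Y N n \<omega>)) (Y N n \<omega>) (t - tn N n) \<partial>M)
    \<le> ennreal (1 + A * (Sg\<^sup>2 * dt N)) * (\<integral>\<^sup>+\<omega>. ennreal (\<phi> (Y N n \<omega>)) \<partial>M)
      + ennreal (B * (Sg\<^sup>2 * dt N)) + ennreal \<kappa> * Eocc p N n"
proof -
  interpret N: prob_space N01 by (rule prob_N01)
  define z where "z \<omega> = Y N n \<omega>" for \<omega>
  define d where "d = t - tn N n"
  define E where "E = 1 + A * (Sg\<^sup>2 * dt N)"
  define b where "b = B * (Sg\<^sup>2 * dt N)"
  have d: "0 < d" "d \<le> dt N" using t by (auto simp: d_def tn_Suc)
  have E: "0 \<le> E" and b: "0 \<le> b" using A B dt_pos[OF N] by (auto simp: E_def b_def)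
  have zS: "z \<omega> \<in> S" for \<omega> using Y_in_S[OF N] by (simp add: z_def)
  have [measurable]: "z \<in> borel_measurable M" unfolding z_def[abs_def] by (rule Y_measurable[OF N])
  have "(\<lambda>x. \<phi> (stp (\<sigma>' (z (fst x))) (z (fst x)) (sqrt d * snd x) d)) \<in> borel_measurable (M \<Otimes>\<^sub>M N01)"
    using d(1) stp_in_S[OF \<sigma>'_pos d(1)] by (intro measurable_on_S[OF \<phi>(1)] measurable_stp) (auto simp: \<sigma>'_pos)
  then have [measurable]: "(\<lambda>\<omega>. (\<integral>\<^sup>+\<xi>. ennreal (\<phi> (stp (\<sigma>' (z \<omega>)) (z \<omega>) (sqrt d * \<xi>) d)) \<partial>N01)) \<in> borel_measurable M"
    by (intro N.borel_measurable_nn_integral) (auto simp: split_beta')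
  have [measurable]: "(\<lambda>\<omega>. \<phi> (z \<omega>)) \<in> borel_measurable M"
    by (rule measurable_on_S[OF \<phi>(1) _ zS]) simp
  have "(\<integral>\<^sup>+\<omega>. ennreal (\<phi> (Xh N t \<omega>)) \<partial>M) + ennreal a * (\<integral>\<^sup>+\<omega>. occ p (\<sigma>' (z \<omega>)) (z \<omega>) d \<partial>M)
    = (\<integral>\<^sup>+\<omega>. (\<integral>\<^sup>+\<xi>. ennreal (\<phi> (stp (\<sigma>' (z \<omega>)) (z \<omega>) (sqrt d * \<xi>) d)) \<partial>N01)
        + ennreal a * occ p (\<sigma>' (z \<omega>)) (z \<omega>) d \<partial>M)"
    using one_step_expectation[OF N t \<phi>(1)]
    by (simp add: nn_integral_add nn_integral_cmult z_def[symmetric] d_def[symmetric])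
  also have "\<dots> \<le> (\<integral>\<^sup>+\<omega>. (ennreal E * ennreal (\<phi> (z \<omega>)) + ennreal b)
      + ennreal \<kappa> * occ p (\<sigma>' (z \<omega>)) (z \<omega>) (dt N) \<partial>M)"
  proof (intro nn_integral_mono)
    fix \<omega>
    note small = step_small[OF zS N less_imp_le[OF d(1)] d(2), of \<omega>]
    have "(1 + A * ((\<sigma>' (z \<omega>))\<^sup>2 * d)) * \<phi> (z \<omega>) + B * ((\<sigma>' (z \<omega>))\<^sup>2 * d) \<le> E * \<phi> (z \<omega>) + b"
      unfolding E_def b_def using A B \<phi>(2)[OF zS]
      by (intro add_mono mult_right_mono mult_left_mono small order_refl)
    then have "ennreal ((1 + A * ((\<sigma>' (z \<omega>))\<^sup>2 * d)) * \<phi> (z \<omega>) + B * ((\<sigma>' (z \<omega>))\<^sup>2 * d))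
        \<le> ennreal (E * \<phi> (z \<omega>) + b)" by (rule ennreal_leI)
    also have "\<dots> = ennreal E * ennreal (\<phi> (z \<omega>)) + ennreal b"
      using E b \<phi>(2)[OF zS] by (simp add: ennreal_plus ennreal_mult)
    finally show "(\<integral>\<^sup>+\<xi>. ennreal (\<phi> (stp (\<sigma>' (z \<omega>)) (z \<omega>) (sqrt d * \<xi>) d)) \<partial>N01)
        + ennreal a * occ p (\<sigma>' (z \<omega>)) (z \<omega>) d
      \<le> (ennreal E * ennreal (\<phi> (z \<omega>)) + ennreal b) + ennreal \<kappa> * occ p (\<sigma>' (z \<omega>)) (z \<omega>) (dt N)"
      by (intro order_trans[OF kernel[OF zS \<sigma>'_pos d(1) small(1)] add_mono]
          mult_left_mono[OF occ_mono[OF d(2)]]) simp_all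
  qed
  also have "\<dots> = ennreal E * (\<integral>\<^sup>+\<omega>. ennreal (\<phi> (z \<omega>)) \<partial>M) + ennreal b + ennreal \<kappa> * Eocc p N n"
    by (simp add: nn_integral_add nn_integral_cmult emeasure_space_1 Eocc_def z_def[symmetric])
  finally show ?thesis by (simp only: z_def d_def E_def b_def)
qed

lemma of_nat_dt:
  assumes "0 < N" "0 \<le> k"
  shows "of_nat N * ennreal (k * (Sg\<^sup>2 * dt N)) = ennreal (k * (Sg\<^sup>2 * T))"
proof -
  have e: "real N * (k * (Sg\<^sup>2 * dt N)) = k * (Sg\<^sup>2 * T)"
    using dt_sum[OF assms(1)] by (metis mult.left_commute)
  show ?thesis unfolding e[symmetric] ennreal_of_nat_eq_real_of_nat
    by (rule ennreal_mult[symmetric]) (use assms dt_pos[OF assms(1)] in auto)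
qed

text \<open>With growth factor 1 the inequalities for \<open>U p\<close> telescope: the time
  integrals accumulate on the left, while N errors of size \<open>K * (Sg\<^sup>2 * dt N)\<close>
  add up to a bound free of N.\<close>

lemma Eocc_sum_bound:
  assumes p: "0 < p" "p < 1"
  obtains B where "\<And>N. 0 < N \<Longrightarrow> (\<Sum>n<N. Eocc p N n) \<le> ennreal B"
proof -
  obtain a K where a: "0 < a" and K: "0 \<le> K" and
    kernel: "\<And>z c b. z \<in> S \<Longrightarrow> 0 < c \<Longrightarrow> 0 < b \<Longrightarrow> c\<^sup>2 * b \<le> s0 \<Longrightarrow>
      (\<integral>\<^sup>+\<xi>. ennreal (U p (stp c z (sqrt b * \<xi>) b)) \<partial>N01) + ennreal a * occ p c z b
        \<le> ennreal (U p z) + ennreal (K * (c\<^sup>2 * b))"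
    using U_step[OF p s0_nonneg] by blast
  define u where "u N n = (\<integral>\<^sup>+\<omega>. ennreal (U p (Y N n \<omega>)) \<partial>M)" for N n
  define b where "b N = ennreal (K * (Sg\<^sup>2 * dt N))" for N
  have step: "u N (Suc n) + ennreal a * Eocc p N n \<le> u N n + b N" if N: "0 < N" for N n
  proof -
    have t: "tn N n < tn N (Suc n)" "tn N (Suc n) - tn N n = dt N" using dt_pos[OF N] by (auto simp: tn_Suc)
    have "(\<integral>\<^sup>+\<omega>. ennreal (U p (Xh N (tn N (Suc n)) \<omega>)) \<partial>M)
        + ennreal a * (\<integral>\<^sup>+\<omega>. occ p (\<sigma>' (Y N n \<omega>)) (Y N n \<omega>) (tn N (Suc n) - tn N n) \<partial>M)
      \<le> ennreal (1 + 0 * (Sg\<^sup>2 * dt N)) * u N n + b N + ennreal 0 * Eocc p N n"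
      unfolding u_def b_def
    proof (rule expectation_step[OF continuous_U _ order_refl K _ N t(1) order_refl])
      fix z c b :: real assume "z \<in> S" "0 < c" "0 < b" "c\<^sup>2 * b \<le> s0"
      then show "(\<integral>\<^sup>+\<xi>. ennreal (U p (stp c z (sqrt b * \<xi>) b)) \<partial>N01) + ennreal a * occ p c z b
        \<le> ennreal ((1 + 0 * (c\<^sup>2 * b)) * U p z + K * (c\<^sup>2 * b)) + ennreal 0 * occ p c z b"
        using kernel[of z c b] K by (simp add: ennreal_plus U_def)
    qed (simp add: U_def)
    then show ?thesis unfolding t(2) Eocc_def[symmetric] by (simp add: u_def Xh_grid[OF N] del: bem_grid.simps)
  qed
  have sum: "u N n + ennreal a * (\<Sum>i<n. Eocc p N i) \<le> ennreal (U p x0) + of_nat n * b N" if N: "0 < N" for N n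
  proof (induction n)
    case 0 show ?case by (simp add: u_def emeasure_space_1)
  next
    case (Suc n)
    have "u N (Suc n) + ennreal a * (\<Sum>i<Suc n. Eocc p N i)
      = (u N (Suc n) + ennreal a * Eocc p N n) + ennreal a * (\<Sum>i<n. Eocc p N i)"
      by (simp add: distrib_left add_ac)
    also have "\<dots> \<le> (u N n + b N) + ennreal a * (\<Sum>i<n. Eocc p N i)" by (intro add_right_mono step N)
    also have "\<dots> = (u N n + ennreal a * (\<Sum>i<n. Eocc p N i)) + b N" by (simp add: add_ac)
    also have "\<dots> \<le> (ennreal (U p x0) + of_nat n * b N) + b N" by (intro add_right_mono Suc)
    finally show ?case by (simp add: distrib_right add_ac)
  qed
  show ?thesis
  proof (rule that[of "(U p x0 + K * (Sg\<^sup>2 * T)) / a"])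
    fix N :: nat assume N: "0 < N"
    have "ennreal a * (\<Sum>i<N. Eocc p N i) \<le> ennreal (U p x0) + of_nat N * b N"
      by (rule order_trans[OF _ sum[OF N, of N]]) simp
    also have "\<dots> = ennreal (U p x0 + K * (Sg\<^sup>2 * T))"
      using K T_pos by (simp add: b_def of_nat_dt[OF N K] ennreal_plus U_def)
    finally have 1: "ennreal a * (\<Sum>i<N. Eocc p N i) \<le> ennreal (U p x0 + K * (Sg\<^sup>2 * T))" .
    have "(\<Sum>i<N. Eocc p N i) = ennreal (1 / a) * (ennreal a * (\<Sum>i<N. Eocc p N i))"
      using a by (simp add: mult.assoc[symmetric] ennreal_mult[symmetric])
    also have "\<dots> \<le> ennreal (1 / a) * ennreal (U p x0 + K * (Sg\<^sup>2 * T))" by (intro mult_left_mono 1) simp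
    also have "\<dots> = ennreal ((U p x0 + K * (Sg\<^sup>2 * T)) / a)"
      using a K T_pos by (subst ennreal_mult[symmetric]) (auto simp: U_def)
    finally show "(\<Sum>i<N. Eocc p N i) \<le> ennreal ((U p x0 + K * (Sg\<^sup>2 * T)) / a)" .
  qed
qed

lemma Xh_grid_cases:
  assumes N: "0 < N" and t: "0 \<le> t" "t \<le> T"
  obtains "t = 0" | n where "n < N" "tn N n < t" "t \<le> tn N (Suc n)"
proof (cases "t = 0")
  case False
  define n where "n = nat (\<lceil>t * real N / T\<rceil> - 1)"
  have t0: "0 < t * real N / T" using t False N T_pos by simp
  have c: "real_of_int \<lceil>t * real N / T\<rceil> - 1 < t * real N / T" "t * real N / T \<le> real_of_int \<lceil>t * real N / T\<rceil>" by linarith+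
  have n: "real n = real_of_int \<lceil>t * real N / T\<rceil> - 1" using t0 by (simp add: n_def)
  have "real n < t * real N / T" "t * real N / T \<le> real n + 1" using c n by linarith+
  then have "tn N n < t" "t \<le> tn N (Suc n)" using T_pos N unfolding grid_def by (auto simp: field_simps)
  moreover have "real n < real N"
  proof -
    have "t * real N / T \<le> real N" using t T_pos N by (simp add: field_simps)
    then show ?thesis using c(1) n by linarith
  qed
  ultimately show ?thesis using that by auto
qed

text \<open>The growth factors of at most N steps multiply to at most exp(A Sg^2 T), whatever N is;
  the time integrals enter through their sum, which \<open>Eocc_sum_bound\<close> controls.\<close>

lemma expectation_bound:
  assumes \<phi>: "continuous_on S \<phi>" "\<And>x. x \<in> S \<Longrightarrow> 0 \<le> \<phi> x" and A: "0 \<le> A" and B: "0 \<le> B"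
    and kernel: "\<And>z c b. z \<in> S \<Longrightarrow> 0 < c \<Longrightarrow> 0 < b \<Longrightarrow> c\<^sup>2 * b \<le> s0 \<Longrightarrow>
      (\<integral>\<^sup>+\<xi>. ennreal (\<phi> (stp c z (sqrt b * \<xi>) b)) \<partial>N01)
        \<le> ennreal ((1 + A * (c\<^sup>2 * b)) * \<phi> z + B * (c\<^sup>2 * b)) + ennreal \<kappa> * occ p c z b"
    and N: "0 < N" and t: "0 \<le> t" "t \<le> T"
  shows "(\<integral>\<^sup>+\<omega>. ennreal (\<phi> (Xh N t \<omega>)) \<partial>M)
    \<le> ennreal (exp (A * (Sg\<^sup>2 * T))) * (ennreal (\<phi> x0) + ennreal (B * (Sg\<^sup>2 * T)) + ennreal \<kappa> * (\<Sum>i<N. Eocc p N i))"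
proof -
  define e where "e = ennreal (1 + A * (Sg\<^sup>2 * dt N))"
  define b where "b = ennreal (B * (Sg\<^sup>2 * dt N))"
  define w where "w i = ennreal \<kappa> * Eocc p N i" for i
  have "0 \<le> A * (Sg\<^sup>2 * dt N)" using A dt_pos[OF N] by simp
  then have e1: "1 \<le> e" unfolding e_def ennreal_1[symmetric] by (intro ennreal_leI) simp
  have st: "(\<integral>\<^sup>+\<omega>. ennreal (\<phi> (Xh N s \<omega>)) \<partial>M) \<le> e * (\<integral>\<^sup>+\<omega>. ennreal (\<phi> (Y N n \<omega>)) \<partial>M) + b + w n"
    if "tn N n < s" "s \<le> tn N (Suc n)" for n s
    using expectation_step[OF \<phi> A B _ N that, of 0 p \<kappa>] kernel by (simp add: e_def b_def w_def)
  have eN: "e ^ N \<le> ennreal (exp (A * (Sg\<^sup>2 * T)))"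
  proof -
    have "e \<le> ennreal (exp (A * (Sg\<^sup>2 * dt N)))" unfolding e_def by (intro ennreal_leI exp_ge_add_one_self)
    then have "e ^ N \<le> ennreal (exp (A * (Sg\<^sup>2 * dt N))) ^ N" by (intro power_mono) auto
    also have "\<dots> = ennreal (exp (real N * (A * (Sg\<^sup>2 * dt N))))" by (simp only: ennreal_power exp_ge_zero exp_of_nat_mult)
    also have "real N * (A * (Sg\<^sup>2 * dt N)) = A * (Sg\<^sup>2 * T)" using dt_sum[OF N] by (metis mult.left_commute)
    finally show ?thesis .
  qed
  have final: "e ^ n * (ennreal (\<phi> x0) + of_nat n * b + (\<Sum>i<n. w i))
    \<le> ennreal (exp (A * (Sg\<^sup>2 * T))) * (ennreal (\<phi> x0) + ennreal (B * (Sg\<^sup>2 * T)) + ennreal \<kappa> * (\<Sum>i<N. Eocc p N i))"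
    if "n \<le> N" for n
    unfolding sum_distrib_left w_def[symmetric] of_nat_dt[OF N B, folded b_def, symmetric]
    using that e1 by (intro mult_mono add_mono sum_mono2 mult_right_mono order_trans[OF power_increasing eN]) auto
  from N t show ?thesis
  proof (cases rule: Xh_grid_cases)
    case 1
    then show ?thesis using final[of 0] by (simp add: bem_def emeasure_space_1)
  next
    case (2 n)
    \<comment> \<open>Grid values up to n, followed by the value at t as one more entry, so that a
      single recursion also covers the last, possibly incomplete step.\<close>
    define u where "u i = (if i \<le> n then \<integral>\<^sup>+\<omega>. ennreal (\<phi> (Y N i \<omega>)) \<partial>M else \<integral>\<^sup>+\<omega>. ennreal (\<phi> (Xh N t \<omega>)) \<partial>M)" for i
    have "u (Suc i) \<le> e * u i + b + w i" if "i < Suc n" for i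
    proof (cases "i = n")
      case True then show ?thesis using st[OF 2(2,3)] by (simp add: u_def)
    next
      case False
      then show ?thesis using that st[of i "tn N (Suc i)"] dt_pos[OF N]
        by (simp add: u_def tn_Suc Xh_grid[OF N, of "Suc i", unfolded tn_Suc] del: bem_grid.simps)
    qed
    from discrete_gronwall[of "Suc n" u, OF this e1]
    have "u (Suc n) \<le> e ^ Suc n * (ennreal (\<phi> x0) + of_nat (Suc n) * b + (\<Sum>i<Suc n. w i))"
      by (simp add: u_def emeasure_space_1)
    then show ?thesis using final[of "Suc n"] 2(1) by (simp add: u_def del: sum.lessThan_Suc of_nat_Suc power_Suc)
  qed
qed

lemma continuous_inverse_h: "continuous_on S (\<lambda>x. 1 / h x)"
  by (intro continuous_intros continuous_h) (auto dest: h_pos)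

lemma inverse_h_bound:
  obtains B where "\<And>N t. 0 < N \<Longrightarrow> 0 \<le> t \<Longrightarrow> t \<le> T \<Longrightarrow> (\<integral>\<^sup>+\<omega>. ennreal (1 / h (Xh N t \<omega>)) \<partial>M) \<le> ennreal B"
proof -
  \<comment> \<open>Lies strictly between 0 and 1 for \<open>Eocc_sum_bound\<close> and not below q
    for \<open>inverse_h_step\<close>.\<close>
  define p where "p = (1 + q) / 2"
  have p: "0 < p" "p < 1" "q \<le> p" using q_nonneg q_less_1 by (auto simp: p_def)
  obtain K where K: "0 \<le> K" and
    step: "\<And>z c b. z \<in> S \<Longrightarrow> 0 < c \<Longrightarrow> 0 < b \<Longrightarrow> c\<^sup>2 * b \<le> s0 \<Longrightarrow>
      (\<integral>\<^sup>+\<xi>. ennreal (1 / h (stp c z (sqrt b * \<xi>) b)) \<partial>N01)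
        \<le> ennreal (1 / h z) + ennreal (K * (c\<^sup>2 * b)) + ennreal K * occ p c z b"
    using inverse_h_step[OF p(3) s0_nonneg] by blast
  obtain B0 where B0: "\<And>N. 0 < N \<Longrightarrow> (\<Sum>n<N. Eocc p N n) \<le> ennreal B0"
    using Eocc_sum_bound[OF p(1,2)] by blast
  define R where "R = ennreal (1 / h x0) + ennreal (K * (Sg\<^sup>2 * T)) + ennreal K * ennreal B0"
  have "R < top" by (simp add: R_def ennreal_mult_less_top)
  then obtain B where B: "R = ennreal B" by (metis ennreal_enn2real)
  show ?thesis
  proof (rule that[of B])
    fix N :: nat and t assume N: "0 < N" and t: "0 \<le> t" "t \<le> T"
    have "(\<integral>\<^sup>+\<omega>. ennreal (1 / h (Xh N t \<omega>)) \<partial>M)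
      \<le> ennreal (exp (0 * (Sg\<^sup>2 * T))) * (ennreal (1 / h x0) + ennreal (K * (Sg\<^sup>2 * T)) + ennreal K * (\<Sum>i<N. Eocc p N i))"
    proof (rule expectation_bound[OF continuous_inverse_h _ order_refl K _ N t])
      fix z c b assume *: "z \<in> S" "0 < c" "0 < b" "c\<^sup>2 * b \<le> s0"
      have "ennreal ((1 + 0 * (c\<^sup>2 * b)) * (1 / h z) + K * (c\<^sup>2 * b)) = ennreal (1 / h z) + ennreal (K * (c\<^sup>2 * b))"
        using h_pos[OF *(1)] K * by (subst ennreal_plus[symmetric]) auto
      then show "(\<integral>\<^sup>+\<xi>. ennreal (1 / h (stp c z (sqrt b * \<xi>) b)) \<partial>N01)
        \<le> ennreal ((1 + 0 * (c\<^sup>2 * b)) * (1 / h z) + K * (c\<^sup>2 * b)) + ennreal K * occ p c z b"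
        using step[OF *] by simp
    qed (auto dest: h_pos intro: less_imp_le)
    also have "\<dots> \<le> R" unfolding R_def using B0[OF N] by (simp add: add_left_mono mult_left_mono)
    finally show "(\<integral>\<^sup>+\<omega>. ennreal (1 / h (Xh N t \<omega>)) \<partial>M) \<le> ennreal B" by (simp add: B)
  qed
qed

lemma moment_bound:
  obtains B where "0 \<le> B" "\<And>N t. 0 < N \<Longrightarrow> 0 \<le> t \<Longrightarrow> t \<le> T \<Longrightarrow> (\<integral>\<^sup>+\<omega>. ennreal ((1 + (Xh N t \<omega>)\<^sup>2) ^ m) \<partial>M) \<le> ennreal B"
proof -
  obtain K where K: "0 \<le> K" and
    step: "\<And>z c b. z \<in> S \<Longrightarrow> 0 < c \<Longrightarrow> 0 < b \<Longrightarrow> c\<^sup>2 * b \<le> s0 \<Longrightarrow>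
      (\<integral>\<^sup>+\<xi>. ennreal ((1 + (stp c z (sqrt b * \<xi>) b)\<^sup>2) ^ m) \<partial>N01) \<le> ennreal ((1 + K * (c\<^sup>2 * b)) * (1 + z\<^sup>2) ^ m)"
    using moment_step[OF s0_nonneg, of m] by blast
  have co: "continuous_on S (\<lambda>x. (1 + x\<^sup>2) ^ m)" by (intro continuous_intros)
  show ?thesis
  proof (rule that[of "exp (K * (Sg\<^sup>2 * T)) * (1 + x0\<^sup>2) ^ m"])
    fix N :: nat and t assume N: "0 < N" and t: "0 \<le> t" "t \<le> T"
    have "(\<integral>\<^sup>+\<omega>. ennreal ((1 + (Xh N t \<omega>)\<^sup>2) ^ m) \<partial>M)
      \<le> ennreal (exp (K * (Sg\<^sup>2 * T))) * (ennreal ((1 + x0\<^sup>2) ^ m) + ennreal (0 * (Sg\<^sup>2 * T)) + ennreal 0 * (\<Sum>i<N. Eocc 0 N i))"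
      by (rule expectation_bound[OF co _ K order_refl _ N t]) (use step in simp_all)
    then show "(\<integral>\<^sup>+\<omega>. ennreal ((1 + (Xh N t \<omega>)\<^sup>2) ^ m) \<partial>M) \<le> ennreal (exp (K * (Sg\<^sup>2 * T)) * (1 + x0\<^sup>2) ^ m)"
      by (simp add: ennreal_mult)
  qed simp
qed


text \<open>The scheme on its step \<open>n\<close>; the value \<open>x0\<close> elsewhere keeps the map jointly measurable and in \<open>S\<close>.\<close>

definition "Xstep N n s \<omega> = (if tn N n < s \<and> s \<le> tn N (Suc n) then Xh N s \<omega> else x0)"

lemma Xstep_in_S: "0 < N \<Longrightarrow> Xstep N n s \<omega> \<in> S"
  by (auto simp: Xstep_def x0_in_S intro: Xh_in_S[of N n])

lemma Xstep_measurable: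
  assumes N: "0 < N"
  shows "(\<lambda>x. Xstep N n (fst x) (snd x)) \<in> borel_measurable (lborel \<Otimes>\<^sub>M M)"
proof -
  define t' where "t' s = (if tn N n < s then s - tn N n else 1)" for s
  have t'm[measurable]: "t' \<in> borel_measurable borel" unfolding t'_def by measurable
  have t'0: "0 < t' s" for s by (simp add: t'_def)
  have cont: "continuous_on {0..} (\<lambda>t. W t \<omega>)" if "\<omega> \<in> space M" for \<omega>
    using bm that by (simp add: brownian_motion_def)
  have "(\<lambda>(s, \<omega>). W (max 0 s) \<omega>) \<in> borel_measurable (borel \<Otimes>\<^sub>M M)"
    by (rule measurable_continuous_paths[OF W_measurable cont])
  then have [measurable]: "(\<lambda>x. W (max 0 (fst x)) (snd x)) \<in> borel_measurable (lborel \<Otimes>\<^sub>M M)"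
    by (simp add: split_beta')
  note [measurable] = Y_measurable[OF N] W_measurable[OF tn_nonneg]
  have [measurable]: "(\<lambda>x. stp (\<sigma>' (Y N n (snd x))) (Y N n (snd x)) (W (max 0 (fst x)) (snd x) - W (tn N n) (snd x)) (t' (fst x))) \<in> borel_measurable (lborel \<Otimes>\<^sub>M M)"
    by (intro measurable_stp) (auto simp: \<sigma>'_pos t'0)
  have "(\<lambda>x. if tn N n < fst x \<and> fst x \<le> tn N (Suc n) then stp (\<sigma>' (Y N n (snd x))) (Y N n (snd x)) (W (max 0 (fst x)) (snd x) - W (tn N n) (snd x)) (t' (fst x)) else x0) \<in> borel_measurable (lborel \<Otimes>\<^sub>M M)"
    by measurable
  also have "(\<lambda>x. if tn N n < fst x \<and> fst x \<le> tn N (Suc n) then stp (\<sigma>' (Y N n (snd x))) (Y N n (snd x)) (W (max 0 (fst x)) (snd x) - W (tn N n) (snd x)) (t' (fst x)) else x0)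
    = (\<lambda>x. Xstep N n (fst x) (snd x))"
  proof
    fix x :: "real \<times> 'a"
    have "max 0 (fst x) = fst x" if "tn N n < fst x" using that tn_nonneg[of N n] by simp
    then show "(if tn N n < fst x \<and> fst x \<le> tn N (Suc n) then stp (\<sigma>' (Y N n (snd x))) (Y N n (snd x)) (W (max 0 (fst x)) (snd x) - W (tn N n) (snd x)) (t' (fst x)) else x0)
      = Xstep N n (fst x) (snd x)"
      by (simp add: Xstep_def Xh_eq[OF N, of n] t'_def)
  qed
  finally show ?thesis .
qed

section \<open>Time integrals along the scheme\<close>

lemma swap_time:
  fixes a b :: real
  assumes f: "(\<lambda>x. f (fst x) (snd x)) \<in> borel_measurable (lborel \<Otimes>\<^sub>M M)"
  shows "(\<integral>\<^sup>+\<omega>. (\<integral>\<^sup>+s\<in>{a<..b}. f s \<omega> \<partial>lborel) \<partial>M) = (\<integral>\<^sup>+s\<in>{a<..b}. (\<integral>\<^sup>+\<omega>. f s \<omega> \<partial>M) \<partial>lborel)"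
    "(\<lambda>\<omega>. (\<integral>\<^sup>+s\<in>{a<..b}. f s \<omega> \<partial>lborel)) \<in> borel_measurable M"
proof -
  interpret pair_sigma_finite lborel M ..
  note [measurable] = f
  have m: "(\<lambda>(s, \<omega>). f s \<omega> * indicator {a<..b} s) \<in> borel_measurable (lborel \<Otimes>\<^sub>M M)"
    unfolding split_beta' by measurable
  have "(\<integral>\<^sup>+\<omega>. (\<integral>\<^sup>+s. f s \<omega> * indicator {a<..b} s \<partial>lborel) \<partial>M) = (\<integral>\<^sup>+s. (\<integral>\<^sup>+\<omega>. f s \<omega> * indicator {a<..b} s \<partial>M) \<partial>lborel)"
    by (rule Fubini'[OF m])
  also have "\<dots> = (\<integral>\<^sup>+s\<in>{a<..b}. (\<integral>\<^sup>+\<omega>. f s \<omega> \<partial>M) \<partial>lborel)"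
    by (intro nn_integral_cong) (auto simp: indicator_def)
  finally show "(\<integral>\<^sup>+\<omega>. (\<integral>\<^sup>+s\<in>{a<..b}. f s \<omega> \<partial>lborel) \<partial>M) = (\<integral>\<^sup>+s\<in>{a<..b}. (\<integral>\<^sup>+\<omega>. f s \<omega> \<partial>M) \<partial>lborel)" .
  show "(\<lambda>\<omega>. (\<integral>\<^sup>+s\<in>{a<..b}. f s \<omega> \<partial>lborel)) \<in> borel_measurable M"
    by (rule lborel.borel_measurable_nn_integral) (use measurable_pair_swap[OF m] in \<open>simp add: split_beta'\<close>)
qed

lemma nn_integral_Icc_eq_Ioc: "(\<integral>\<^sup>+s\<in>{a..b}. f s \<partial>lborel) = (\<integral>\<^sup>+s\<in>{a<..b}. f s \<partial>lborel)" for a b :: real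
  by (intro nn_integral_cong_AE, use AE_lborel_singleton[of a] in eventually_elim) (auto simp: indicator_def)

lemma measurable_psi_Xstep:
  assumes N: "0 < N" and e: "continuous_on S e"
  shows "(\<lambda>x. ennreal (psi (\<sigma>' (Y N n (snd x))) e (fst x - tn N n) (Xstep N n (fst x) (snd x)))) \<in> borel_measurable (lborel \<Otimes>\<^sub>M M)"
proof -
  note [measurable] = Y_measurable[OF N]
  have "(\<lambda>x. psi (\<sigma>' (Y N n (snd x))) e (fst x - tn N n) (Xstep N n (fst x) (snd x))) \<in> borel_measurable (lborel \<Otimes>\<^sub>M M)"
    by (rule measurable_psi[OF _ _ Xstep_measurable[OF N]]) (use Xstep_in_S[OF N] e in auto)
  then show ?thesis by measurable
qed

text \<open>Conditioning on \<open>Y N n\<close> works at a fixed time, so the integrals are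
  exchanged, the kernel is inserted, the integrals are exchanged back and time is shifted by
  t_n.\<close>

lemma time_integral_eq_Eocc:
  fixes p :: real
  assumes N: "0 < N"
  defines "e \<equiv> \<lambda>y. h y powr (- 2 - p)"
  shows "(\<integral>\<^sup>+\<omega>. (\<integral>\<^sup>+s\<in>{tn N n<..tn N (Suc n)}. ennreal (psi (\<sigma>' (Y N n \<omega>)) e (s - tn N n) (Xstep N n s \<omega>)) \<partial>lborel) \<partial>M) = Eocc p N n"
proof -
  interpret pair_sigma_finite lborel M ..
  have e: "continuous_on S e" unfolding e_def by (rule continuous_h_powr)
  note [measurable] = Y_measurable[OF N]
  have step: "(\<integral>\<^sup>+\<omega>. ennreal (psi (\<sigma>' (Y N n \<omega>)) e (s - tn N n) (Xstep N n s \<omega>)) \<partial>M) = (\<integral>\<^sup>+\<omega>. step_mean (\<sigma>' (Y N n \<omega>)) (Y N n \<omega>) e (s - tn N n) \<partial>M)"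
    if s: "tn N n < s" "s \<le> tn N (Suc n)" for s
  proof -
    have "snd \<in> borel_measurable ((borel :: real measure) \<Otimes>\<^sub>M restrict_space borel S)"
      using measurable_snd[of "borel :: real measure" "restrict_space borel S"] by (simp add: measurable_restrict_space2_iff)
    then have "(\<lambda>x. psi (\<sigma>' (fst x)) e (s - tn N n) (snd x)) \<in> borel_measurable (borel \<Otimes>\<^sub>M restrict_space borel S)"
      by (intro measurable_psi e) (auto simp: space_pair_measure space_restrict_space)
    then have "(\<lambda>(z, x). ennreal (psi (\<sigma>' z) e (s - tn N n) x)) \<in> borel_measurable (borel \<Otimes>\<^sub>M restrict_space borel S)"
      by (simp add: split_beta')
    from Xh_step_integral[OF N s this] show ?thesis using s by (simp add: Xstep_def step_mean_def)
  qed
  have m: "(\<lambda>(s, \<omega>). step_mean (\<sigma>' (Y N n \<omega>)) (Y N n \<omega>) e (s - tn N n) * indicator {0<..dt N} (s - tn N n)) \<in> borel_measurable (lborel \<Otimes>\<^sub>M M)"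
  proof -
    have "(\<lambda>x. (Y N n (snd x), fst x - tn N n)) \<in> measurable (lborel \<Otimes>\<^sub>M M) (borel \<Otimes>\<^sub>M lborel)" by measurable
    from measurable_compose[OF this measurable_step_mean_joint[OF e, of "dt N"]] show ?thesis by (simp add: split_beta')
  qed
  have ind: "indicator {tn N n<..tn N (Suc n)} s = (indicator {0<..dt N} (s - tn N n) :: ennreal)" for s
    by (auto simp: indicator_def tn_Suc)
  have "(\<integral>\<^sup>+\<omega>. (\<integral>\<^sup>+s\<in>{tn N n<..tn N (Suc n)}. ennreal (psi (\<sigma>' (Y N n \<omega>)) e (s - tn N n) (Xstep N n s \<omega>)) \<partial>lborel) \<partial>M)
    = (\<integral>\<^sup>+s\<in>{tn N n<..tn N (Suc n)}. (\<integral>\<^sup>+\<omega>. ennreal (psi (\<sigma>' (Y N n \<omega>)) e (s - tn N n) (Xstep N n s \<omega>)) \<partial>M) \<partial>lborel)"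
    by (rule swap_time(1)[OF measurable_psi_Xstep[OF N e]])
  also have "\<dots> = (\<integral>\<^sup>+s. (\<integral>\<^sup>+\<omega>. step_mean (\<sigma>' (Y N n \<omega>)) (Y N n \<omega>) e (s - tn N n) * indicator {0<..dt N} (s - tn N n) \<partial>M) \<partial>lborel)"
  proof (intro nn_integral_cong)
    fix s
    show "(\<integral>\<^sup>+\<omega>. ennreal (psi (\<sigma>' (Y N n \<omega>)) e (s - tn N n) (Xstep N n s \<omega>)) \<partial>M) * indicator {tn N n<..tn N (Suc n)} s
      = (\<integral>\<^sup>+\<omega>. step_mean (\<sigma>' (Y N n \<omega>)) (Y N n \<omega>) e (s - tn N n) * indicator {0<..dt N} (s - tn N n) \<partial>M)"
      unfolding ind[symmetric] by (cases "s \<in> {tn N n<..tn N (Suc n)}") (auto simp: step)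
  qed
  also have "\<dots> = (\<integral>\<^sup>+\<omega>. (\<integral>\<^sup>+s. step_mean (\<sigma>' (Y N n \<omega>)) (Y N n \<omega>) e (s - tn N n) * indicator {0<..dt N} (s - tn N n) \<partial>lborel) \<partial>M)"
    by (rule Fubini'[OF m, symmetric])
  also have "\<dots> = Eocc p N n"
    unfolding Eocc_def occ_def
  proof (rule nn_integral_cong)
    fix \<omega>
    define G where "G t = step_mean (\<sigma>' (Y N n \<omega>)) (Y N n \<omega>) e t * indicator {0<..dt N} t" for t
    have [measurable]: "G \<in> borel_measurable borel"
      using measurable_step_mean[OF \<sigma>'_pos e] by (simp add: G_def[abs_def])
    have "(\<integral>\<^sup>+t. G t \<partial>lborel) = (\<integral>\<^sup>+s. G (- tn N n + 1 * s) \<partial>lborel)"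
      by (subst nn_integral_real_affine[where c = 1 and t = "- tn N n"]) auto
    then show "(\<integral>\<^sup>+s. step_mean (\<sigma>' (Y N n \<omega>)) (Y N n \<omega>) e (s - tn N n) * indicator {0<..dt N} (s - tn N n) \<partial>lborel)
      = (\<integral>\<^sup>+t\<in>{0<..dt N}. step_mean (\<sigma>' (Y N n \<omega>)) (Y N n \<omega>) (\<lambda>y. h y powr (- 2 - p)) t \<partial>lborel)"
      by (simp add: G_def e_def)
  qed
  finally show ?thesis .
qed

lemma bem_Hx_eq:
  assumes "x \<in> S" "z \<in> S"
  shows "bem_Hx \<sigma> h a z s x = Hs ((\<sigma>' z)\<^sup>2 * (s - a)) x"
proof -
  have "bem_H \<sigma> h a z s = (\<lambda>y. y - ((\<sigma>' z)\<^sup>2 * (s - a)) * g y)"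
    using assms by (auto simp: bem_H_def g_def \<sigma>'_def h1_eq[symmetric] fun_eq_iff)
  then show ?thesis unfolding bem_Hx_def using DERIV_imp_deriv[OF step_deriv[OF assms(1)]] by simp
qed

definition "Bterm p N n \<omega> = (\<integral>\<^sup>+ s\<in>{tn N n..tn N (Suc n)}.
   ennreal ((\<sigma> (Xh N (tn N n) \<omega>))\<^sup>2 * h (Xh N s \<omega>) powr (- 2 - p)
     / (bem_Hx \<sigma> h (tn N n) (Xh N (tn N n) \<omega>) s (Xh N s \<omega>))\<^sup>2) \<partial>lborel)"

lemma Bterm_eq:
  assumes N: "0 < N"
  shows "Bterm p N n \<omega> = (\<integral>\<^sup>+s\<in>{tn N n<..tn N (Suc n)}. ennreal (psi (\<sigma>' (Y N n \<omega>)) (\<lambda>y. h y powr (- 2 - p)) (s - tn N n) (Xstep N n s \<omega>)) \<partial>lborel)"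
  unfolding Bterm_def nn_integral_Icc_eq_Ioc
proof (intro nn_integral_cong)
  fix s
  show "ennreal ((\<sigma> (Xh N (tn N n) \<omega>))\<^sup>2 * h (Xh N s \<omega>) powr (- 2 - p)
     / (bem_Hx \<sigma> h (tn N n) (Xh N (tn N n) \<omega>) s (Xh N s \<omega>))\<^sup>2) * indicator {tn N n<..tn N (Suc n)} s
   = ennreal (psi (\<sigma>' (Y N n \<omega>)) (\<lambda>y. h y powr (- 2 - p)) (s - tn N n) (Xstep N n s \<omega>)) * indicator {tn N n<..tn N (Suc n)} s"
  proof (cases "s \<in> {tn N n<..tn N (Suc n)}")
    case True
    then have "Xh N s \<omega> \<in> S" by (intro Xh_in_S[OF N]) auto
    then show ?thesis using True Y_in_S[OF N, of n \<omega>]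
      by (simp add: bem_Hx_eq Xh_grid[OF N] psi_def Xstep_def \<sigma>'_def)
  qed simp
qed

lemma Bterm_measurable: assumes N: "0 < N" shows "Bterm p N n \<in> borel_measurable M"
proof -
  have "Bterm p N n = (\<lambda>\<omega>. \<integral>\<^sup>+s\<in>{tn N n<..tn N (Suc n)}. ennreal (psi (\<sigma>' (Y N n \<omega>)) (\<lambda>y. h y powr (- 2 - p)) (s - tn N n) (Xstep N n s \<omega>)) \<partial>lborel)"
    by (rule ext) (rule Bterm_eq[OF N])
  then show ?thesis using swap_time(2)[OF measurable_psi_Xstep[OF N continuous_h_powr]] by simp
qed

lemma EBterm: "0 < N \<Longrightarrow> (\<integral>\<^sup>+\<omega>. Bterm p N n \<omega> \<partial>M) = Eocc p N n"
  by (simp add: Bterm_eq time_integral_eq_Eocc)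

text \<open>The drift bound behind \<open>Eocc_sum_bound\<close> requires p > 0, whereas (1) admits
  p = 0. Raising the exponent costs at most Sg^2 per unit of time because H_x >= 1.\<close>

lemma Bterm_mono:
  assumes N: "0 < N" and p: "0 \<le> p" "p \<le> p'" and \<omega>: "\<omega> \<in> space M"
  shows "Bterm p N n \<omega> \<le> ennreal (Sg\<^sup>2 * dt N) + Bterm p' N n \<omega>"
proof -
  note d = dt_pos[OF N]
  have m: "(\<lambda>s. ennreal (psi (\<sigma>' (Y N n \<omega>)) (\<lambda>y. h y powr (- 2 - p')) (s - tn N n) (Xstep N n s \<omega>)) * indicator {tn N n<..tn N (Suc n)} s) \<in> borel_measurable lborel"

  proof -
    have "(\<lambda>s. ennreal (psi (\<sigma>' (Y N n \<omega>)) (\<lambda>y. h y powr (- 2 - p')) (s - tn N n) (Xstep N n s \<omega>))) \<in> borel_measurable lborel"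
      using measurable_compose[OF measurable_Pair2'[OF \<omega>] measurable_psi_Xstep[OF N continuous_h_powr[of "- 2 - p'"], of n]] by simp
    then show ?thesis by (rule borel_measurable_times_ennreal) simp
  qed
  have "Bterm p N n \<omega> \<le> (\<integral>\<^sup>+s. ennreal (Sg\<^sup>2) * indicator {tn N n<..tn N (Suc n)} s + ennreal (psi (\<sigma>' (Y N n \<omega>)) (\<lambda>y. h y powr (- 2 - p')) (s - tn N n) (Xstep N n s \<omega>)) * indicator {tn N n<..tn N (Suc n)} s \<partial>lborel)"
    unfolding Bterm_eq[OF N]
  proof (intro nn_integral_mono)
    fix s
    show "ennreal (psi (\<sigma>' (Y N n \<omega>)) (\<lambda>y. h y powr (- 2 - p)) (s - tn N n) (Xstep N n s \<omega>)) * indicator {tn N n<..tn N (Suc n)} s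
      \<le> ennreal (Sg\<^sup>2) * indicator {tn N n<..tn N (Suc n)} s + ennreal (psi (\<sigma>' (Y N n \<omega>)) (\<lambda>y. h y powr (- 2 - p')) (s - tn N n) (Xstep N n s \<omega>)) * indicator {tn N n<..tn N (Suc n)} s"
    proof (cases "s \<in> {tn N n<..tn N (Suc n)}")
      case True
      define x c where "x = Xstep N n s \<omega>" and "c = \<sigma>' (Y N n \<omega>)"
      have x: "x \<in> S" unfolding x_def by (rule Xstep_in_S[OF N])
      have H: "1 \<le> Hs (c\<^sup>2 * (s - tn N n)) x" using True by (intro Hs_ge_1 x) auto
      have "h x powr (- 2 - p) \<le> 1 + h x powr (- 2 - p')"
        using powr_le_one_plus[OF h_pos[OF x], of "2 + p" "2 + p'"] p by simp
      then have "psi c (\<lambda>y. h y powr (- 2 - p)) (s - tn N n) x \<le> c\<^sup>2 * (1 + h x powr (- 2 - p')) / (Hs (c\<^sup>2 * (s - tn N n)) x)\<^sup>2"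
        unfolding psi_def by (intro divide_right_mono mult_left_mono) auto
      also have "\<dots> = c\<^sup>2 / (Hs (c\<^sup>2 * (s - tn N n)) x)\<^sup>2 + psi c (\<lambda>y. h y powr (- 2 - p')) (s - tn N n) x"
        by (simp add: psi_def distrib_left add_divide_distrib)
      also have "c\<^sup>2 / (Hs (c\<^sup>2 * (s - tn N n)) x)\<^sup>2 \<le> Sg\<^sup>2 / 1"
        using H \<sigma>'_sq_le[OF Y_in_S[OF N]] unfolding c_def by (intro frac_le) auto
      finally have "ennreal (psi c (\<lambda>y. h y powr (- 2 - p)) (s - tn N n) x) \<le> ennreal (Sg\<^sup>2 + psi c (\<lambda>y. h y powr (- 2 - p')) (s - tn N n) x)"
        by (intro ennreal_leI) simp
      also have "\<dots> = ennreal (Sg\<^sup>2) + ennreal (psi c (\<lambda>y. h y powr (- 2 - p')) (s - tn N n) x)"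
        by (rule ennreal_plus) (auto simp: psi_nonneg)
      finally show ?thesis using True by (simp add: x_def c_def)
    qed simp
  qed
  also have "\<dots> = (\<integral>\<^sup>+s. ennreal (Sg\<^sup>2) * indicator {tn N n<..tn N (Suc n)} s \<partial>lborel) + Bterm p' N n \<omega>"
    unfolding Bterm_eq[OF N] by (rule nn_integral_add[OF _ m]) simp
  also have "(\<integral>\<^sup>+s. ennreal (Sg\<^sup>2) * indicator {tn N n<..tn N (Suc n)} s \<partial>lborel) = ennreal (Sg\<^sup>2 * dt N)"
    using d by (simp add: nn_integral_cmult_indicator tn_Suc ennreal_mult)
  finally show ?thesis .
qed


section \<open>The bounds in (1) and (3)\<close>

lemma Xh_T:
  assumes N: "0 < N" and t: "0 \<le> t" "t \<le> T"
  shows "Xh N t \<in> borel_measurable M" "Xh N t \<omega> \<in> S"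
proof -
  from N t have "Xh N t \<in> borel_measurable M \<and> Xh N t \<omega> \<in> S"
  proof (cases rule: Xh_grid_cases)
    case 1
    then have "Xh N t = (\<lambda>\<omega>. x0)" by (simp add: bem_def fun_eq_iff)
    then show ?thesis by (simp add: x0_in_S)
  next
    case (2 n)
    then show ?thesis using Xh_measurable[OF N, of n t] Xh_in_S[OF N, of n t] by simp
  qed
  then show "Xh N t \<in> borel_measurable M" "Xh N t \<omega> \<in> S" by auto
qed

lemma bem_moments_bounded:
  assumes p: "0 \<le> p" "p < 1"
  shows "(SUP N\<in>{2..}. SUP t\<in>{0..T}. \<integral>\<^sup>+ \<omega>. (ennreal (1 / h (Xh N t \<omega>)) + (\<Sum>n<N. Bterm p N n \<omega>)
      + ennreal (\<bar>Xh N t \<omega>\<bar> ^ m)) \<partial>M) < \<infinity>"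
proof -
  define p' where "p' = (1 + p) / 2"
  have p': "0 < p'" "p' < 1" "p \<le> p'" using p by (auto simp: p'_def)
  obtain B1 where B1: "\<And>N t. 0 < N \<Longrightarrow> 0 \<le> t \<Longrightarrow> t \<le> T \<Longrightarrow> (\<integral>\<^sup>+\<omega>. ennreal (1 / h (Xh N t \<omega>)) \<partial>M) \<le> ennreal B1"
    using inverse_h_bound by blast
  obtain B2 where B2: "\<And>N. 0 < N \<Longrightarrow> (\<Sum>n<N. Eocc p' N n) \<le> ennreal B2"
    using Eocc_sum_bound[OF p'(1,2)] by blast
  obtain B3 where "0 \<le> B3" and B3: "\<And>N t. 0 < N \<Longrightarrow> 0 \<le> t \<Longrightarrow> t \<le> T \<Longrightarrow> (\<integral>\<^sup>+\<omega>. ennreal ((1 + (Xh N t \<omega>)\<^sup>2) ^ m) \<partial>M) \<le> ennreal B3"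
    by (rule moment_bound[of m]) (rule that)
  have "(\<integral>\<^sup>+ \<omega>. (ennreal (1 / h (Xh N t \<omega>)) + (\<Sum>n<N. Bterm p N n \<omega>) + ennreal (\<bar>Xh N t \<omega>\<bar> ^ m)) \<partial>M)
     \<le> ennreal B1 + (ennreal (Sg\<^sup>2 * T) + ennreal B2) + ennreal B3" if N: "2 \<le> N" and t: "0 \<le> t" "t \<le> T" for N t
  proof -
    have N0: "0 < N" using N by simp
    note [measurable] = Xh_T(1)[OF N0 t] Bterm_measurable[OF N0]
    have [measurable]: "(\<lambda>\<omega>. 1 / h (Xh N t \<omega>)) \<in> borel_measurable M"
      by (rule measurable_on_S[OF continuous_inverse_h _ Xh_T(2)[OF N0 t]]) simp
    have "(\<integral>\<^sup>+ \<omega>. (ennreal (1 / h (Xh N t \<omega>)) + (\<Sum>n<N. Bterm p N n \<omega>) + ennreal (\<bar>Xh N t \<omega>\<bar> ^ m)) \<partial>M)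
      = (\<integral>\<^sup>+ \<omega>. ennreal (1 / h (Xh N t \<omega>)) \<partial>M) + (\<Sum>n<N. \<integral>\<^sup>+ \<omega>. Bterm p N n \<omega> \<partial>M) + (\<integral>\<^sup>+ \<omega>. ennreal (\<bar>Xh N t \<omega>\<bar> ^ m) \<partial>M)"
    proof -
      have add3: "(\<integral>\<^sup>+\<omega>. u \<omega> + v \<omega> + w \<omega> \<partial>M) = (\<integral>\<^sup>+\<omega>. u \<omega> \<partial>M) + (\<integral>\<^sup>+\<omega>. v \<omega> \<partial>M) + (\<integral>\<^sup>+\<omega>. w \<omega> \<partial>M)"
        if "u \<in> borel_measurable M" "v \<in> borel_measurable M" "w \<in> borel_measurable M" for u v w :: "'a \<Rightarrow> ennreal"
        using that by (simp add: nn_integral_add)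
      have "(\<integral>\<^sup>+ \<omega>. (\<Sum>n<N. Bterm p N n \<omega>) \<partial>M) = (\<Sum>n<N. \<integral>\<^sup>+ \<omega>. Bterm p N n \<omega> \<partial>M)"
        by (rule nn_integral_sum) measurable
      then show ?thesis by (subst add3) simp_all
    qed
    also have "\<dots> \<le> ennreal B1 + (ennreal (Sg\<^sup>2 * T) + ennreal B2) + ennreal B3"
    proof (intro add_mono B1 N0 t)
      have "(\<Sum>n<N. \<integral>\<^sup>+ \<omega>. Bterm p N n \<omega> \<partial>M) \<le> (\<Sum>n<N. \<integral>\<^sup>+ \<omega>. ennreal (Sg\<^sup>2 * dt N) + Bterm p' N n \<omega> \<partial>M)"
        by (intro sum_mono nn_integral_mono Bterm_mono N0 p p')
      also have "\<dots> = (\<Sum>n<N. ennreal (Sg\<^sup>2 * dt N) + Eocc p' N n)"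
        by (intro sum.cong refl) (simp add: nn_integral_add emeasure_space_1 EBterm[OF N0])
      also have "\<dots> = ennreal (real N) * ennreal (Sg\<^sup>2 * dt N) + (\<Sum>n<N. Eocc p' N n)"
        by (simp add: sum.distrib ennreal_of_nat_eq_real_of_nat)
      also have "ennreal (real N) * ennreal (Sg\<^sup>2 * dt N) = ennreal (Sg\<^sup>2 * T)"
      proof -
        have e: "real N * (Sg\<^sup>2 * dt N) = Sg\<^sup>2 * T" using dt_sum[OF N0] by (metis mult.left_commute)
        show ?thesis unfolding e[symmetric] by (rule ennreal_mult[symmetric]) (use dt_pos[OF N0] in auto)
      qed
      also have "ennreal (Sg\<^sup>2 * T) + (\<Sum>n<N. Eocc p' N n) \<le> ennreal (Sg\<^sup>2 * T) + ennreal B2"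
        by (intro add_left_mono B2 N0)
      finally show "(\<Sum>n<N. \<integral>\<^sup>+ \<omega>. Bterm p N n \<omega> \<partial>M) \<le> ennreal (Sg\<^sup>2 * T) + ennreal B2" .
      have "(\<integral>\<^sup>+ \<omega>. ennreal (\<bar>Xh N t \<omega>\<bar> ^ m) \<partial>M) \<le> (\<integral>\<^sup>+\<omega>. ennreal ((1 + (Xh N t \<omega>)\<^sup>2) ^ m) \<partial>M)"
      proof (intro nn_integral_mono ennreal_leI power_mono)
        fix \<omega>
        show "\<bar>Xh N t \<omega>\<bar> \<le> 1 + (Xh N t \<omega>)\<^sup>2"
          using zero_le_power2[of "\<bar>Xh N t \<omega>\<bar> - 1"] by (simp add: power2_diff)
      qed simp
      also have "\<dots> \<le> ennreal B3" by (rule B3[OF N0 t])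
      finally show "(\<integral>\<^sup>+ \<omega>. ennreal (\<bar>Xh N t \<omega>\<bar> ^ m) \<partial>M) \<le> ennreal B3" .
    qed
    finally show ?thesis .
  qed
  then have "(SUP N\<in>{2..}. SUP t\<in>{0..T}. \<integral>\<^sup>+ \<omega>. (ennreal (1 / h (Xh N t \<omega>)) + (\<Sum>n<N. Bterm p N n \<omega>)
      + ennreal (\<bar>Xh N t \<omega>\<bar> ^ m)) \<partial>M) \<le> ennreal B1 + (ennreal (Sg\<^sup>2 * T) + ennreal B2) + ennreal B3"
    by (intro SUP_least) auto
  also have "\<dots> < \<infinity>" by simp
  finally show ?thesis .
qed

text \<open>As -h''/h <= D h^-p, the exponential factor is of order dt h(z)^-p, so each step
  contributes of order dt^2 and N steps of order T/N. Young's inequality separates h(z)^-p from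
  h(x)^-p and x^m, and 2p <= 1 reduces the squares to 1/h.\<close>

lemma bem_error_integral_bound:
  fixes m :: real
  assumes p: "0 \<le> p" "p \<le> 1 / 2" and bdd: "bounded ((\<lambda>x. h2 x / h x powr (1 - p)) ` S)"
    and m: "0 \<le> m"
  shows "\<exists>K. \<forall>N\<ge>2. (\<integral>\<^sup>+ \<omega>. (\<Sum>n<N. \<integral>\<^sup>+ s\<in>{tn N n..tn N (Suc n)}.
           ennreal ((1 - exp ((s - tn N n) * (\<sigma> (Xh N (tn N n) \<omega>))\<^sup>2
                        * (h2 (Xh N (tn N n) \<omega>) / (2 * h (Xh N (tn N n) \<omega>)))))
                    * ((\<sigma> (Xh N (tn N n) \<omega>))\<^sup>2 * (h (Xh N s \<omega>) powr (- p) + Xh N s \<omega> powr m)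
                        / (bem_Hx \<sigma> h (tn N n) (Xh N (tn N n) \<omega>) s (Xh N s \<omega>))\<^sup>2)) \<partial>lborel) \<partial>M)
        < ennreal (K * T / real N)"
    (is "\<exists>K. \<forall>N\<ge>2. ?E N < _")
proof -
  obtain D where bd: "\<And>x. x \<in> S \<Longrightarrow> \<bar>h2 x / h x powr (1 - p)\<bar> \<le> D"
    using bdd unfolding bounded_iff by fastforce
  \<comment> \<open>The exponent m is real, the moment bounds are available for natural
    exponents.\<close>
  define k where "k = nat \<lceil>m\<rceil>"
  have e4: "ennreal (4 + 2 * a + b + c) = ennreal 4 + ennreal 2 * ennreal a + ennreal b + ennreal c"
    if "0 \<le> a" "0 \<le> b" "0 \<le> c" for a b c :: real
    using that by (simp add: ennreal_plus ennreal_mult del: ennreal_numeral)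
  obtain B1' where "\<And>N t. 0 < N \<Longrightarrow> 0 \<le> t \<Longrightarrow> t \<le> T \<Longrightarrow> (\<integral>\<^sup>+\<omega>. ennreal (1 / h (Xh N t \<omega>)) \<partial>M) \<le> ennreal B1'"
    using inverse_h_bound by blast
  then have "\<And>N t. 0 < N \<Longrightarrow> 0 \<le> t \<Longrightarrow> t \<le> T \<Longrightarrow> (\<integral>\<^sup>+\<omega>. ennreal (1 / h (Xh N t \<omega>)) \<partial>M) \<le> ennreal \<bar>B1'\<bar>"
    by (rule order_trans[OF _ ennreal_leI]) auto
  then obtain B1 where B1: "0 \<le> B1" "\<And>N t. 0 < N \<Longrightarrow> 0 \<le> t \<Longrightarrow> t \<le> T \<Longrightarrow> (\<integral>\<^sup>+\<omega>. ennreal (1 / h (Xh N t \<omega>)) \<partial>M) \<le> ennreal B1"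
    by (meson abs_ge_zero)
  obtain B3 where B3: "0 \<le> B3" "\<And>N t. 0 < N \<Longrightarrow> 0 \<le> t \<Longrightarrow> t \<le> T \<Longrightarrow> (\<integral>\<^sup>+\<omega>. ennreal ((1 + (Xh N t \<omega>)\<^sup>2) ^ k) \<partial>M) \<le> ennreal B3"
    using moment_bound[of k] by blast
  \<comment> \<open>The point \<open>x0\<close> witnesses that S is nonempty, whence D dominates an
    absolute value.\<close>
  have D: "0 \<le> D" using bd[OF x0_in_S] by linarith
  \<comment> \<open>From a (b + c) <= 2 a^2 + b^2 + c^2 with a = h(z)^-p, b = h(x)^-p and c = x^m,
    after bounding h^(-2p) by 1 + 1/h.\<close>
  define G where "G z x = 4 + 2 * (1 / h z) + 1 / h x + (1 + x\<^sup>2) ^ k" for z x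
  have Gnn: "0 \<le> G z x" if "z \<in> S" "x \<in> S" for z x
    using h_pos[OF that(1)] h_pos[OF that(2)] by (simp add: G_def)
  define A where "A = Sg^4 * D"
  have A: "0 \<le> A" using D by (simp add: A_def)
  have pt: "(1 - exp ((s - a) * (\<sigma> z)\<^sup>2 * (h2 z / (2 * h z)))) * ((\<sigma> z)\<^sup>2 * (h x powr (- p) + x powr m) / (bem_Hx \<sigma> h a z s x)\<^sup>2)
     \<le> A * d * G z x" if z: "z \<in> S" and x: "x \<in> S" and s: "a < s" "s \<le> a + d" for z x a s d
  proof -
    have hz: "0 < h z" and hx: "0 < h x" using h_pos z x by auto
    have sz: "0 < \<sigma> z" "(\<sigma> z)\<^sup>2 \<le> Sg\<^sup>2" using \<sigma>_pos[OF z] \<sigma>_le[OF z] by (auto intro!: power_mono)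
    have x0: "0 < x" using state_pos[OF x] .
    have "h2 z / h z = h2 z / h z powr (1 - p) * h z powr (- p)"
      using hz by (simp add: powr_diff powr_minus field_simps)
    then have e: "- (h2 z / h z) \<le> D * h z powr (- p)"
      using mult_right_mono[OF abs_le_D2[OF bd[OF z]], of "h z powr (- p)"] by simp
    have "1 - exp ((s - a) * (\<sigma> z)\<^sup>2 * (h2 z / (2 * h z))) \<le> - ((s - a) * (\<sigma> z)\<^sup>2 * (h2 z / (2 * h z)))"
      using exp_ge_add_one_self[of "(s - a) * (\<sigma> z)\<^sup>2 * (h2 z / (2 * h z))"] by linarith
    also have "\<dots> = (s - a) * (\<sigma> z)\<^sup>2 / 2 * (- (h2 z / h z))" by simp
    also have "\<dots> \<le> (s - a) * (\<sigma> z)\<^sup>2 / 2 * (D * h z powr (- p))"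
      using s by (intro mult_left_mono e) auto
    also have "\<dots> \<le> d * Sg\<^sup>2 / 1 * (D * h z powr (- p))"
      using s sz D by (intro mult_right_mono frac_le mult_mono) auto
    finally have 1: "1 - exp ((s - a) * (\<sigma> z)\<^sup>2 * (h2 z / (2 * h z))) \<le> d * Sg\<^sup>2 * (D * h z powr (- p))" by simp
    have H: "1 \<le> bem_Hx \<sigma> h a z s x" unfolding bem_Hx_eq[OF x z] using s by (intro Hs_ge_1 x) auto
    have 2: "(\<sigma> z)\<^sup>2 * (h x powr (- p) + x powr m) / (bem_Hx \<sigma> h a z s x)\<^sup>2 \<le> Sg\<^sup>2 * (h x powr (- p) + x powr m) / 1"
      using H sz by (intro frac_le mult_right_mono) auto
    have pp: "h y powr (- p) * h y powr (- p) \<le> 1 + 1 / h y" if "0 < h y" for y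
      using powr_le_one_plus[OF that, of "2 * p" 1] p that by (simp add: powr_add[symmetric] powr_minus_divide)
    have sq: "a * (b + c) \<le> 2 * (a * a) + b * b + c * c" for a b c :: real
    proof -
      have "2 * (a * b) \<le> a * a + b * b" "2 * (a * c) \<le> a * a + c * c"
        using zero_le_power2[of "a - b"] zero_le_power2[of "a - c"] by (simp_all add: power2_eq_square algebra_simps)
      then show ?thesis using zero_le_square[of a] zero_le_square[of b] zero_le_square[of c]
        unfolding distrib_left by linarith
    qed
    have xm: "x powr m * x powr m \<le> (1 + x\<^sup>2) ^ k"
    proof -
      have "x powr m * x powr m = (x\<^sup>2) powr m" using x0 by (simp add: powr_mult power2_eq_square)
      also have "\<dots> \<le> (1 + x\<^sup>2) powr m" using m by (intro powr_mono2) auto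
      also have "\<dots> \<le> (1 + x\<^sup>2) powr (real k)" by (intro powr_mono) (auto simp: k_def real_nat_ceiling_ge)
      also have "\<dots> = (1 + x\<^sup>2) ^ k" by (rule powr_realpow) (simp add: add_pos_nonneg)
      finally show ?thesis .
    qed
    have 3: "h z powr (- p) * (h x powr (- p) + x powr m) \<le> G z x"
      using sq[of "h z powr (- p)" "h x powr (- p)" "x powr m"] pp[OF hz] pp[OF hx] xm unfolding G_def by linarith
    have "(1 - exp ((s - a) * (\<sigma> z)\<^sup>2 * (h2 z / (2 * h z)))) * ((\<sigma> z)\<^sup>2 * (h x powr (- p) + x powr m) / (bem_Hx \<sigma> h a z s x)\<^sup>2)
      \<le> (d * Sg\<^sup>2 * (D * h z powr (- p))) * ((\<sigma> z)\<^sup>2 * (h x powr (- p) + x powr m) / (bem_Hx \<sigma> h a z s x)\<^sup>2)"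
      by (intro mult_right_mono 1) auto
    also have "\<dots> \<le> (d * Sg\<^sup>2 * (D * h z powr (- p))) * (Sg\<^sup>2 * (h x powr (- p) + x powr m))"
      using 2 D s by (intro mult_left_mono) auto
    also have "\<dots> = A * d * (h z powr (- p) * (h x powr (- p) + x powr m))"
      by (simp add: A_def power2_eq_square power4_eq_xxxx)
    also have "\<dots> \<le> A * d * G z x" using A s by (intro mult_left_mono 3) auto
    finally show ?thesis .
  qed
  define B where "B = 4 + 2 * B1 + B1 + B3"
  have Bnn: "0 \<le> B" using B1(1) B3(1) by (simp add: B_def)
  show ?thesis
  \<comment> \<open>The summand 1 makes the final inequality strict.\<close>
  proof (intro exI[of _ "A * B * T + 1"] allI impI)
    fix N :: nat assume "2 \<le> N"
    then have N: "0 < N" by simp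
    note d = dt_pos[OF N]
    note [measurable] = Y_measurable[OF N] Xstep_measurable[OF N]
    have hm[measurable]: "(\<lambda>x. 1 / h (Y N n (snd x))) \<in> borel_measurable (lborel \<Otimes>\<^sub>M M)"
      "(\<lambda>x. 1 / h (Xstep N n (fst x) (snd x))) \<in> borel_measurable (lborel \<Otimes>\<^sub>M M)" for n
    proof -
      have "(\<lambda>x. Y N n (snd x)) \<in> borel_measurable (lborel \<Otimes>\<^sub>M M)" by measurable
      from measurable_on_S[OF continuous_inverse_h this Y_in_S[OF N]]
      show "(\<lambda>x. 1 / h (Y N n (snd x))) \<in> borel_measurable (lborel \<Otimes>\<^sub>M M)" .
      show "(\<lambda>x. 1 / h (Xstep N n (fst x) (snd x))) \<in> borel_measurable (lborel \<Otimes>\<^sub>M M)"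
        by (rule measurable_on_S[OF continuous_inverse_h Xstep_measurable[OF N] Xstep_in_S[OF N]])
    qed
    have Gm[measurable]: "(\<lambda>x. ennreal (A * dt N * G (Y N n (snd x)) (Xstep N n (fst x) (snd x)))) \<in> borel_measurable (lborel \<Otimes>\<^sub>M M)" for n
      unfolding G_def by measurable
    have bound: "(\<integral>\<^sup>+ \<omega>. (\<integral>\<^sup>+s\<in>{tn N n<..tn N (Suc n)}. ennreal (A * dt N * G (Y N n \<omega>) (Xstep N n s \<omega>)) \<partial>lborel) \<partial>M)
      \<le> ennreal (A * dt N * B * dt N)" if n: "n < N" for n
    proof -
      have "(\<integral>\<^sup>+ \<omega>. (\<integral>\<^sup>+s\<in>{tn N n<..tn N (Suc n)}. ennreal (A * dt N * G (Y N n \<omega>) (Xstep N n s \<omega>)) \<partial>lborel) \<partial>M)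
        = (\<integral>\<^sup>+s\<in>{tn N n<..tn N (Suc n)}. (\<integral>\<^sup>+ \<omega>. ennreal (A * dt N * G (Y N n \<omega>) (Xstep N n s \<omega>)) \<partial>M) \<partial>lborel)"
        by (rule swap_time(1)[OF Gm])
      also have "\<dots> \<le> (\<integral>\<^sup>+s. ennreal (A * dt N * B) * indicator {tn N n<..tn N (Suc n)} s \<partial>lborel)"
      proof (intro nn_integral_mono)
        fix s
        show "(\<integral>\<^sup>+ \<omega>. ennreal (A * dt N * G (Y N n \<omega>) (Xstep N n s \<omega>)) \<partial>M) * indicator {tn N n<..tn N (Suc n)} s
          \<le> ennreal (A * dt N * B) * indicator {tn N n<..tn N (Suc n)} s"
        proof (cases "s \<in> {tn N n<..tn N (Suc n)}")
          case True
          have sT: "0 \<le> s" "s \<le> T" using True tn_nonneg[of N n] tn_le_T[OF N, of "Suc n"] n by auto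
          have tT: "0 \<le> tn N n" "tn N n \<le> T" using tn_nonneg tn_le_T[OF N, of n] n by auto
          note [measurable] = Xh_T(1)[OF N sT]
          have [measurable]: "(\<lambda>\<omega>. 1 / h (Xh N s \<omega>)) \<in> borel_measurable M" "(\<lambda>\<omega>. 1 / h (Y N n \<omega>)) \<in> borel_measurable M"
            by (rule measurable_on_S[OF continuous_inverse_h Xh_T[OF N sT]], rule measurable_on_S[OF continuous_inverse_h Y_measurable[OF N] Y_in_S[OF N]])
          have nn: "0 \<le> 1 / h (Y N n \<omega>)" "0 \<le> 1 / h (Xh N s \<omega>)" for \<omega>
            using h_pos[OF Y_in_S[OF N]] h_pos[OF Xh_T(2)[OF N sT]] by (auto intro!: less_imp_le)
          have "(\<integral>\<^sup>+ \<omega>. ennreal (A * dt N * G (Y N n \<omega>) (Xstep N n s \<omega>)) \<partial>M)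
            = (\<integral>\<^sup>+ \<omega>. ennreal (A * dt N) * (ennreal 4 + ennreal 2 * ennreal (1 / h (Y N n \<omega>)) + ennreal (1 / h (Xh N s \<omega>)) + ennreal ((1 + (Xh N s \<omega>)\<^sup>2) ^ k)) \<partial>M)"
          proof (intro nn_integral_cong)
            fix \<omega>
            have "ennreal (A * dt N * G (Y N n \<omega>) (Xstep N n s \<omega>)) = ennreal (A * dt N) * ennreal (G (Y N n \<omega>) (Xstep N n s \<omega>))"
              using A d Gnn[OF Y_in_S[OF N] Xstep_in_S[OF N]] by (intro ennreal_mult) auto
            also have "ennreal (G (Y N n \<omega>) (Xstep N n s \<omega>)) = ennreal 4 + ennreal 2 * ennreal (1 / h (Y N n \<omega>)) + ennreal (1 / h (Xh N s \<omega>)) + ennreal ((1 + (Xh N s \<omega>)\<^sup>2) ^ k)"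
            proof -
              have "Xstep N n s \<omega> = Xh N s \<omega>" using True by (simp add: Xstep_def)
              then show ?thesis unfolding G_def by (simp only:) (rule e4[OF nn], simp)
            qed
            finally show "ennreal (A * dt N * G (Y N n \<omega>) (Xstep N n s \<omega>)) = ennreal (A * dt N) * (ennreal 4 + ennreal 2 * ennreal (1 / h (Y N n \<omega>)) + ennreal (1 / h (Xh N s \<omega>)) + ennreal ((1 + (Xh N s \<omega>)\<^sup>2) ^ k))" .
          qed
          also have "\<dots> = ennreal (A * dt N) * (ennreal 4 + ennreal 2 * (\<integral>\<^sup>+ \<omega>. ennreal (1 / h (Y N n \<omega>)) \<partial>M) + (\<integral>\<^sup>+ \<omega>. ennreal (1 / h (Xh N s \<omega>)) \<partial>M) + (\<integral>\<^sup>+ \<omega>. ennreal ((1 + (Xh N s \<omega>)\<^sup>2) ^ k) \<partial>M))"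
            by (simp add: nn_integral_add nn_integral_cmult emeasure_space_1 del: ennreal_numeral)
          also have "\<dots> \<le> ennreal (A * dt N) * (ennreal 4 + ennreal 2 * ennreal B1 + ennreal B1 + ennreal B3)"
          proof (intro mult_left_mono add_mono order_refl B1(2) B3(2) N sT)
            show "(\<integral>\<^sup>+ \<omega>. ennreal (1 / h (Y N n \<omega>)) \<partial>M) \<le> ennreal B1"
              using B1(2)[OF N tT] by (simp add: Xh_grid[OF N])
          qed auto
          also have "ennreal 4 + ennreal 2 * ennreal B1 + ennreal B1 + ennreal B3 = ennreal B"
            unfolding B_def by (rule e4[OF B1(1) B1(1) B3(1), symmetric])
          also have "ennreal (A * dt N) * ennreal B = ennreal (A * dt N * B)" using A d Bnn by (simp add: ennreal_mult)
          finally show ?thesis using True by simp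
        qed simp
      qed
      also have "\<dots> = ennreal (A * dt N * B * dt N)"
        using d A Bnn by (simp add: nn_integral_cmult_indicator tn_Suc ennreal_mult[symmetric])
      finally show ?thesis .
    qed
    have "?E N
      \<le> (\<integral>\<^sup>+ \<omega>. (\<Sum>n<N. \<integral>\<^sup>+s\<in>{tn N n<..tn N (Suc n)}. ennreal (A * dt N * G (Y N n \<omega>) (Xstep N n s \<omega>)) \<partial>lborel) \<partial>M)"
      unfolding nn_integral_Icc_eq_Ioc
    proof (intro nn_integral_mono sum_mono)
      fix \<omega> n s
      show "ennreal ((1 - exp ((s - tn N n) * (\<sigma> (Xh N (tn N n) \<omega>))\<^sup>2
                        * (h2 (Xh N (tn N n) \<omega>) / (2 * h (Xh N (tn N n) \<omega>)))))
                    * ((\<sigma> (Xh N (tn N n) \<omega>))\<^sup>2 * (h (Xh N s \<omega>) powr (- p) + Xh N s \<omega> powr m)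
                        / (bem_Hx \<sigma> h (tn N n) (Xh N (tn N n) \<omega>) s (Xh N s \<omega>))\<^sup>2)) * indicator {tn N n<..tn N (Suc n)} s
         \<le> ennreal (A * dt N * G (Y N n \<omega>) (Xstep N n s \<omega>)) * indicator {tn N n<..tn N (Suc n)} s"
      proof (cases "s \<in> {tn N n<..tn N (Suc n)}")
        case True
        then have x: "Xh N s \<omega> \<in> S" by (intro Xh_in_S[OF N, of n]) auto
        show ?thesis using True pt[OF Y_in_S[OF N] x, of "tn N n" s "dt N" n \<omega>]
          by (auto simp: Xh_grid[OF N] Xstep_def tn_Suc intro!: ennreal_leI)
      qed simp
    qed
    also have "\<dots> = (\<Sum>n<N. \<integral>\<^sup>+ \<omega>. (\<integral>\<^sup>+s\<in>{tn N n<..tn N (Suc n)}. ennreal (A * dt N * G (Y N n \<omega>) (Xstep N n s \<omega>)) \<partial>lborel) \<partial>M)"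
      by (intro nn_integral_sum swap_time(2)[OF Gm])
    also have "\<dots> \<le> (\<Sum>n<N. ennreal (A * dt N * B * dt N))" by (intro sum_mono bound) auto
    also have "\<dots> = ennreal (real N * (A * dt N * B * dt N))"
      using A d Bnn by (simp add: ennreal_of_nat_eq_real_of_nat ennreal_mult[symmetric])
    also have "real N * (A * dt N * B * dt N) = A * B * T * dt N"
    proof -
      have "real N * (A * dt N * B * dt N) = A * B * (real N * dt N) * dt N" by simp
      then show ?thesis by (simp only: dt_sum[OF N])
    qed
    also have "ennreal (A * B * T * dt N) < ennreal ((A * B * T + 1) * T / real N)"
    proof (rule ennreal_lessI)
      have "A * B * T * dt N < (A * B * T + 1) * dt N" using d by simp
      then show "A * B * T * dt N < (A * B * T + 1) * T / real N" by (simp add: dt_def)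
      have "0 \<le> A * B * T" using A Bnn T_pos by simp
      then show "0 < (A * B * T + 1) * T / real N" using T_pos N by simp
    qed
    finally show "?E N
        < ennreal ((A * B * T + 1) * T / real N)" .
  qed
qed

end

subsection \<open>Conditional moments at stopping times\<close>

text \<open>Among the suprema of countable subfamilies one maximises the weighted integral
  \<open>J\<close>. Joining a further f cannot increase it, so f lies almost surely below that
  supremum. The weight 1/(1 + B) keeps all these integrals at most 1.\<close>

lemma ess_sup_exists:
  assumes M: "prob_space M" and meas: "\<And>f. f \<in> \<Phi> \<Longrightarrow> f \<in> borel_measurable M"
    and B: "B \<in> borel_measurable M" "AE \<omega> in M. B \<omega> < \<infinity>"
    and dom: "\<And>f. f \<in> \<Phi> \<Longrightarrow> AE \<omega> in M. f \<omega> \<le> B \<omega>"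
  shows "\<exists>Z. is_ess_sup M \<Phi> Z \<and> (AE \<omega> in M. Z \<omega> < \<infinity>)"
proof -
  interpret prob_space M by (rule M)
  note [measurable] = B(1)
  define w where "w \<omega> = inverse (1 + B \<omega>)" for \<omega>
  have [measurable]: "w \<in> borel_measurable M" unfolding w_def by measurable
  have w_le: "w \<omega> * x \<le> 1" if "x \<le> B \<omega>" "B \<omega> < \<infinity>" for x \<omega>
  proof -
    have "w \<omega> * x \<le> w \<omega> * (1 + B \<omega>)" using that by (intro mult_left_mono) (auto intro: order_trans add_increasing)
    also have "\<dots> = 1" using that ennreal_divide_self[of "1 + B \<omega>"] unfolding w_def
      by (simp add: divide_ennreal_def mult.commute)
    finally show ?thesis .
  qed
  define Sup' where "Sup' A \<omega> = (SUP f\<in>A. f \<omega>)" for A :: "('a \<Rightarrow> ennreal) set" and \<omega>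
  have Sm: "Sup' A \<in> borel_measurable M" if "countable A" "A \<subseteq> \<Phi>" for A
    unfolding Sup'_def using that meas by (intro borel_measurable_SUP) auto
  have Sdom: "AE \<omega> in M. Sup' A \<omega> \<le> Z' \<omega>" if "countable A" "\<And>f. f \<in> A \<Longrightarrow> AE \<omega> in M. f \<omega> \<le> Z' \<omega>" for A and Z' :: "'a \<Rightarrow> ennreal"
  proof -
    have "AE \<omega> in M. \<forall>f\<in>A. f \<omega> \<le> Z' \<omega>" using that by (simp add: AE_ball_countable)
    then show ?thesis by eventually_elim (auto simp: Sup'_def intro: SUP_least)
  qed
  define J where "J A = (\<integral>\<^sup>+\<omega>. w \<omega> * Sup' A \<omega> \<partial>M)" for A
  define \<A> where "\<A> = {A. countable A \<and> A \<subseteq> \<Phi>}"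
  have J1: "J A \<le> 1" if "A \<in> \<A>" for A
  proof -
    have "AE \<omega> in M. Sup' A \<omega> \<le> B \<omega>" using that dom by (intro Sdom) (auto simp: \<A>_def)
    then have "AE \<omega> in M. w \<omega> * Sup' A \<omega> \<le> 1" using B(2) by eventually_elim (rule w_le)
    then have "J A \<le> (\<integral>\<^sup>+\<omega>. 1 \<partial>M)" unfolding J_def by (rule nn_integral_mono_AE)
    then show ?thesis by (simp add: emeasure_space_1)
  qed
  have "\<A> \<noteq> {}" by (auto simp: \<A>_def)
  from ennreal_SUP_countable_SUP[OF this, of J] obtain v :: "nat \<Rightarrow> ennreal"
    where v: "range v \<subseteq> J ` \<A>" "Sup (J ` \<A>) = Sup (range v)" by auto
  have "\<exists>A\<in>\<A>. J A = v i" for i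
  proof -
    have "v i \<in> J ` \<A>" using v(1) by blast
    then show ?thesis by auto
  qed
  then obtain A where A: "\<And>i. A i \<in> \<A>" "\<And>i. J (A i) = v i" by metis
  \<comment> \<open>The union of a maximising sequence of countable subfamilies is countable, so the
    supremum of \<open>J\<close> is attained.\<close>
  define A0 where "A0 = (\<Union>i. A i)"
  have A0: "A0 \<in> \<A>" using A(1) by (auto simp: A0_def \<A>_def)
  have Jmax: "J A' \<le> J A0" if "A' \<in> \<A>" for A'
  proof -
    have "J A' \<le> Sup (range v)" unfolding v(2)[symmetric] using that by (intro SUP_upper)
    also have "\<dots> \<le> J A0"
    proof (rule SUP_least)
      fix i show "v i \<le> J A0"
        unfolding A(2)[symmetric] J_def Sup'_def
        by (intro nn_integral_mono mult_left_mono SUP_subset_mono) (auto simp: A0_def)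
    qed
    finally show ?thesis .
  qed
  define Z where "Z = Sup' A0"
  have Zm[measurable]: "Z \<in> borel_measurable M" unfolding Z_def using A0 by (intro Sm) (auto simp: \<A>_def)
  have ZB: "AE \<omega> in M. Z \<omega> \<le> B \<omega>" unfolding Z_def using A0 dom by (intro Sdom) (auto simp: \<A>_def)
  have up: "AE \<omega> in M. f \<omega> \<le> Z \<omega>" if f: "f \<in> \<Phi>" for f
  proof -
    have A1: "insert f A0 \<in> \<A>" using A0 f by (auto simp: \<A>_def)
    have S1: "Sup' (insert f A0) \<omega> = sup (f \<omega>) (Z \<omega>)" for \<omega> by (simp add: Sup'_def Z_def)
    note [measurable] = meas[OF f]
    have fin: "(\<integral>\<^sup>+\<omega>. w \<omega> * Z \<omega> \<partial>M) \<noteq> \<infinity>"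
      using J1[OF A0] unfolding J_def Z_def by (auto simp: top_unique)
    have "(\<integral>\<^sup>+\<omega>. w \<omega> * sup (f \<omega>) (Z \<omega>) - w \<omega> * Z \<omega> \<partial>M) = (\<integral>\<^sup>+\<omega>. w \<omega> * sup (f \<omega>) (Z \<omega>) \<partial>M) - (\<integral>\<^sup>+\<omega>. w \<omega> * Z \<omega> \<partial>M)"
      by (rule nn_integral_diff[OF _ _ fin]) (auto intro!: AE_I2 mult_left_mono)
    also have "\<dots> = 0"
      using Jmax[OF A1] unfolding J_def S1 Z_def[symmetric] by (intro diff_eq_0_ennreal) (use fin in \<open>auto simp: less_top\<close>)
    finally have "AE \<omega> in M. w \<omega> * sup (f \<omega>) (Z \<omega>) - w \<omega> * Z \<omega> = 0"
      by (subst (asm) nn_integral_0_iff_AE) auto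
    with B(2) ZB dom[OF f] show ?thesis
    proof eventually_elim
      case (elim \<omega>)
      have w0: "w \<omega> \<noteq> 0" "w \<omega> \<noteq> top" using elim by (auto simp: w_def ennreal_inverse_eq_0_iff ennreal_inverse_eq_top_iff)
      have "w \<omega> * Z \<omega> \<noteq> top" using w_le[OF elim(2,1)] by (auto simp: top_unique)
      then have "w \<omega> * sup (f \<omega>) (Z \<omega>) \<le> w \<omega> * Z \<omega>" using elim(4) by (simp add: diff_eq_0_iff_ennreal less_top)
      then have "sup (f \<omega>) (Z \<omega>) \<le> Z \<omega>"
        using w0 by (metis ennreal_mult_le_mult_iff)
      then show ?case by simp
    qed
  qed
  have "is_ess_sup M \<Phi> Z"
    unfolding is_ess_sup_def
  proof (intro conjI ballI impI Zm up)
    fix Z' :: "'a \<Rightarrow> ennreal" assume "\<forall>f\<in>\<Phi>. AE \<omega> in M. f \<omega> \<le> Z' \<omega>"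
    then show "AE \<omega> in M. Z \<omega> \<le> Z' \<omega>"
      unfolding Z_def using A0 by (intro Sdom) (auto simp: \<A>_def)
  qed
  moreover have "AE \<omega> in M. Z \<omega> < \<infinity>" using ZB B(2) by eventually_elim (rule le_less_trans)
  ultimately show ?thesis by blast
qed

text \<open>For Brownian increments \<open>f\<close>, a suitable \<open>Sm\<close> is a weighted sum of the powers of all dyadic
  increments; its expectation is explicit, so no maximal inequality is needed.\<close>

lemma dyadic_chaining:
  fixes f :: "real \<Rightarrow> real" and k :: nat
  assumes k: "0 < k" and D: "0 < D" and cont: "continuous_on {0..} f" and f0: "f 0 = 0"
    and Sn: "0 \<le> Sm" and S: "\<And>j i. i < 2 ^ j \<Longrightarrow> (f (real (Suc i) * D / 2 ^ j) - f (real i * D / 2 ^ j)) ^ (2 * k) \<le> Sm * (1 / 2) ^ j"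
    and d: "0 < d" "d < D"
  defines "\<rho> \<equiv> root (2 * k) (1 / 2)"
  shows "f d ^ (2 * k) \<le> 2 / (D * (1 - \<rho>) ^ (2 * k)) * Sm * d"
proof -
  define p where "p = 2 * k"
  have p: "0 < p" "even p" using k by (auto simp: p_def)
  \<comment> \<open>The 2k-th root of the bound \<open>Sm * (1 / 2) ^ j\<close> decays geometrically
    with ratio \<rho> < 1, so the increments along the chain can be summed.\<close>
  have \<rho>p: "\<rho> ^ p = 1 / 2" unfolding \<rho>_def p_def using k by (intro real_root_pow_pos2) auto
  have \<rho>: "0 < \<rho>" "\<rho> < 1" using k by (auto simp: \<rho>_def real_root_lt_1_iff)
  define s where "s = root p Sm"
  have s: "0 \<le> s" "s ^ p = Sm" using p Sn by (auto simp: s_def real_root_pow_pos2)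
  \<comment> \<open>The largest multiple of D/2^j not above d; consecutive approximations agree or
    differ by one increment of level j + 1.\<close>
  define x where "x j = real (nat \<lfloor>2 ^ j * d / D\<rfloor>) * D / 2 ^ j" for j
  have step: "\<bar>f (x (Suc j)) - f (x j)\<bar> \<le> s * \<rho> ^ Suc j" for j
  proof -
    define y where "y = 2 ^ j * d / D"
    define i where "i = nat \<lfloor>y\<rfloor>"
    have y0: "0 \<le> y" using d D by (simp add: y_def)
    have ri: "real i = real_of_int \<lfloor>y\<rfloor>" using y0 by (simp add: i_def)
    have i: "real i \<le> y" "y < real i + 1" unfolding ri by linarith+
    have y2: "2 ^ Suc j * d / D = 2 * y" by (simp add: y_def)
    have yj: "y < 2 ^ j" using d D by (simp add: y_def field_simps)
    have xj: "x j = real (2 * i) * D / 2 ^ Suc j" by (simp add: x_def i_def y_def)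
    have "nat \<lfloor>2 * y\<rfloor> = 2 * i \<or> nat \<lfloor>2 * y\<rfloor> = 2 * i + 1"
    proof -
      have "\<lfloor>2 * y\<rfloor> = int (2 * i) \<or> \<lfloor>2 * y\<rfloor> = int (2 * i + 1)" using i by linarith
      then show ?thesis by auto
    qed
    then show ?thesis
    proof
      assume "nat \<lfloor>2 * y\<rfloor> = 2 * i"
      then have "x (Suc j) = x j" unfolding xj by (simp only: x_def y2)
      then show ?thesis using s \<rho> by simp
    next
      assume "nat \<lfloor>2 * y\<rfloor> = 2 * i + 1"
      then have xs: "x (Suc j) = real (Suc (2 * i)) * D / 2 ^ Suc j" by (simp only: x_def y2) simp
      have "real i < 2 ^ j" using i yj by linarith
      then have "i < 2 ^ j" by (metis of_nat_less_numeral_power_cancel_iff)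
      then have "2 * i < 2 ^ Suc j" by simp
      from S[OF this] have "(f (x (Suc j)) - f (x j)) ^ p \<le> Sm * (1 / 2) ^ Suc j"
        unfolding xs xj p_def .
      also have "\<dots> = (s * \<rho> ^ Suc j) ^ p"
        unfolding s(2)[symmetric] \<rho>p[symmetric] by (simp only: power_mult_distrib power_mult[symmetric] mult.commute)
      finally have "\<bar>f (x (Suc j)) - f (x j)\<bar> ^ p \<le> (s * \<rho> ^ Suc j) ^ p" using p by (simp add: power_even_abs)
      then show ?thesis using p s \<rho> by (subst (asm) power_mono_iff) auto
    qed
  qed
  obtain M where M: "1 \<le> 2 ^ M * d / D"
  proof -
    obtain n where "D / d < 2 ^ n" using real_arch_pow[of 2 "D / d"] by auto
    then show ?thesis using that[of n] d D by (simp add: field_simps)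
  qed
  \<comment> \<open>The first level whose mesh is at most d. One level before, the approximation is
    still 0, so the chain starts at f 0 = 0, and (1/2)^m <= 2 d/D supplies the factor d.\<close>
  define m' where "m' = (LEAST n. 1 \<le> 2 ^ n * d / D)"
  have m': "1 \<le> 2 ^ m' * d / D" unfolding m'_def using M by (rule LeastI[of "\<lambda>n. 1 \<le> 2 ^ n * d / D" M])
  have "m' \<noteq> 0" using m' d D by (intro notI) (simp add: field_simps)
  then obtain m where m: "m' = Suc m" using not0_implies_Suc by blast
  have "\<not> 1 \<le> 2 ^ m * d / D" using not_less_Least[of m "\<lambda>n. 1 \<le> 2 ^ n * d / D"] m by (simp add: m'_def)
  then have "x m = 0" using d D by (simp add: x_def floor_eq_iff)
  have b: "\<bar>f (x (m + l))\<bar> \<le> s * \<rho> ^ m * (\<Sum>i<l. \<rho> ^ Suc i)" for l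
  proof (induction l)
    case 0 then show ?case by (simp add: \<open>x m = 0\<close> f0)
  next
    case (Suc l)
    have "\<bar>f (x (m + Suc l))\<bar> \<le> \<bar>f (x (m + l))\<bar> + s * \<rho> ^ Suc (m + l)" using step[of "m + l"] by simp
    also have "\<dots> \<le> s * \<rho> ^ m * (\<Sum>i<l. \<rho> ^ Suc i) + s * \<rho> ^ m * \<rho> ^ Suc l" using Suc by (simp add: power_add mult_ac)
    finally show ?case by (simp add: distrib_left)
  qed
  have bb: "\<bar>f (x (m + l))\<bar> \<le> s * \<rho> ^ m * (1 / (1 - \<rho>))" for l
  proof -
    have "(\<Sum>i<l. \<rho> ^ Suc i) \<le> (\<Sum>i<l. \<rho> ^ i)" using \<rho> by (intro sum_mono) (simp add: mult_left_le_one_le)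
    also have "\<dots> = (1 - \<rho> ^ l) / (1 - \<rho>)" using \<rho> by (simp add: sum_gp_strict)
    also have "\<dots> \<le> 1 / (1 - \<rho>)" using \<rho> by (intro divide_right_mono) auto
    finally show ?thesis using s \<rho> by (intro order_trans[OF b] mult_left_mono) auto
  qed
  have x0: "0 \<le> x j" for j using D by (simp add: x_def)
  have "(\<lambda>l. x (m + l)) \<longlonglongrightarrow> d"
  proof (rule real_tendsto_sandwich)
    have xb: "d - D * (1 / 2) ^ j \<le> x j" "x j \<le> d" for j
    proof -
      define y where "y = 2 ^ j * d / D"
      have y: "real (nat \<lfloor>y\<rfloor>) \<le> y" "y - 1 \<le> real (nat \<lfloor>y\<rfloor>)" using d D by (auto simp: y_def)
      have yD: "y * D / 2 ^ j = d" using D by (simp add: y_def)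
      have "x j = real (nat \<lfloor>y\<rfloor>) * D / 2 ^ j" by (simp add: x_def y_def)
      moreover have "real (nat \<lfloor>y\<rfloor>) * D / 2 ^ j \<le> y * D / 2 ^ j" using y D by (intro divide_right_mono mult_right_mono) auto
      moreover have "(y - 1) * D / 2 ^ j \<le> real (nat \<lfloor>y\<rfloor>) * D / 2 ^ j" using y D by (intro divide_right_mono mult_right_mono) auto
      moreover have "(y - 1) * D / 2 ^ j = y * D / 2 ^ j - D * (1 / 2) ^ j" by (simp add: field_simps power_divide)
      ultimately show "d - D * (1 / 2) ^ j \<le> x j" "x j \<le> d" using yD by auto
    qed
    show "\<forall>\<^sub>F l in sequentially. d - D * (1 / 2) ^ (m + l) \<le> x (m + l)" "\<forall>\<^sub>F l in sequentially. x (m + l) \<le> d"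
      using xb by auto
    have "(\<lambda>l. (1 / 2 :: real) ^ (m + l)) \<longlonglongrightarrow> 0"
      using LIMSEQ_ignore_initial_segment[OF LIMSEQ_realpow_zero[of "1 / 2"], of m] by (simp add: add.commute)
    then have "(\<lambda>l. d - D * (1 / 2) ^ (m + l)) \<longlonglongrightarrow> d - D * 0" by (intro tendsto_intros)
    then show "(\<lambda>l. d - D * (1 / 2) ^ (m + l)) \<longlonglongrightarrow> d" by simp
  qed simp
  from continuous_on_tendsto_compose[OF cont this] have "(\<lambda>l. f (x (m + l))) \<longlonglongrightarrow> f d" using d x0 by simp
  then have "(\<lambda>l. \<bar>f (x (m + l))\<bar>) \<longlonglongrightarrow> \<bar>f d\<bar>" by (rule tendsto_rabs)
  then have "\<bar>f d\<bar> \<le> s * \<rho> ^ m * (1 / (1 - \<rho>))" by (rule LIMSEQ_le_const2) (use bb in auto)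
  then have "\<bar>f d\<bar> ^ p \<le> (s * \<rho> ^ m * (1 / (1 - \<rho>))) ^ p" by (intro power_mono) auto
  also have "\<dots> = Sm * (1 / 2) ^ m * (1 / (1 - \<rho>) ^ p)"
    unfolding s(2)[symmetric] \<rho>p[symmetric] by (simp add: power_mult_distrib power_divide power_mult[symmetric] mult.commute)
  also have "\<dots> \<le> Sm * (2 * d / D) * (1 / (1 - \<rho>) ^ p)"
  proof (intro mult_right_mono mult_left_mono)
    show "(1 / 2) ^ m \<le> 2 * d / D" using m' d D unfolding m by (simp add: field_simps power_divide)
  qed (use Sn \<rho> in auto)
  finally show ?thesis using p by (simp add: p_def power_even_abs field_simps)
qed

context bem_scheme
begin

lemma increment_moment:
  assumes s: "0 \<le> s" "s < t"
  shows "(\<integral>\<^sup>+\<omega>. ennreal ((W t \<omega> - W s \<omega>) ^ (2 * k)) \<partial>M) = ennreal ((t - s) ^ k * (\<integral>\<xi>. \<xi> ^ (2 * k) \<partial>N01))"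
proof -
  define f where "f x = ennreal (snd x ^ (2 * k))" for x :: "real \<times> real"
  have f: "f \<in> borel_measurable (borel \<Otimes>\<^sub>M borel)" unfolding f_def by measurable
  have Z: "(\<lambda>\<omega>. 0 :: real) \<in> borel_measurable (F s)" by simp
  have "(\<integral>\<^sup>+\<omega>. ennreal ((W t \<omega> - W s \<omega>) ^ (2 * k)) \<partial>M) = (\<integral>\<^sup>+\<omega>. (\<integral>\<^sup>+\<xi>. ennreal ((sqrt (t - s) * \<xi>) ^ (2 * k)) \<partial>N01) \<partial>M)"
    using brownian_increment_integral[OF filt bm s Z f] by (simp add: f_def)
  also have "\<dots> = (\<integral>\<^sup>+\<xi>. ennreal ((t - s) ^ k * \<xi> ^ (2 * k)) \<partial>N01)"
    using s by (simp add: emeasure_space_1 power_mult_distrib power_mult)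
  also have "\<dots> = ennreal (\<integral>\<xi>. (t - s) ^ k * \<xi> ^ (2 * k) \<partial>N01)"
    using s by (intro nn_integral_eq_integral integrable_mult_right integrable_std_normal_distribution_moment) (auto simp: power_mult)
  also have "(\<integral>\<xi>. (t - s) ^ k * \<xi> ^ (2 * k) \<partial>N01) = (t - s) ^ k * (\<integral>\<xi>. \<xi> ^ (2 * k) \<partial>N01)" by simp
  finally show ?thesis .
qed

text \<open>\<open>V\<close> weights the powers of all level-j increments by 2^j, so each is at most
  V/2^j, as \<open>dyadic_chaining\<close> requires. Its mean is a multiple of the sum over j of 4^j
  (D/2^j)^k, which converges for k >= 3.\<close>

lemma increment_modulus:
  assumes k: "3 \<le> k" and a: "0 \<le> a" and \<delta>: "0 < \<delta>"
  obtains Kf where "Kf \<in> borel_measurable M" "(\<integral>\<^sup>+\<omega>. Kf \<omega> \<partial>M) < \<infinity>"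
    "\<And>\<omega> d. \<omega> \<in> space M \<Longrightarrow> 0 < d \<Longrightarrow> d \<le> \<delta> \<Longrightarrow> ennreal ((W (a + d) \<omega> - W a \<omega>) ^ (2 * k)) \<le> Kf \<omega> * ennreal d"
proof -
  \<comment> \<open>Chaining needs d < D, and d = \<delta> has to be covered.\<close>
  define D where "D = 2 * \<delta>"
  have D: "0 < D" using \<delta> by (simp add: D_def)
  define \<Delta> where "\<Delta> j i \<omega> = (W (a + real (Suc i) * D / 2 ^ j) \<omega> - W (a + real i * D / 2 ^ j) \<omega>) ^ (2 * k)" for j i \<omega>
  have t0: "0 \<le> a + real i * D / 2 ^ j" for i j using a D by simp
  have [measurable]: "\<Delta> j i \<in> borel_measurable M" for j i
    unfolding \<Delta>_def[abs_def] using W_measurable[OF t0[of "Suc i" j]] W_measurable[OF t0[of i j]] by measurable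
  define V where "V \<omega> = (\<Sum>j. ennreal (2 ^ j) * (\<Sum>i<2^j. ennreal (\<Delta> j i \<omega>)))" for \<omega>
  have [measurable]: "V \<in> borel_measurable M" unfolding V_def[abs_def] by measurable
  define c where "c = (\<integral>\<xi>. \<xi> ^ (2 * k) \<partial>N01)"
  have c: "0 \<le> c" unfolding c_def by (intro integral_nonneg_AE AE_I2) (simp add: power_mult)
  have E\<Delta>: "(\<integral>\<^sup>+\<omega>. ennreal (\<Delta> j i \<omega>) \<partial>M) = ennreal ((D / 2 ^ j) ^ k * c)" for j i
  proof -
    have lt: "a + real i * D / 2 ^ j < a + real (Suc i) * D / 2 ^ j" using D by (simp add: divide_strict_right_mono)
    have "a + real (Suc i) * D / 2 ^ j - (a + real i * D / 2 ^ j) = D / 2 ^ j" by (simp add: field_simps)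
    then show ?thesis using increment_moment[OF t0 lt, of k] by (simp add: \<Delta>_def c_def)
  qed
  have "(\<integral>\<^sup>+\<omega>. V \<omega> \<partial>M) = (\<Sum>j. \<integral>\<^sup>+\<omega>. ennreal (2 ^ j) * (\<Sum>i<2^j. ennreal (\<Delta> j i \<omega>)) \<partial>M)"
    unfolding V_def by (rule nn_integral_suminf) measurable
  also have "\<dots> = (\<Sum>j. ennreal (2 ^ j) * (\<Sum>i<(2::nat)^j. ennreal ((D / 2 ^ j) ^ k * c)))"
    by (intro suminf_cong) (simp add: nn_integral_cmult nn_integral_sum E\<Delta>)
  also have "\<dots> \<le> (\<Sum>j. ennreal (D ^ k * c * (1 / 2) ^ j))"
  proof (intro suminf_le allI)
    fix j
    have "ennreal (2 ^ j) * (\<Sum>i<(2::nat)^j. ennreal ((D / 2 ^ j) ^ k * c)) = ennreal (2 ^ j * (2 ^ j * ((D / 2 ^ j) ^ k * c)))"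
      using D c by (simp add: ennreal_mult ennreal_of_nat_eq_real_of_nat)
    also have "\<dots> \<le> ennreal (D ^ k * c * (1 / 2) ^ j)"
    proof (rule ennreal_leI)
      have "(2::real) ^ j * 2 ^ j * 2 ^ j = (2 ^ j) ^ 3" by (simp add: power3_eq_cube)
      also have "\<dots> \<le> (2 ^ j) ^ k" using k by (intro power_increasing) auto
      finally have "2 ^ j * 2 ^ j * 2 ^ j / (2 ^ j) ^ k \<le> (1::real)" by (simp add: divide_le_eq_1)
      then have "D ^ k * c * (2 ^ j * 2 ^ j * 2 ^ j / (2 ^ j) ^ k) * (1 / 2) ^ j \<le> D ^ k * c * 1 * (1 / 2) ^ j"
        using D c by (intro mult_right_mono mult_left_mono) auto
      then show "2 ^ j * (2 ^ j * ((D / 2 ^ j) ^ k * c)) \<le> D ^ k * c * (1 / 2) ^ j"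
        by (simp add: power_divide field_simps)
    qed
    finally show "ennreal (2 ^ j) * (\<Sum>i<(2::nat)^j. ennreal ((D / 2 ^ j) ^ k * c)) \<le> ennreal (D ^ k * c * (1 / 2) ^ j)" .
  qed auto
  also have "\<dots> < \<infinity>"
  proof -
    have "summable (\<lambda>j. D ^ k * c * (1 / 2) ^ j)" by (intro summable_mult summable_geometric) simp
    then show ?thesis using D c by (subst suminf_ennreal2) auto
  qed
  finally have EV: "(\<integral>\<^sup>+\<omega>. V \<omega> \<partial>M) < \<infinity>" .
  define \<rho> where "\<rho> = root (2 * k) (1 / 2)"
  define C2 where "C2 = 2 / (D * (1 - \<rho>) ^ (2 * k))"
  have \<rho>: "\<rho> < 1" using k by (simp add: \<rho>_def real_root_lt_1_iff)
  have C2: "0 < C2" using D \<rho> by (simp add: C2_def)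
  show ?thesis
  proof (rule that[of "\<lambda>\<omega>. ennreal C2 * V \<omega>"])
    show "(\<lambda>\<omega>. ennreal C2 * V \<omega>) \<in> borel_measurable M" by measurable
    show "(\<integral>\<^sup>+\<omega>. ennreal C2 * V \<omega> \<partial>M) < \<infinity>" using EV by (simp add: nn_integral_cmult ennreal_mult_less_top)
    fix \<omega> d assume \<omega>: "\<omega> \<in> space M" and d: "0 < d" "d \<le> \<delta>"
    show "ennreal ((W (a + d) \<omega> - W a \<omega>) ^ (2 * k)) \<le> ennreal C2 * V \<omega> * ennreal d"
    proof (cases "V \<omega> = top")
      case True
      then show ?thesis using C2 d by (simp add: ennreal_mult_top ennreal_top_mult)
    next
      case False
      define v where "v = enn2real (V \<omega>)"
      have v: "V \<omega> = ennreal v" "0 \<le> v" using False by (auto simp: v_def less_top)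
      define f where "f x = W (a + x) \<omega> - W a \<omega>" for x
      have "f d ^ (2 * k) \<le> C2 * v * d"
        unfolding C2_def \<rho>_def
      proof (rule dyadic_chaining)
        show "continuous_on {0..} f"
        proof -
          have cW: "continuous_on {0..} (\<lambda>t. W t \<omega>)" using bm \<omega> by (simp add: brownian_motion_def)
          have ca: "continuous_on {0..} (\<lambda>x. a + x)" by (intro continuous_intros)
          have "continuous_on {0..} (\<lambda>x. W (a + x) \<omega>)"
            by (rule continuous_on_compose2[OF cW ca]) (use a in auto)
          then show ?thesis unfolding f_def by (rule continuous_on_diff) (rule continuous_on_const)
        qed
        fix j i :: nat assume i: "i < 2 ^ j"
        have "ennreal (2 ^ j * \<Delta> j i \<omega>) = ennreal (2 ^ j) * ennreal (\<Delta> j i \<omega>)" by (simp add: ennreal_mult \<Delta>_def power_mult)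
        also have "\<dots> \<le> ennreal (2 ^ j) * (\<Sum>i<2^j. ennreal (\<Delta> j i \<omega>))"
          using i by (intro mult_left_mono member_le_sum) auto
        also have "\<dots> \<le> V \<omega>" unfolding V_def
          using sum_le_suminf[of "\<lambda>j. ennreal (2 ^ j) * (\<Sum>i<2^j. ennreal (\<Delta> j i \<omega>))" "{j}"] by auto
        finally have "2 ^ j * \<Delta> j i \<omega> \<le> v" unfolding v(1) using v(2) by (simp add: ennreal_le_iff)
        then have "\<Delta> j i \<omega> \<le> v * (1 / 2) ^ j" by (simp add: power_divide field_simps)
        then show "(f (real (Suc i) * D / 2 ^ j) - f (real i * D / 2 ^ j)) ^ (2 * k) \<le> v * (1 / 2) ^ j"
          by (simp add: \<Delta>_def f_def)
      qed (use k D v d \<delta> in \<open>auto simp: f_def D_def\<close>)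
      then have "ennreal (f d ^ (2 * k)) \<le> ennreal (C2 * v * d)" by (rule ennreal_leI)
      also have "\<dots> = ennreal C2 * V \<omega> * ennreal d" using C2 v d by (simp add: ennreal_mult)
      finally show ?thesis by (simp add: f_def)
    qed
  qed
qed

text \<open>Valid for all t of the step at once, hence at random times. Apart from \<open>K3\<close>
  and \<open>Kk\<close>, everything on the right is determined by \<open>Y N n\<close> and so is
  known at t_n. At t = t_n itself no implicit step is solved, hence the case distinction.\<close>

lemma Xh_pathwise:
  assumes N: "0 < N" and k: "3 \<le> k" "m \<le> k" and \<omega>: "\<omega> \<in> space M" and t: "tn N n \<le> t" "t \<le> tn N (Suc n)"
    and K3: "\<And>d. 0 < d \<Longrightarrow> d \<le> dt N \<Longrightarrow> ennreal ((W (tn N n + d) \<omega> - W (tn N n) \<omega>) ^ (2 * 3)) \<le> K3 * ennreal d"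
    and Kk: "\<And>d. 0 < d \<Longrightarrow> d \<le> dt N \<Longrightarrow> ennreal ((W (tn N n + d) \<omega> - W (tn N n) \<omega>) ^ (2 * k)) \<le> Kk * ennreal d"
  defines "z \<equiv> Y N n \<omega>"
  shows "ennreal (1 / h (Xh N t \<omega>) + Xh N t \<omega> ^ m)
    \<le> ennreal (2 / h z + 2 ^ k * (1 + 2 * z\<^sup>2 + 2 * (\<sigma>' z)\<^sup>2 * dt N) ^ k)
      + ennreal ((2 * L * \<sigma>' z / h z)^4 / (2 * h z)) * K3 + ennreal (2 ^ k * (2 * (\<sigma>' z)\<^sup>2) ^ k * dt N) * Kk"
proof -
  have z: "z \<in> S" unfolding z_def by (rule Y_in_S[OF N])
  have hz: "0 < h z" by (rule h_pos[OF z])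
  note dp = dt_pos[OF N]
  define c where "c = \<sigma>' z"
  have c: "0 < c" by (simp add: c_def \<sigma>'_pos)
  define A1 where "A1 = 1 + 2 * z\<^sup>2 + 2 * c\<^sup>2 * dt N"
  have A1: "1 \<le> A1" using dp by (simp add: A1_def)
  define x where "x = Xh N t \<omega>"
  have x: "x \<in> S" unfolding x_def by (rule Xh_in_S[OF N t])
  have x0: "0 < x" by (rule state_pos[OF x])
  have xm: "x ^ m \<le> (1 + x\<^sup>2) ^ k"
  proof -
    have "x \<le> 1 + x\<^sup>2" using zero_le_power2[of "x - 1"] x0 by (simp add: power2_diff)
    then have "x ^ m \<le> (1 + x\<^sup>2) ^ m" using x0 by (intro power_mono) auto
    also have "\<dots> \<le> (1 + x\<^sup>2) ^ k" using k by (intro power_increasing) auto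
    finally show ?thesis .
  qed
  show ?thesis
  proof (cases "t = tn N n")
    case True
    then have xz: "x = z" by (simp add: x_def z_def Xh_grid[OF N])
    have "1 + z\<^sup>2 \<le> A1" using dp by (simp add: A1_def)
    then have "(1 + z\<^sup>2) ^ k \<le> A1 ^ k" by (intro power_mono) auto
    also have "\<dots> \<le> 2 ^ k * A1 ^ k" using A1 by simp
    finally have "1 / h x + x ^ m \<le> 2 / h z + 2 ^ k * A1 ^ k"
      using xm hz unfolding xz by (intro add_mono divide_right_mono) auto
    then have "ennreal (1 / h x + x ^ m) \<le> ennreal (2 / h z + 2 ^ k * A1 ^ k)" by (rule ennreal_leI)
    then show ?thesis unfolding x_def A1_def c_def by (simp add: add_increasing2 add.assoc)
  next
    case False
    define d where "d = t - tn N n"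
    have d: "0 < d" "d \<le> dt N" using False t by (auto simp: d_def tn_Suc)
    define w where "w = W t \<omega> - W (tn N n) \<omega>"
    have td: "tn N n + d = t" by (simp add: d_def)
    have xs: "x = stp c z w d" unfolding x_def c_def z_def w_def d_def using False t by (intro Xh_eq[OF N]) auto
    have w3: "ennreal (w ^ 6 / d) \<le> K3"
    proof -
      have "ennreal (w ^ 6) \<le> K3 * ennreal d" using K3[OF d] by (simp add: td w_def)
      then have "ennreal (w ^ 6) / ennreal d \<le> K3 * ennreal d / ennreal d" by (rule divide_right_mono_ennreal)
      also have "\<dots> = K3" using d by (subst ennreal_times_divide[symmetric]) (simp add: ennreal_divide_self)
      finally show ?thesis using d by (simp add: divide_ennreal)
    qed
    have wk: "ennreal (w ^ (2 * k)) \<le> Kk * ennreal (dt N)"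
    proof -
      have "ennreal (w ^ (2 * k)) \<le> Kk * ennreal d" using Kk[OF d] by (simp add: td w_def)
      also have "\<dots> \<le> Kk * ennreal (dt N)" by (intro mult_left_mono ennreal_leI d) simp
      finally show ?thesis .
    qed
    have h1: "1 / h x \<le> 2 / h z + (2 * L * c / h z)^4 / (2 * h z) * (w ^ 6 / d)"
      unfolding xs by (rule inverse_h_stp_le[OF c d(1) z])
    have "x\<^sup>2 \<le> (z + c * w)\<^sup>2 + 2 * c\<^sup>2 * d" unfolding xs by (rule stp_square[OF c d(1)])
    also have "(z + c * w)\<^sup>2 \<le> 2 * z\<^sup>2 + 2 * c\<^sup>2 * w\<^sup>2"
      using zero_le_power2[of "z - c * w"] by (simp add: power2_sum power2_diff power_mult_distrib)
    also have "2 * c\<^sup>2 * d \<le> 2 * c\<^sup>2 * dt N" using d by (intro mult_left_mono) auto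
    finally have "1 + x\<^sup>2 \<le> A1 + 2 * c\<^sup>2 * w\<^sup>2" by (simp add: A1_def)
    also have "\<dots> \<le> 2 * max A1 (2 * c\<^sup>2 * w\<^sup>2)" by simp
    finally have "(1 + x\<^sup>2) ^ k \<le> (2 * max A1 (2 * c\<^sup>2 * w\<^sup>2)) ^ k" by (intro power_mono) auto
    also have "\<dots> \<le> 2 ^ k * (A1 ^ k + (2 * c\<^sup>2 * w\<^sup>2) ^ k)"
      unfolding power_mult_distrib[of 2 "max A1 (2 * c\<^sup>2 * w\<^sup>2)"] using A1 by (intro mult_left_mono) (auto simp: max_def)
    also have "\<dots> = 2 ^ k * A1 ^ k + 2 ^ k * (2 * c\<^sup>2) ^ k * w ^ (2 * k)"
      by (simp add: distrib_left power_mult_distrib power_mult)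
    finally have "1 / h x + x ^ m \<le> (2 / h z + 2 ^ k * A1 ^ k) + (2 * L * c / h z)^4 / (2 * h z) * (w ^ 6 / d) + 2 ^ k * (2 * c\<^sup>2) ^ k * w ^ (2 * k)"
      using h1 xm by linarith
    then have "ennreal (1 / h x + x ^ m) \<le> ennreal ((2 / h z + 2 ^ k * A1 ^ k) + (2 * L * c / h z)^4 / (2 * h z) * (w ^ 6 / d) + 2 ^ k * (2 * c\<^sup>2) ^ k * w ^ (2 * k))"
      by (rule ennreal_leI)
    also have "\<dots> = ennreal (2 / h z + 2 ^ k * A1 ^ k) + ennreal ((2 * L * c / h z)^4 / (2 * h z) * (w ^ 6 / d)) + ennreal (2 ^ k * (2 * c\<^sup>2) ^ k * w ^ (2 * k))"
    proof -
      have "0 \<le> 2 / h z + 2 ^ k * A1 ^ k" "0 \<le> (2 * L * c / h z)^4 / (2 * h z) * (w ^ 6 / d)" "0 \<le> 2 ^ k * (2 * c\<^sup>2) ^ k * w ^ (2 * k)"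
        using A1 hz d by (auto simp: power_mult intro!: add_nonneg_nonneg mult_nonneg_nonneg divide_nonneg_nonneg)
      then show ?thesis by (simp only: ennreal_plus add_nonneg_nonneg)
    qed
    also have "ennreal ((2 * L * c / h z)^4 / (2 * h z) * (w ^ 6 / d)) = ennreal ((2 * L * c / h z)^4 / (2 * h z)) * ennreal (w ^ 6 / d)"
      using hz d by (intro ennreal_mult) auto
    also have "\<dots> \<le> ennreal ((2 * L * c / h z)^4 / (2 * h z)) * K3" by (intro mult_left_mono w3) simp
    also have "ennreal (2 ^ k * (2 * c\<^sup>2) ^ k * w ^ (2 * k)) = ennreal (2 ^ k * (2 * c\<^sup>2) ^ k) * ennreal (w ^ (2 * k))"
      by (intro ennreal_mult) (auto simp: power_mult)
    also have "\<dots> \<le> ennreal (2 ^ k * (2 * c\<^sup>2) ^ k) * (Kk * ennreal (dt N))" by (intro mult_left_mono wk) simp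
    also have "\<dots> = ennreal (2 ^ k * (2 * c\<^sup>2) ^ k * dt N) * Kk"
      using dp by (subst ennreal_mult) (auto simp: mult_ac)
    finally show ?thesis unfolding x_def A1_def c_def
      by (simp add: add_left_mono add_right_mono)
  qed
qed

text \<open>All candidates are dominated by the conditional expectation of one variable
  \<open>R\<close>. Its coefficients are measurable at t_n and can be taken out, so integrability of
  \<open>K3\<close> and \<open>Kk\<close> makes the bound finite almost surely.\<close>

lemma bem_conditional_moments_finite:
  assumes N: "2 \<le> N"
  shows "\<exists>Z. is_ess_sup M
        {nn_cond_exp M (F (tn N n)) (\<lambda>\<omega>. ennreal (1 / h (Xh N (\<tau> \<omega>) \<omega>) + Xh N (\<tau> \<omega>) \<omega> ^ m))
         | \<tau>. \<tau> \<in> interval_stopping_times M F (tn N n) (tn N (Suc n))} Z \<and> (AE \<omega> in M. Z \<omega> < \<infinity>)"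
proof -
  have N0: "0 < N" using N by simp
  define k where "k = max 3 m"
  have k: "3 \<le> k" "m \<le> k" by (auto simp: k_def)
  define G where "G = F (tn N n)"
  interpret finite_measure_subalgebra M G
    by unfold_locales (simp add: G_def sub_F)
  obtain K3 where K3m[measurable]: "K3 \<in> borel_measurable M" and K3f: "(\<integral>\<^sup>+\<omega>. K3 \<omega> \<partial>M) < \<infinity>" and
    K3: "\<And>\<omega> d. \<omega> \<in> space M \<Longrightarrow> 0 < d \<Longrightarrow> d \<le> dt N \<Longrightarrow> ennreal ((W (tn N n + d) \<omega> - W (tn N n) \<omega>) ^ (2 * 3)) \<le> K3 \<omega> * ennreal d"
    by (rule increment_modulus[OF order_refl tn_nonneg dt_pos[OF N0]]) blast
  obtain Kk where Kkm[measurable]: "Kk \<in> borel_measurable M" and Kkf: "(\<integral>\<^sup>+\<omega>. Kk \<omega> \<partial>M) < \<infinity>" and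
    Kk: "\<And>\<omega> d. \<omega> \<in> space M \<Longrightarrow> 0 < d \<Longrightarrow> d \<le> dt N \<Longrightarrow> ennreal ((W (tn N n + d) \<omega> - W (tn N n) \<omega>) ^ (2 * k)) \<le> Kk \<omega> * ennreal d"
    by (rule increment_modulus[OF k(1) tn_nonneg dt_pos[OF N0]]) blast
  define z where "z \<omega> = Y N n \<omega>" for \<omega>
  have zG[measurable]: "z \<in> borel_measurable G" unfolding z_def[abs_def] G_def by (rule Y_adapted[OF N0])
  have zS: "z \<omega> \<in> S" for \<omega> unfolding z_def by (rule Y_in_S[OF N0])
  have [measurable]: "(\<lambda>\<omega>. h (z \<omega>)) \<in> borel_measurable G" by (rule measurable_on_S[OF continuous_h zG zS])
  define A where "A \<omega> = ennreal (2 / h (z \<omega>) + 2 ^ k * (1 + 2 * (z \<omega>)\<^sup>2 + 2 * (\<sigma>' (z \<omega>))\<^sup>2 * dt N) ^ k)" for \<omega>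
  define B1 where "B1 \<omega> = ennreal ((2 * L * \<sigma>' (z \<omega>) / h (z \<omega>))^4 / (2 * h (z \<omega>)))" for \<omega>
  define B2 where "B2 \<omega> = ennreal (2 ^ k * (2 * (\<sigma>' (z \<omega>))\<^sup>2) ^ k * dt N)" for \<omega>
  have ABG[measurable]: "A \<in> borel_measurable G" "B1 \<in> borel_measurable G" "B2 \<in> borel_measurable G"
    unfolding A_def[abs_def] B1_def[abs_def] B2_def[abs_def] by measurable
  have [measurable]: "A \<in> borel_measurable M" "B1 \<in> borel_measurable M" "B2 \<in> borel_measurable M"
    using ABG by (auto intro: measurable_from_subalg[OF subalg])
  define R where "R \<omega> = A \<omega> + B1 \<omega> * K3 \<omega> + B2 \<omega> * Kk \<omega>" for \<omega>
  have [measurable]: "R \<in> borel_measurable M" unfolding R_def[abs_def] by measurable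
  define Bd where "Bd = nn_cond_exp M G R"
  have fin: "AE \<omega> in M. nn_cond_exp M G f \<omega> < \<infinity>" if [measurable]: "f \<in> borel_measurable M" and "(\<integral>\<^sup>+\<omega>. f \<omega> \<partial>M) < \<infinity>" for f
  proof -
    have "(\<integral>\<^sup>+\<omega>. nn_cond_exp M G f \<omega> \<partial>M) = (\<integral>\<^sup>+\<omega>. f \<omega> \<partial>M)"
      using nn_cond_exp_intg[of "\<lambda>_. 1" f] by simp
    then have "AE \<omega> in M. nn_cond_exp M G f \<omega> \<noteq> \<infinity>"
      using that by (intro nn_integral_PInf_AE) auto
    then show ?thesis by eventually_elim (simp add: less_top)
  qed
  have Bdfin: "AE \<omega> in M. Bd \<omega> < \<infinity>"
  proof -
    have "AE \<omega> in M. nn_cond_exp M G (\<lambda>\<omega>. A \<omega> + B1 \<omega> * K3 \<omega>) \<omega> + nn_cond_exp M G (\<lambda>\<omega>. B2 \<omega> * Kk \<omega>) \<omega> = Bd \<omega>"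
      unfolding Bd_def R_def[abs_def] by (rule nn_cond_exp_sum) measurable
    moreover have "AE \<omega> in M. nn_cond_exp M G A \<omega> + nn_cond_exp M G (\<lambda>\<omega>. B1 \<omega> * K3 \<omega>) \<omega> = nn_cond_exp M G (\<lambda>\<omega>. A \<omega> + B1 \<omega> * K3 \<omega>) \<omega>"
      by (rule nn_cond_exp_sum) measurable
    moreover have "AE \<omega> in M. A \<omega> = nn_cond_exp M G A \<omega>" by (rule nn_cond_exp_F_meas) measurable
    moreover have "AE \<omega> in M. B1 \<omega> * nn_cond_exp M G K3 \<omega> = nn_cond_exp M G (\<lambda>\<omega>. B1 \<omega> * K3 \<omega>) \<omega>"
      by (rule nn_cond_exp_prod) measurable
    moreover have "AE \<omega> in M. B2 \<omega> * nn_cond_exp M G Kk \<omega> = nn_cond_exp M G (\<lambda>\<omega>. B2 \<omega> * Kk \<omega>) \<omega>"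
      by (rule nn_cond_exp_prod) measurable
    ultimately show ?thesis using fin[OF K3m K3f] fin[OF Kkm Kkf]
    proof eventually_elim
      case (elim \<omega>)
      have "A \<omega> + B1 \<omega> * nn_cond_exp M G K3 \<omega> + B2 \<omega> * nn_cond_exp M G Kk \<omega> < \<infinity>"
        using elim(6,7) by (simp add: A_def B1_def B2_def ennreal_mult_less_top)
      then show ?case using elim(1-5) by simp
    qed
  qed
  have meas: "nn_cond_exp M G f \<in> borel_measurable M" for f
    by (rule measurable_from_subalg[OF subalg borel_measurable_nn_cond_exp])
  show ?thesis unfolding G_def[symmetric]
  proof (rule ess_sup_exists[OF prob_space_axioms _ _ Bdfin])
    show "Bd \<in> borel_measurable M" unfolding Bd_def by (rule meas)
    fix f assume "f \<in> {nn_cond_exp M G (\<lambda>\<omega>. ennreal (1 / h (Xh N (\<tau> \<omega>) \<omega>) + Xh N (\<tau> \<omega>) \<omega> ^ m))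
         | \<tau>. \<tau> \<in> interval_stopping_times M F (tn N n) (tn N (Suc n))}"
    then obtain \<tau> where f: "f = nn_cond_exp M G (\<lambda>\<omega>. ennreal (1 / h (Xh N (\<tau> \<omega>) \<omega>) + Xh N (\<tau> \<omega>) \<omega> ^ m))"
      and \<tau>: "AE \<omega> in M. \<tau> \<omega> \<in> {tn N n..tn N (Suc n)}" by (auto simp: interval_stopping_times_def)
    show "f \<in> borel_measurable M" unfolding f by (rule meas)
    define u where "u \<omega> = ennreal (1 / h (Xh N (\<tau> \<omega>) \<omega>) + Xh N (\<tau> \<omega>) \<omega> ^ m)" for \<omega>
    show "AE \<omega> in M. f \<omega> \<le> Bd \<omega>"
    proof (cases "u \<in> borel_measurable M")
      case True
      have "AE \<omega> in M. u \<omega> \<le> R \<omega>" using \<tau> AE_space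
      proof eventually_elim
        case (elim \<omega>)
        then have t: "tn N n \<le> \<tau> \<omega>" "\<tau> \<omega> \<le> tn N (Suc n)" by auto
        show ?case unfolding u_def R_def A_def B1_def B2_def z_def
          by (rule Xh_pathwise[OF N0 k elim(2) t K3[OF elim(2)] Kk[OF elim(2)]])
      qed
      then have "AE \<omega> in M. nn_cond_exp M G u \<omega> \<le> nn_cond_exp M G R \<omega>"
        using True by (intro nn_cond_exp_mono) auto
      then show ?thesis by (simp add: f Bd_def u_def[abs_def])
    next
      case False
      \<comment> \<open>\<open>nn_cond_exp\<close> takes the default value 0 on nonmeasurable
        functions.\<close>
      then have "f = (\<lambda>_. 0)" unfolding f nn_cond_exp_def by (simp add: u_def[abs_def])
      then show ?thesis by simp
    qed
  qed
qed

end

subsection \<open>The transforming functions\<close>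

lemma convex_state_space: "convex (state_space r)"
proof (rule is_interval_convex)
  show "is_interval (state_space r)"
    unfolding is_interval_1 state_space_def
    by (auto intro: order_less_le_trans order_le_less_trans[OF ereal_less_eq(3)[THEN iffD2]])
qed

text \<open>With 1/r read as 0 for infinite r, both cases of the potential density become min x y -
  x y / r.\<close>

definition "inv_r r = (if r = \<infinity> then 0 else 1 / real_of_ereal r)"

lemma potential_density_eq: "potential_density r x y = min x y - inv_r r * (x * y)"
  by (auto simp: potential_density_def inv_r_def min_def max_def algebra_simps)

lemma potential_density_bounds:
  assumes r: "0 < r" and x: "x \<in> state_space r" and y: "y \<in> state_space r"
  shows "0 < potential_density r x y" "potential_density r x y \<le> x"
    "r < \<infinity> \<Longrightarrow> potential_density r x y \<le> real_of_ereal r - x"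
proof -
  have pos: "0 < x" "0 < y" using x y by (auto simp: state_space_def)
  have inv: "0 \<le> inv_r r" using r by (cases r) (auto simp: inv_r_def)
  have lt: "inv_r r * x < 1" "inv_r r * y < 1"
    using r x y by (cases r; auto simp: inv_r_def state_space_def)+
  have "potential_density r x y = min x y * (1 - inv_r r * max x y)"
    unfolding potential_density_eq by (auto simp: min_def max_def algebra_simps)
  then show "0 < potential_density r x y" using pos lt by (simp add: max_def)
  have "0 \<le> inv_r r * (x * y)" using inv pos by simp
  then show "potential_density r x y \<le> x" unfolding potential_density_eq by simp
  assume fin: "r < \<infinity>"
  define R where "R = real_of_ereal r"
  have R: "0 < R" "x < R" "y < R" "inv_r r = 1 / R"
    using fin r x y by (cases r; auto simp: R_def inv_r_def state_space_def)+
  have "potential_density r x y \<le> y * (1 - x / R)"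
    unfolding potential_density_eq R(4) by (simp add: algebra_simps)
  also have "\<dots> \<le> R * (1 - x / R)" using R pos by (intro mult_right_mono) auto
  also have "\<dots> = R - x" using R by (simp add: field_simps)
  finally show "potential_density r x y \<le> real_of_ereal r - x" by (simp add: R_def)
qed

text \<open>The minimum is concave in its first argument and the term x y / r is linear in
  it.\<close>

lemma potential_density_concave:
  assumes "0 \<le> a" "a \<le> 1"
  shows "(1 - a) * potential_density r x y + a * potential_density r t y \<le> potential_density r ((1 - a) * x + a * t) y"
proof -
  have "(1 - a) * min x y + a * min t y \<le> min ((1 - a) * x + a * t) y"
  proof (rule min.boundedI)
    show "(1 - a) * min x y + a * min t y \<le> (1 - a) * x + a * t"
      using assms by (intro add_mono mult_left_mono) auto
    have "(1 - a) * min x y + a * min t y \<le> (1 - a) * y + a * y"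
      using assms by (intro add_mono mult_left_mono) auto
    then show "(1 - a) * min x y + a * min t y \<le> y" by (simp add: algebra_simps)
  qed
  moreover have "(1 - a) * potential_density r x y + a * potential_density r t y
      = ((1 - a) * min x y + a * min t y) - inv_r r * (((1 - a) * x + a * t) * y)"
    unfolding potential_density_eq by (simp add: algebra_simps)
  ultimately show ?thesis unfolding potential_density_eq by linarith
qed

text \<open>Positivity, the linear bounds, concavity and, for infinite r, monotonicity hold for each
  u(., y) and survive integration against f dm; K is the total mass of f dm. The identity function
  is treated directly, with K = 1.\<close>

lemma H_class_properties:
  assumes r: "0 < r" and \<sigma>: "continuous_on (state_space r) \<sigma>" "\<And>x. x \<in> state_space r \<Longrightarrow> 0 < \<sigma> x"
    and h: "h \<in> H_class r \<sigma>"
  obtains K where "\<And>x. x \<in> state_space r \<Longrightarrow> 0 < h x" "\<And>x. x \<in> state_space r \<Longrightarrow> h x \<le> K * x"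
    "\<And>x. x \<in> state_space r \<Longrightarrow> r < \<infinity> \<Longrightarrow> h x \<le> K * (real_of_ereal r - x)"
    "concave_on (state_space r) h" "\<And>x t. r = \<infinity> \<Longrightarrow> x \<in> state_space r \<Longrightarrow> x \<le> t \<Longrightarrow> h x \<le> h t"
proof -
  let ?S = "state_space r"
  show ?thesis
  proof (cases "h \<in> H0_class r \<sigma>")
    case False
    then have ri: "r = \<infinity>" and hx: "\<And>x. x \<in> ?S \<Longrightarrow> h x = x"
      using h by (auto simp: H_class_def split: if_splits)
    have "concave_on ?S h"
    proof -
      have "concave_on ?S (\<lambda>x. x)" using convex_state_space[of r]
        by (simp add: concave_on_iff)
      then show ?thesis using hx convex_state_space[of r] unfolding concave_on_iff convex_def by auto
    qed
    moreover have "t \<in> ?S" if "x \<in> ?S" "x \<le> t" for x t using that ri by (auto simp: state_space_def)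
    ultimately show ?thesis using hx ri
      by (intro that[of 1]) (auto simp: state_space_def)
  next
    case True
    define m where "m = speed_measure r \<sigma>"
    obtain f where fc: "continuous_on ?S f" and fpos: "\<And>y. y \<in> ?S \<Longrightarrow> 0 < f y"
      and fint: "set_integrable m ?S f"
      and hf: "\<And>x. x \<in> ?S \<Longrightarrow> h x = (LINT y:?S|m. potential_density r x y * f y)"
      using True by (auto simp: H0_class_def m_def)
    have Sm[measurable]: "?S \<in> sets borel" using open_state_space by simp
    have sets_m[measurable_cong]: "sets m = sets borel" by (simp add: m_def speed_measure_def)
    \<comment> \<open>f is controlled on (0, r) only; its extension by 0 is Borel.\<close>
    define F where "F y = indicator ?S y *\<^sub>R f y" for y
    have F[measurable]: "F \<in> borel_measurable borel"
      unfolding F_def[abs_def] by (rule borel_measurable_continuous_on_indicator[OF Sm fc])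
    have Fi: "integrable m F" using fint by (simp add: set_integrable_def F_def[abs_def])
    have F0: "0 \<le> F y" for y using fpos by (auto simp: F_def indicator_def intro: less_imp_le)
    have hF: "h x = (\<integral>y. potential_density r x y * F y \<partial>m)" if "x \<in> ?S" for x
      unfolding hf[OF that] set_lebesgue_integral_def F_def by (simp add: mult_ac)
    have ub: "potential_density r x y * F y \<le> x * F y" "0 \<le> potential_density r x y * F y"
      if "x \<in> ?S" for x y
      using potential_density_bounds[OF r that, of y] F0[of y] fpos[of y]
      by (auto simp: F_def indicator_def intro!: mult_right_mono mult_nonneg_nonneg less_imp_le)
    have pm[measurable]: "(\<lambda>y. potential_density r x y) \<in> borel_measurable borel" for x
      unfolding potential_density_eq by measurable
    have ui: "integrable m (\<lambda>y. potential_density r x y * F y)" if x: "x \<in> ?S" for x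
    proof (rule Bochner_Integration.integrable_bound)
      show "integrable m (\<lambda>y. x * F y)" using Fi by simp
      show "AE y in m. norm (potential_density r x y * F y) \<le> norm (x * F y)"
      proof (intro AE_I2)
        fix y show "norm (potential_density r x y * F y) \<le> norm (x * F y)"
          unfolding real_norm_def abs_of_nonneg[OF ub(2)[OF x, of y]] using ub(1)[OF x, of y] by linarith
      qed
    qed measurable
    define K where "K = (\<integral>y. F y \<partial>m)"
    have pos: "0 < h x" if x: "x \<in> ?S" for x
    proof -
      have "0 \<le> h x" unfolding hF[OF x] using ub[OF x] by (intro integral_nonneg_AE AE_I2)
      moreover have "h x \<noteq> 0"
      proof
        assume "h x = 0"
        then have "AE y in m. potential_density r x y * F y = 0"
          unfolding hF[OF x] by (subst (asm) integral_nonneg_eq_0_iff_AE[OF ui[OF x]]) (use ub[OF x] in auto)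
        moreover have "(\<lambda>x. ennreal (2 / (\<sigma> x)\<^sup>2) * indicator ?S x) \<in> borel_measurable borel"
        proof -
          have c: "continuous_on ?S (\<lambda>x. 2 / (\<sigma> x)\<^sup>2)"
            by (intro continuous_intros \<sigma>) (use \<sigma>(2) in fastforce)
          have "(\<lambda>x. ennreal (indicator ?S x *\<^sub>R (2 / (\<sigma> x)\<^sup>2))) \<in> borel_measurable borel"
            using borel_measurable_continuous_on_indicator[OF Sm c] by measurable
          also have "(\<lambda>x. ennreal (indicator ?S x *\<^sub>R (2 / (\<sigma> x)\<^sup>2))) = (\<lambda>x. ennreal (2 / (\<sigma> x)\<^sup>2) * indicator ?S x)"
            by (auto simp: indicator_def fun_eq_iff)
          finally show ?thesis .
        qed
        \<comment> \<open>The density 2/\<sigma>^2 is positive on (0, r), so a null set of the speed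
          measure is Lebesgue null there, which an open nonempty set cannot be.\<close>
        ultimately have "AE y in lborel. 0 < ennreal (2 / (\<sigma> y)\<^sup>2) * indicator ?S y \<longrightarrow> potential_density r x y * F y = 0"
          unfolding m_def speed_measure_def by (subst (asm) AE_density) auto
        then have "AE y in lborel. y \<notin> ?S"
        proof eventually_elim
          case (elim y)
          show ?case
          proof
            assume y: "y \<in> ?S"
            then have "0 < ennreal (2 / (\<sigma> y)\<^sup>2) * indicator ?S y" using \<sigma>(2)[OF y] by simp
            then have "potential_density r x y * F y = 0" using elim by blast
            then show False using potential_density_bounds(1)[OF r x y] fpos[OF y] y by (simp add: F_def)
          qed
        qed
        then have "?S \<in> null_sets lborel" by (subst (asm) AE_iff_null_sets[symmetric]) auto
        then have "negligible ?S" unfolding negligible_iff_null_sets by (rule null_sets_completionI)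
        then have "?S = {}" using open_not_negligible[OF open_state_space] by blast
        then show False using x by blast
      qed
      ultimately show ?thesis by simp
    qed
    have left: "h x \<le> K * x" if x: "x \<in> ?S" for x
    proof -
      have "h x \<le> (\<integral>y. x * F y \<partial>m)" unfolding hF[OF x]
        using ub[OF x] Fi by (intro integral_mono ui x) auto
      then show ?thesis by (simp add: K_def mult.commute)
    qed
    have right: "h x \<le> K * (real_of_ereal r - x)" if x: "x \<in> ?S" and fin: "r < \<infinity>" for x
    proof -
      have "h x \<le> (\<integral>y. (real_of_ereal r - x) * F y \<partial>m)" unfolding hF[OF x]
      proof (rule integral_mono[OF ui[OF x]])
        fix y show "potential_density r x y * F y \<le> (real_of_ereal r - x) * F y"
          using potential_density_bounds(3)[OF r x _ fin, of y] F0[of y]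
          by (cases "y \<in> ?S") (auto simp: F_def intro: mult_right_mono)
      qed (use Fi in simp)
      then show ?thesis by (simp add: K_def mult.commute)
    qed
    have conc: "concave_on ?S h"
      unfolding concave_on_iff
    proof (intro conjI ballI allI impI convex_state_space)
      fix x t u v :: real assume x: "x \<in> ?S" and t: "t \<in> ?S" and u: "0 \<le> u" and v: "0 \<le> v" and uv: "u + v = 1"
      have xt: "u *\<^sub>R x + v *\<^sub>R t \<in> ?S" using convex_state_space[of r] x t u v uv by (auto simp: convex_def)
      have "u * h x + v * h t = (\<integral>y. u * (potential_density r x y * F y) + v * (potential_density r t y * F y) \<partial>m)"
        unfolding hF[OF x] hF[OF t] using ui[OF x] ui[OF t] by simp
      also have "\<dots> \<le> (\<integral>y. potential_density r (u *\<^sub>R x + v *\<^sub>R t) y * F y \<partial>m)"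
      proof (rule integral_mono[OF _ ui[OF xt]])
        fix y
        have "(u * potential_density r x y + v * potential_density r t y) * F y \<le> potential_density r (u *\<^sub>R x + v *\<^sub>R t) y * F y"
          using potential_density_concave[of v r x y t] u v uv F0[of y] by (intro mult_right_mono) (auto simp: eq_diff_eq[symmetric])
        then show "u * (potential_density r x y * F y) + v * (potential_density r t y * F y) \<le> potential_density r (u *\<^sub>R x + v *\<^sub>R t) y * F y"
          by (simp add: algebra_simps)
      qed (use ui[OF x] ui[OF t] in simp)
      also have "\<dots> = h (u *\<^sub>R x + v *\<^sub>R t)" by (rule hF[OF xt, symmetric])
      finally show "u * h x + v * h t \<le> h (u *\<^sub>R x + v *\<^sub>R t)" .
    qed
    have mono: "h x \<le> h t" if ri: "r = \<infinity>" and x: "x \<in> ?S" and xt: "x \<le> t" for x t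
    proof -
      have t: "t \<in> ?S" using x xt ri by (auto simp: state_space_def)
      show ?thesis unfolding hF[OF x] hF[OF t]
      proof (intro integral_mono ui x t mult_right_mono F0)
        fix y show "potential_density r x y \<le> potential_density r t y"
          using xt ri by (auto simp: potential_density_eq inv_r_def)
      qed
    qed
    show ?thesis by (rule that[OF pos left right conc mono])
  qed
qed

theorem theorem3p1:
  fixes r :: ereal and \<sigma> h :: "real \<Rightarrow> real" and x0 T p q C :: real
    and P FP :: "real \<Rightarrow> 'b measure" and XP :: "real \<Rightarrow> 'b \<Rightarrow> real"
    and Q :: "'a measure" and F :: "real \<Rightarrow> 'a measure" and W X :: "real \<Rightarrow> 'a \<Rightarrow> real"
  assumes setting: "standing_setting r \<sigma> P FP XP"
    and h_class: "h \<in> H_class r \<sigma>"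
    and h_C2: "\<And>x. x \<in> state_space r \<Longrightarrow> h differentiable (at x) \<and> deriv h differentiable (at x)"
      "continuous_on (state_space r) (deriv (deriv h))"
    and h_bdd: "bounded (deriv h ` state_space r)" "bounded (deriv (deriv h) ` state_space r)"
    and q: "0 \<le> q" "q < 1"
    and h_third: "\<And>x. x \<in> state_space r \<Longrightarrow> deriv (deriv h) differentiable (at x) \<and>
        \<bar>deriv (deriv (deriv h)) x\<bar> \<le> C * (1 + h x powr (- q))"
    and \<sigma>_bdd: "bounded (\<sigma> ` state_space r)"
    and x0: "x0 \<in> state_space r"
    and Q: "h_transform r \<sigma> h x0 Q F W X"
    and T: "0 < T"
    and p: "0 \<le> p" "p < 1"
  defines "Xh \<equiv> bem r \<sigma> h x0 W T"
  defines "Hx \<equiv> (\<lambda>N n s \<omega>.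
      bem_Hx \<sigma> h (grid T N n) (Xh N (grid T N n) \<omega>) s (Xh N s \<omega>))"
  shows
    "(\<forall>m::nat.
      (SUP N\<in>{2..}. SUP t\<in>{0..T}. \<integral>\<^sup>+ \<omega>.
         (ennreal (1 / h (Xh N t \<omega>))
          + (\<Sum>n<N. \<integral>\<^sup>+ s\<in>{grid T N n..grid T N (Suc n)}.
               ennreal ((\<sigma> (Xh N (grid T N n) \<omega>))\<^sup>2 * h (Xh N s \<omega>) powr (- 2 - p)
                        / (Hx N n s \<omega>)\<^sup>2) \<partial>lborel)
          + ennreal (\<bar>Xh N t \<omega>\<bar> ^ m)) \<partial>Q) < \<infinity>)
     \<and>
     (\<forall>N\<ge>2. \<forall>n<N. \<forall>m::nat. \<exists>Z.
      is_ess_sup Q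
        {nn_cond_exp Q (F (grid T N n))
           (\<lambda>\<omega>. ennreal (1 / h (Xh N (\<tau> \<omega>) \<omega>) + Xh N (\<tau> \<omega>) \<omega> ^ m))
         | \<tau>. \<tau> \<in> interval_stopping_times Q F (grid T N n) (grid T N (Suc n))} Z \<and>
      (AE \<omega> in Q. Z \<omega> < \<infinity>))
     \<and>
     (p \<le> 1 / 2 \<longrightarrow> bounded ((\<lambda>x. deriv (deriv h) x / h x powr (1 - p)) ` state_space r) \<longrightarrow>
      (\<forall>m\<ge>0::real. \<exists>K::real. \<forall>N\<ge>2.
        (\<integral>\<^sup>+ \<omega>. (\<Sum>n<N. \<integral>\<^sup>+ s\<in>{grid T N n..grid T N (Suc n)}.
           ennreal ((1 - exp ((s - grid T N n) * (\<sigma> (Xh N (grid T N n) \<omega>))\<^sup>2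
                        * (deriv (deriv h) (Xh N (grid T N n) \<omega>) / (2 * h (Xh N (grid T N n) \<omega>)))))
                    * ((\<sigma> (Xh N (grid T N n) \<omega>))\<^sup>2 * (h (Xh N s \<omega>) powr (- p) + Xh N s \<omega> powr m)
                        / (Hx N n s \<omega>)\<^sup>2)) \<partial>lborel) \<partial>Q)
        < ennreal (K * T / real N)))"
proof -
  let ?S = "state_space r"
  have r: "0 < r" and adm: "admissible_coefficient r \<sigma>" using setting by (auto simp: standing_setting_def)
  have \<sigma>_pos: "0 < \<sigma> x" and \<sigma>_diff: "\<sigma> differentiable (at x)" if "x \<in> ?S" for x
    using adm that by (auto simp: admissible_coefficient_def)
  have \<sigma>_cont: "continuous_on ?S \<sigma>"
    by (intro continuous_at_imp_continuous_on ballI differentiable_imp_continuous_within \<sigma>_diff)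
  obtain K where K: "\<And>x. x \<in> ?S \<Longrightarrow> 0 < h x" "\<And>x. x \<in> ?S \<Longrightarrow> h x \<le> K * x"
    "\<And>x. x \<in> ?S \<Longrightarrow> r < \<infinity> \<Longrightarrow> h x \<le> K * (real_of_ereal r - x)"
    "concave_on ?S h" "\<And>x t. r = \<infinity> \<Longrightarrow> x \<in> ?S \<Longrightarrow> x \<le> t \<Longrightarrow> h x \<le> h t"
    using H_class_properties[OF r \<sigma>_cont \<sigma>_pos h_class] by blast
  obtain L1 where L1: "\<And>x. x \<in> ?S \<Longrightarrow> \<bar>deriv h x\<bar> \<le> L1" using h_bdd(1) by (auto simp: bounded_iff)
  obtain L2 where L2: "\<And>x. x \<in> ?S \<Longrightarrow> \<bar>deriv (deriv h) x\<bar> \<le> L2" using h_bdd(2) by (auto simp: bounded_iff)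
  obtain Sg where Sg: "\<And>x. x \<in> ?S \<Longrightarrow> \<bar>\<sigma> x\<bar> \<le> Sg" using \<sigma>_bdd by (auto simp: bounded_iff)
  define L where "L = max K (max L1 L2)"
  have D1: "(h has_real_derivative deriv h x) (at x)" and D2: "(deriv h has_real_derivative deriv (deriv h) x) (at x)"
    and D3: "(deriv (deriv h) has_real_derivative deriv (deriv (deriv h)) x) (at x)" if "x \<in> ?S" for x
    using h_C2(1)[OF that] h_third[OF that] by (auto simp: DERIV_deriv_iff_real_differentiable)
  \<comment> \<open>Concavity enters the locale in this form; it is the tangent inequality for the
    convex function -h.\<close>
  have tangent: "h t \<le> h x + deriv h x * (t - x)" if x: "x \<in> ?S" and t: "t \<in> ?S" for x t
  proof -
    have "- deriv h x * (t - x) \<le> - h t - (- h x)"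
    proof (rule convex_on_imp_above_tangent)
      show "convex_on ?S (\<lambda>x. - h x)" using K(4) by (simp add: concave_on_def)
      show "((\<lambda>x. - h x) has_real_derivative - deriv h x) (at x within ?S)"
        by (rule DERIV_minus[OF has_field_derivative_at_within[OF D1[OF x]]])
    qed (use x t open_state_space convex_state_space in \<open>auto simp: interior_open intro: convex_connected\<close>)
    then show ?thesis by simp
  qed
  interpret bem_scheme r h "deriv h" "deriv (deriv h)" "deriv (deriv (deriv h))" L C q \<sigma> x0 T Sg Q F W
  proof
    fix x t assume x: "x \<in> ?S"
    show "\<bar>deriv h x\<bar> \<le> L" using L1[OF x] by (simp add: L_def)
    show "\<bar>deriv (deriv h) x\<bar> \<le> L" using L2[OF x] by (simp add: L_def)
    have x0: "0 < x" using x by (simp add: state_space_def)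
    have "K * x \<le> L * x" using x0 by (intro mult_right_mono) (auto simp: L_def)
    then show "h x \<le> L * x" using K(2)[OF x] by linarith
    show "h x \<le> L * (real_of_ereal r - x)" if fin: "r < \<infinity>"
    proof -
      have "x < real_of_ereal r" using x fin r by (cases r) (auto simp: state_space_def)
      then have "K * (real_of_ereal r - x) \<le> L * (real_of_ereal r - x)" by (intro mult_right_mono) (auto simp: L_def)
      then show ?thesis using K(3)[OF x fin] by linarith
    qed
    show "\<sigma> x \<le> Sg" using Sg[OF x] by linarith
  qed (use r K q h_third tangent D1 D2 D3 \<sigma>_pos \<sigma>_cont x0 T Q in \<open>auto simp: h_transform_def\<close>)
  show ?thesis
  proof (intro conjI allI impI, goal_cases)
    case (1 m)
    show ?case using bem_moments_bounded[OF p, of m] unfolding Bterm_def Hx_def Xh_def .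
  next
    case (2 N n m)
    then show ?case unfolding Xh_def by (intro bem_conditional_moments_finite)
  next
    case (3 m)
    then show ?case unfolding Hx_def Xh_def by (intro bem_error_integral_bound[OF p(1)])
  qed
qed

end
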